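(* Let $R$ be a commutative Noetherian local ring with residue field $k$, and let $\mathfrak{X}$ be a prethick subcategory of $\operatorname{mod} R$. Suppose there exists a finitely generated $R$-module $M$ satisfying the following two conditions: (1) $\operatorname{depth} R \geq \operatorname{depth}_R M + 1$; (2) $M/(x_1,\ldots,x_i)M$ is in $\mathfrak{X}$ for all $i = 0,\ldots,\operatorname{depth}_R M + 1$ and all $R$-regular sequences $x_1,\ldots,x_i$. Then $\mathfrak{X}$ contains $k$.
   Context: $R$ is a commutative Noetherian local ring with maximal ideal $\mathfrak{m}$ and residue field $k = R/\mathfrak{m}$, and $\operatorname{mod} R$ denotes the category of finitely generated $R$-modules. A full subcategory $\mathfrak{X}$ of $\operatorname{mod} R$ is called prethick if: (a) it is closed under isomorphisms: if $M\in\mathfrak{X}$ and $N\in\operatorname{mod} R$ is isomorphic to $M$, then $N\in\mathfrak{X}$; (b) it is closed under finite direct sums: if $M_1,\ldots,M_n\in\mathfrak{X}$, then $M_1\oplus\cdots\oplus M_n\in\mathfrak{X}$; (c) it is closed under direct summands: if $M\in\mathfrak{X}$ and $N$ is a direct summand of $M$, then $N\in\mathfrak{X}$; (d) it is closed under kernels of epimorphisms: for any exact sequence $0\to L\to M\to N\to 0$ in $\operatorname{mod} R$, if $M,N\in\mathfrak{X}$ then $L\in\mathfrak{X}$; (e) it is closed under cokernels of monomorphisms: for any exact sequence $0\to L\to M\to N\to 0$ in $\operatorname{mod} R$, if $L,M\in\mathfrak{X}$ then $N\in\mathfrak{X}$. (Closure under extensions is not required.) Conventions: regular sequences consist of elements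 of $\mathfrak{m}$; for $i=0$ the sequence is empty and $M/(x_1,\ldots,x_i)M = M$; the zero module has depth $\infty$. *)

theory Defs
  imports "HOL-Algebra.Algebra" "HOL-Library.Extended_Nat"
begin

section \<open>Noetherian local rings\<close>

definition noetherian_local_ring :: "('a, 'r) ring_scheme \<Rightarrow> bool" where
  "noetherian_local_ring R \<longleftrightarrow>
     cring R \<and> noetherian_ring R \<and> (\<exists>!m. maximalideal m R)"

definition max_ideal :: "('a, 'r) ring_scheme \<Rightarrow> 'a set" where
  "max_ideal R = (THE m. maximalideal m R)"


section \<open>Finitely generated modules\<close>

definition mod_span :: "('a, 'r) ring_scheme \<Rightarrow> ('a, 'b) module \<Rightarrow> 'b set \<Rightarrow> 'b set" where
  "mod_span R M S = \<Inter>{H. submodule H R M \<and> S \<subseteq> H}"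

text \<open>
  The objects of mod R whose elements live in the type \<open>'b\<close>. HOL cannot collect modules over all
  carrier types into one set. But if \<open>'b\<close> is infinite and admits an injection from the carrier
  of \<open>R\<close> (for instance if \<open>'b\<close> is \<open>'a list\<close>), then every finitely generated
  \<open>R\<close>-module is isomorphic to one in this set, since it is a quotient of a finite power of
  \<open>R\<close>. For such \<open>'b\<close> the set is a skeleton-containing full subcategory, equivalent to mod R.
\<close>
definition fg_modules :: "('a, 'r) ring_scheme \<Rightarrow> ('a, 'b) module set" where
  "fg_modules R =
     {M. module R M \<and> (\<exists>S \<subseteq> carrier M. finite S \<and> mod_span R M S = carrier M)}"

definition module_hom ::
  "('a, 'r) ring_scheme \<Rightarrow> ('a, 'b) module \<Rightarrow> ('a, 'c) module \<Rightarrow> ('b \<Rightarrow> 'c) set" where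
  "module_hom R M N =
     {f \<in> hom (add_monoid M) (add_monoid N).
        \<forall>a \<in> carrier R. \<forall>x \<in> carrier M. f (a \<odot>\<^bsub>M\<^esub> x) = a \<odot>\<^bsub>N\<^esub> f x}"

definition module_iso ::
  "('a, 'r) ring_scheme \<Rightarrow> ('a, 'b) module \<Rightarrow> ('a, 'c) module \<Rightarrow> bool" where
  "module_iso R M N \<longleftrightarrow> (\<exists>f \<in> module_hom R M N. bij_betw f (carrier M) (carrier N))"

definition short_exact_modules ::
  "('a, 'r) ring_scheme \<Rightarrow> ('a, 'b) module \<Rightarrow> ('a, 'c) module \<Rightarrow> ('a, 'd) module
     \<Rightarrow> ('b \<Rightarrow> 'c) \<Rightarrow> ('c \<Rightarrow> 'd) \<Rightarrow> bool" where
  "short_exact_modules R L M N f g \<longleftrightarrow>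
     f \<in> module_hom R L M \<and> g \<in> module_hom R M N \<and>
     inj_on f (carrier L) \<and>
     f ` carrier L = a_kernel M N g \<and>
     g ` carrier M = carrier N"

text \<open>
  Modules are records extending rings; the ring multiplication and unit fields play no role in
  the locale \<open>module\<close> and are left unspecified in the constructions below.
\<close>

definition direct_sum :: "('a, 'b) module list \<Rightarrow> ('a, 'b list) module" where
  "direct_sum Ms =
     \<lparr>carrier = {xs. length xs = length Ms \<and> (\<forall>i < length Ms. xs ! i \<in> carrier (Ms ! i))},
      monoid.mult = undefined, one = undefined,
      ring.zero = map (\<lambda>M. \<zero>\<^bsub>M\<^esub>) Ms,
      add = (\<lambda>xs ys. map (\<lambda>i. xs ! i \<oplus>\<^bsub>Ms ! i\<^esub> ys ! i) [0..<length Ms]),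
      smult = (\<lambda>a xs. map (\<lambda>i. a \<odot>\<^bsub>Ms ! i\<^esub> xs ! i) [0..<length Ms])\<rparr>"

definition quot_module :: "('a, 'b) module \<Rightarrow> 'b set \<Rightarrow> ('a, 'b set) module" where
  "quot_module M N =
     \<lparr>carrier = a_rcosets\<^bsub>M\<^esub> N,
      monoid.mult = undefined, one = undefined,
      ring.zero = N,
      add = set_add M,
      smult = (\<lambda>a A. \<Union>x \<in> A. N +>\<^bsub>M\<^esub> (a \<odot>\<^bsub>M\<^esub> x))\<rparr>"

definition ring_module :: "('a, 'r) ring_scheme \<Rightarrow> ('a, 'a) module" where
  "ring_module R =
     \<lparr>carrier = carrier R, monoid.mult = monoid.mult R, one = monoid.one R, ring.zero = ring.zero R, add = ring.add R,
      smult = monoid.mult R\<rparr>"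

definition residue_field :: "('a, 'r) ring_scheme \<Rightarrow> ('a, 'a set) module" where
  "residue_field R = quot_module (ring_module R) (max_ideal R)"

definition ideal_smult ::
  "('a, 'r) ring_scheme \<Rightarrow> 'a set \<Rightarrow> ('a, 'b) module \<Rightarrow> 'b set" where
  "ideal_smult R I M = mod_span R M {a \<odot>\<^bsub>M\<^esub> y | a y. a \<in> I \<and> y \<in> carrier M}"

definition quot_seq ::
  "('a, 'r) ring_scheme \<Rightarrow> ('a, 'b) module \<Rightarrow> 'a list \<Rightarrow> ('a, 'b set) module" where
  "quot_seq R M xs = quot_module M (ideal_smult R (Idl\<^bsub>R\<^esub> (set xs)) M)"


section \<open>Regular sequences and depth\<close>

definition regular_seq ::
  "('a, 'r) ring_scheme \<Rightarrow> ('a, 'b) module \<Rightarrow> 'a list \<Rightarrow> bool" where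
  "regular_seq R M xs \<longleftrightarrow>
     set xs \<subseteq> max_ideal R \<and>
     (\<forall>i < length xs. \<forall>y \<in> carrier (quot_seq R M (take i xs)).
        xs ! i \<odot>\<^bsub>quot_seq R M (take i xs)\<^esub> y = \<zero>\<^bsub>quot_seq R M (take i xs)\<^esub>
          \<longrightarrow> y = \<zero>\<^bsub>quot_seq R M (take i xs)\<^esub>) \<and>
     carrier (quot_seq R M xs) \<noteq> {\<zero>\<^bsub>quot_seq R M xs\<^esub>}"

text \<open>The zero module has no regular sequence in the above sense, hence the separate case.\<close>
definition depth :: "('a, 'r) ring_scheme \<Rightarrow> ('a, 'b) module \<Rightarrow> enat" where
  "depth R M =
     (if carrier M = {\<zero>\<^bsub>M\<^esub>} then \<infinity>
      else Sup {enat (length xs) | xs. regular_seq R M xs})"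


section \<open>Prethick subcategories\<close>

text \<open>
  A full subcategory is given by its set of objects. Direct sums (of at least one module) and
  summands are taken up to isomorphism, because \<^const>\<open>direct_sum\<close> changes the type of
  elements.
\<close>
definition prethick :: "('a, 'r) ring_scheme \<Rightarrow> ('a, 'b) module set \<Rightarrow> bool" where
  "prethick R \<XX> \<longleftrightarrow>
     \<XX> \<subseteq> fg_modules R \<and>
     (\<forall>M \<in> \<XX>. \<forall>N \<in> fg_modules R. module_iso R N M \<longrightarrow> N \<in> \<XX>) \<and>
     (\<forall>Ms. \<forall>N \<in> fg_modules R.
        Ms \<noteq> [] \<and> set Ms \<subseteq> \<XX> \<and> module_iso R N (direct_sum Ms) \<longrightarrow> N \<in> \<XX>) \<and>
     (\<forall>M \<in> \<XX>. \<forall>N \<in> fg_modules R. \<forall>N' \<in> fg_modules R.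
        module_iso R M (direct_sum [N, N']) \<longrightarrow> N \<in> \<XX>) \<and>
     (\<forall>L \<in> fg_modules R. \<forall>M \<in> \<XX>. \<forall>N \<in> \<XX>. \<forall>f g.
        short_exact_modules R L M N f g \<longrightarrow> L \<in> \<XX>) \<and>
     (\<forall>L \<in> \<XX>. \<forall>M \<in> \<XX>. \<forall>N \<in> fg_modules R. \<forall>f g.
        short_exact_modules R L M N f g \<longrightarrow> N \<in> \<XX>)"

text \<open>
  Membership of a module with elements of another type: some isomorphic copy is in \<open>\<XX>\<close>. For
  \<open>\<XX>\<close> closed under isomorphisms and \<open>N\<close> with elements in \<open>'b\<close> this is \<open>N \<in> \<XX>\<close>.
\<close>
definition contains_module ::
  "('a, 'r) ring_scheme \<Rightarrow> ('a, 'b) module set \<Rightarrow> ('a, 'c) module \<Rightarrow> bool" where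
  "contains_module R \<XX> N \<longleftrightarrow> (\<exists>N' \<in> \<XX>. module_iso R N N')"

end

theory Submission
  imports Defs
begin

text \<open>
  Write \<open>\<mm>\<close> for the maximal ideal. All quotients that occur are of the form \<open>M / U\<close>, and almost the
  whole argument speaks of \<open>M\<close> and the submodule \<open>U\<close> instead. The pair is called socle free if no
  nonzero element of \<open>M / U\<close> is killed by \<open>\<mm>\<close>; this says that \<open>M / U\<close> has positive depth or is zero.

  The problem is reduced to depth zero as follows. Choose a sequence \<open>xs\<close> in \<open>\<mm>\<close> that is regular on
  \<open>R\<close> and on \<open>M\<close> and cannot be prolonged with this property (\<open>common_maximal_nzd_seq\<close>). If \<open>R / (xs)\<close>
  and \<open>M / (xs) M\<close> were both socle free, prime avoidance would give an element of \<open>\<mm>\<close> that is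
  regular on both (\<open>common_nzd_in_coset\<close>), and \<open>xs\<close> could be prolonged. The length of \<open>xs\<close> is at
  most depth \<open>M\<close>, hence less than depth \<open>R\<close>. By the theorem of Rees, all maximal regular sequences
  have the same length (\<open>nzd_seq_length_le\<close>), so \<open>R / (xs)\<close> is still socle free. Hence
  \<open>A = M / (xs) M\<close> is not. Rees's theorem also shows that depth \<open>R\<close> is finite; so depth \<open>M\<close> is
  finite and \<open>M\<close> is nonzero.

  Now let \<open>I = (xs)\<close>. For every \<open>z \<in> \<mm>\<close> that is regular on \<open>R / I\<close>, the sequence \<open>xs, z\<close> is regular on \<open>R\<close>
  and of length at most depth \<open>M\<close> plus one. So \<open>A\<close> and \<open>A / z A\<close> belong to the subcategory, and with
  them the kernel \<open>z A\<close> of the projection. If \<open>y\<close> is regular on \<open>R / I\<close> too, then so is \<open>y z\<close>, and the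
  kernel \<open>V\<close> of the surjection \<open>y : z A \<rightarrow> y z A\<close> belongs to the subcategory. It remains to choose \<open>z\<close>
  and \<open>y\<close> such that \<open>V\<close> is a nonzero vector space over the residue field
  (\<open>nzd_with_vector_space_kernel\<close>), because the residue field is a direct summand of every such
  \<open>V\<close> (\<open>cyclic_complement\<close>).

  For the choice let \<open>L\<close> be the submodule of the elements of \<open>A\<close> that are killed by a power of \<open>\<mm>\<close>.
  It is nonzero, \<open>A / L\<close> is socle free, and so some element of \<open>\<mm>\<close> is regular on both \<open>R / I\<close> and
  \<open>A / L\<close>. A suitable power \<open>y\<close> of it kills \<open>L\<close>. If \<open>z\<close> is regular on \<open>A / L\<close> as well, then \<open>V = z L\<close>. If
  \<open>\<mm> z L\<close> is not zero, say \<open>a z L \<noteq> 0\<close> with \<open>a \<in> \<mm>\<close>, prime avoidance in the coset \<open>a + R y\<close> gives an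
  element that is regular on both quotients and acts on \<open>L\<close> like \<open>a\<close>; multiply \<open>z\<close> by it. As a power
  of \<open>\<mm>\<close> kills \<open>L\<close>, this process, started at \<open>z = 1\<close>, ends with \<open>z L \<noteq> 0\<close> and \<open>\<mm> z L = 0\<close>.
\<close>

section \<open>Submodules and elements that are regular modulo a submodule\<close>

text \<open>
  This submodule \<open>U + x M\<close> stands for the quotient \<open>(M / U) / x (M / U)\<close>. Replacing quotients of
  quotients by larger submodules of one module \<open>M\<close> keeps the carrier type fixed.
\<close>
definition add_mult :: "('a, 'b) module \<Rightarrow> 'b set \<Rightarrow> 'a \<Rightarrow> 'b set" where
  "add_mult M U x = {u \<oplus>\<^bsub>M\<^esub> x \<odot>\<^bsub>M\<^esub> w | u w. u \<in> U \<and> w \<in> carrier M}"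

definition add_cyclic :: "('a, 'r) ring_scheme \<Rightarrow> ('a, 'b) module \<Rightarrow> 'b set \<Rightarrow> 'b \<Rightarrow> 'b set" where
  "add_cyclic R M U v = {u \<oplus>\<^bsub>M\<^esub> a \<odot>\<^bsub>M\<^esub> v | u a. u \<in> U \<and> a \<in> carrier R}"

fun add_mults :: "('a, 'b) module \<Rightarrow> 'b set \<Rightarrow> 'a list \<Rightarrow> 'b set" where
  "add_mults M U [] = U"
| "add_mults M U (x # xs) = add_mults M (add_mult M U x) xs"

text \<open>
  That is, \<open>x\<close> is not a zero divisor on \<open>M / U\<close>.
\<close>
definition nzd_mod :: "('a, 'b) module \<Rightarrow> 'b set \<Rightarrow> 'a \<Rightarrow> bool" where
  "nzd_mod M U x \<longleftrightarrow> (\<forall>v \<in> carrier M. x \<odot>\<^bsub>M\<^esub> v \<in> U \<longrightarrow> v \<in> U)"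

text \<open>
  The sequence is regular on \<open>M / U\<close> up to the condition that the final quotient be nonzero,
  which Nakayama's lemma supplies for sequences in the maximal ideal.
\<close>
fun nzd_seq :: "('a, 'b) module \<Rightarrow> 'b set \<Rightarrow> 'a list \<Rightarrow> bool" where
  "nzd_seq M U [] \<longleftrightarrow> True"
| "nzd_seq M U (x # xs) \<longleftrightarrow> nzd_mod M U x \<and> nzd_seq M (add_mult M U x) xs"

text \<open>
  Modules as plain records without further fields, the type for which \<open>mod_span\<close> and everything
  built on it is defined.
\<close>
locale pure_module = module R M
  for R :: "('a, 'r) ring_scheme" (structure) and M :: "('a, 'b) module" (structure)
begin

lemma submodule_zero: "submodule H R M \<Longrightarrow> \<zero>\<^bsub>M\<^esub> \<in> H"
  using submodule.axioms(1) subgroup.one_closed by fastforce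

lemma submodule_carrier: "submodule H R M \<Longrightarrow> x \<in> H \<Longrightarrow> x \<in> carrier M"
  using submoduleE(1) by blast

lemma submodule_minus:
  "submodule H R M \<Longrightarrow> a \<in> H \<Longrightarrow> b \<in> H \<Longrightarrow> a \<ominus>\<^bsub>M\<^esub> b \<in> H"
  by (simp add: a_minus_def submoduleE)

lemma submodule_add_cancel:
  assumes "submodule H R M" "u \<in> H" "w \<in> carrier M" "u \<oplus>\<^bsub>M\<^esub> w \<in> H"
  shows "w \<in> H"
proof -
  have "u \<in> carrier M" using assms submodule_carrier by blast
  then have "w = (u \<oplus>\<^bsub>M\<^esub> w) \<ominus>\<^bsub>M\<^esub> u"
    using assms(3) by (simp add: a_minus_def M.add.m_comm M.r_neg1)
  then show ?thesis using submodule_minus[OF assms(1,4,2)] by simp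
qed

lemma smult_minus_distr:
  "a \<in> carrier R \<Longrightarrow> v \<in> carrier M \<Longrightarrow> w \<in> carrier M \<Longrightarrow>
   a \<odot>\<^bsub>M\<^esub> (v \<ominus>\<^bsub>M\<^esub> w) = a \<odot>\<^bsub>M\<^esub> v \<ominus>\<^bsub>M\<^esub> a \<odot>\<^bsub>M\<^esub> w"
  by (simp add: a_minus_def smult_r_distr smult_r_minus)

lemma smult_commute:
  "a \<in> carrier R \<Longrightarrow> b \<in> carrier R \<Longrightarrow> v \<in> carrier M \<Longrightarrow>
   a \<odot>\<^bsub>M\<^esub> (b \<odot>\<^bsub>M\<^esub> v) = b \<odot>\<^bsub>M\<^esub> (a \<odot>\<^bsub>M\<^esub> v)"
  by (metis R.m_comm smult_assoc1)

lemma zero_submodule: "submodule {\<zero>\<^bsub>M\<^esub>} R M"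
  by (rule submoduleI) auto

lemma submodule_Inter:
  assumes "\<And>H. H \<in> C \<Longrightarrow> submodule H R M" "C \<noteq> {}"
  shows "submodule (\<Inter>C) R M"
proof (rule submoduleI)
  show "\<Inter>C \<subseteq> carrier M" using assms submoduleE(1) by blast
qed (use assms in \<open>auto intro: submodule_zero submoduleE\<close>)

lemma submodule_inter:
  assumes "submodule H R M" "submodule K R M"
  shows "submodule (H \<inter> K) R M"
  using submodule_Inter[of "{H, K}"] assms by auto

lemma mod_span_submodule:
  assumes "S \<subseteq> carrier M"
  shows "submodule (mod_span R M S) R M"
  unfolding mod_span_def
  by (rule submodule_Inter) (use assms carrier_is_submodule in auto)

lemma mod_span_contains: "S \<subseteq> mod_span R M S"
  unfolding mod_span_def by auto

lemma mod_span_least: "submodule H R M \<Longrightarrow> S \<subseteq> H \<Longrightarrow> mod_span R M S \<subseteq> H"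
  unfolding mod_span_def by auto

lemma add_multI: "u \<in> U \<Longrightarrow> w \<in> carrier M \<Longrightarrow> u \<oplus>\<^bsub>M\<^esub> x \<odot>\<^bsub>M\<^esub> w \<in> add_mult M U x"
  unfolding add_mult_def by blast

lemma add_multE:
  assumes "v \<in> add_mult M U x"
  obtains u w where "u \<in> U" "w \<in> carrier M" "v = u \<oplus>\<^bsub>M\<^esub> x \<odot>\<^bsub>M\<^esub> w"
  using assms unfolding add_mult_def by blast

lemma add_mult_submodule:
  assumes U: "submodule U R M" and x: "x \<in> carrier R"
  shows "submodule (add_mult M U x) R M"
proof (rule submoduleI)
  note c = submodule_carrier[OF U]
  show "add_mult M U x \<subseteq> carrier M"
    using c x by (auto elim!: add_multE)
  show "\<zero>\<^bsub>M\<^esub> \<in> add_mult M U x"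
    using add_multI[of "\<zero>\<^bsub>M\<^esub>" U "\<zero>\<^bsub>M\<^esub>" x] submodule_zero[OF U] x by simp
  show "\<ominus>\<^bsub>M\<^esub> a \<in> add_mult M U x" if "a \<in> add_mult M U x" for a
  proof -
    from that obtain u w where *: "u \<in> U" "w \<in> carrier M" "a = u \<oplus>\<^bsub>M\<^esub> x \<odot>\<^bsub>M\<^esub> w"
      by (rule add_multE)
    then have "\<ominus>\<^bsub>M\<^esub> a = \<ominus>\<^bsub>M\<^esub> u \<oplus>\<^bsub>M\<^esub> x \<odot>\<^bsub>M\<^esub> (\<ominus>\<^bsub>M\<^esub> w)"
      using c x by (simp add: M.minus_add smult_r_minus)
    then show ?thesis using add_multI[of "\<ominus>\<^bsub>M\<^esub> u" U "\<ominus>\<^bsub>M\<^esub> w" x] * submoduleE(3)[OF U] by simp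
  qed
  show "a \<oplus>\<^bsub>M\<^esub> b \<in> add_mult M U x" if ab: "a \<in> add_mult M U x" "b \<in> add_mult M U x" for a b
  proof -
    from ab(1) obtain u w where 1: "u \<in> U" "w \<in> carrier M" "a = u \<oplus>\<^bsub>M\<^esub> x \<odot>\<^bsub>M\<^esub> w"
      by (rule add_multE)
    from ab(2) obtain u' w' where 2: "u' \<in> U" "w' \<in> carrier M" "b = u' \<oplus>\<^bsub>M\<^esub> x \<odot>\<^bsub>M\<^esub> w'"
      by (rule add_multE)
    have "a \<oplus>\<^bsub>M\<^esub> b = (u \<oplus>\<^bsub>M\<^esub> u') \<oplus>\<^bsub>M\<^esub> x \<odot>\<^bsub>M\<^esub> (w \<oplus>\<^bsub>M\<^esub> w')"
      using 1 2 c x by (simp add: smult_r_distr M.a_ac)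
    then show ?thesis
      using add_multI[of "u \<oplus>\<^bsub>M\<^esub> u'" U "w \<oplus>\<^bsub>M\<^esub> w'" x] 1 2 submoduleE(5)[OF U] by simp
  qed
  show "a \<odot>\<^bsub>M\<^esub> v \<in> add_mult M U x" if a: "a \<in> carrier R" and v: "v \<in> add_mult M U x" for a v
  proof -
    from v obtain u w where *: "u \<in> U" "w \<in> carrier M" "v = u \<oplus>\<^bsub>M\<^esub> x \<odot>\<^bsub>M\<^esub> w"
      by (rule add_multE)
    then have "a \<odot>\<^bsub>M\<^esub> v = a \<odot>\<^bsub>M\<^esub> u \<oplus>\<^bsub>M\<^esub> x \<odot>\<^bsub>M\<^esub> (a \<odot>\<^bsub>M\<^esub> w)"
      using a c x by (simp add: smult_r_distr smult_commute)
    then show ?thesis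
      using add_multI[of "a \<odot>\<^bsub>M\<^esub> u" U "a \<odot>\<^bsub>M\<^esub> w" x] * a submoduleE(4)[OF U] by simp
  qed
qed

lemma add_mult_superset:
  assumes "submodule U R M" "x \<in> carrier R"
  shows "U \<subseteq> add_mult M U x"
proof
  fix u assume "u \<in> U"
  then show "u \<in> add_mult M U x"
    using add_multI[of u U "\<zero>\<^bsub>M\<^esub>" x] assms submodule_carrier[OF assms(1)] by simp
qed

lemma smult_in_add_mult:
  assumes "submodule U R M" "x \<in> carrier R" "w \<in> carrier M"
  shows "x \<odot>\<^bsub>M\<^esub> w \<in> add_mult M U x"
  using add_multI[of "\<zero>\<^bsub>M\<^esub>" U w x] assms submodule_zero by simp

lemma add_mult_least:
  assumes "submodule K R M" "U \<subseteq> K" "\<And>w. w \<in> carrier M \<Longrightarrow> x \<odot>\<^bsub>M\<^esub> w \<in> K"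
  shows "add_mult M U x \<subseteq> K"
  using assms submoduleE(5)[OF assms(1)] by (auto elim!: add_multE)

lemma add_mult_mono: "U \<subseteq> U' \<Longrightarrow> add_mult M U x \<subseteq> add_mult M U' x"
  unfolding add_mult_def by blast

lemma add_mult_commute:
  assumes U: "submodule U R M" and x: "x \<in> carrier R" and y: "y \<in> carrier R"
  shows "add_mult M (add_mult M U x) y = add_mult M (add_mult M U y) x"
proof -
  have "add_mult M (add_mult M U x) y \<subseteq> add_mult M (add_mult M U y) x"
    if x: "x \<in> carrier R" and y: "y \<in> carrier R" for x y
  proof (rule add_mult_least)
    note s = add_mult_submodule[OF U]
    show s2: "submodule (add_mult M (add_mult M U y) x) R M"
      by (intro add_mult_submodule U x y)
    show "add_mult M U x \<subseteq> add_mult M (add_mult M U y) x"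
      by (intro add_mult_mono add_mult_superset U y)
    show "y \<odot>\<^bsub>M\<^esub> w \<in> add_mult M (add_mult M U y) x" if "w \<in> carrier M" for w
      using add_mult_superset[OF s[OF y] x] smult_in_add_mult[OF U y that] by blast
  qed
  then show ?thesis using x y by blast
qed

lemma add_mults_submodule:
  "submodule U R M \<Longrightarrow> set xs \<subseteq> carrier R \<Longrightarrow> submodule (add_mults M U xs) R M"
  by (induction xs arbitrary: U) (auto simp: add_mult_submodule)

lemma add_mults_superset:
  "submodule U R M \<Longrightarrow> set xs \<subseteq> carrier R \<Longrightarrow> U \<subseteq> add_mults M U xs"
proof (induction xs arbitrary: U)
  case (Cons x xs)
  then have "U \<subseteq> add_mult M U x" "add_mult M U x \<subseteq> add_mults M (add_mult M U x) xs"
    by (auto simp: add_mult_superset add_mult_submodule intro!: Cons.IH)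
  then show ?case by simp
qed simp

lemma add_mults_snoc: "add_mults M U (xs @ [x]) = add_mult M (add_mults M U xs) x"
  by (induction xs arbitrary: U) auto

lemma add_mults_add_mult:
  "submodule U R M \<Longrightarrow> set xs \<subseteq> carrier R \<Longrightarrow> x \<in> carrier R \<Longrightarrow>
   add_mults M (add_mult M U x) xs = add_mult M (add_mults M U xs) x"
proof (induction xs arbitrary: U)
  case (Cons y xs)
  then show ?case by (simp add: add_mult_commute[of U x y] add_mult_submodule)
qed simp

lemma nzd_seq_snoc:
  "nzd_seq M U (xs @ [x]) \<longleftrightarrow> nzd_seq M U xs \<and> nzd_mod M (add_mults M U xs) x"
  by (induction xs arbitrary: U) auto

lemma add_cyclicI: "u \<in> U \<Longrightarrow> a \<in> carrier R \<Longrightarrow> u \<oplus>\<^bsub>M\<^esub> a \<odot>\<^bsub>M\<^esub> v \<in> add_cyclic R M U v"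
  unfolding add_cyclic_def by blast

lemma add_cyclicE:
  assumes "w \<in> add_cyclic R M U v"
  obtains u a where "u \<in> U" "a \<in> carrier R" "w = u \<oplus>\<^bsub>M\<^esub> a \<odot>\<^bsub>M\<^esub> v"
  using assms unfolding add_cyclic_def by blast

lemma add_cyclic_submodule:
  assumes U: "submodule U R M" and v: "v \<in> carrier M"
  shows "submodule (add_cyclic R M U v) R M"
proof (rule submoduleI)
  note c = submodule_carrier[OF U]
  show "add_cyclic R M U v \<subseteq> carrier M"
    using c v by (auto elim!: add_cyclicE)
  show "\<zero>\<^bsub>M\<^esub> \<in> add_cyclic R M U v"
    using add_cyclicI[of "\<zero>\<^bsub>M\<^esub>" U "\<zero>" v] submodule_zero[OF U] v by simp
  show "\<ominus>\<^bsub>M\<^esub> w \<in> add_cyclic R M U v" if "w \<in> add_cyclic R M U v" for w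
  proof -
    from that obtain u a where *: "u \<in> U" "a \<in> carrier R" "w = u \<oplus>\<^bsub>M\<^esub> a \<odot>\<^bsub>M\<^esub> v"
      by (rule add_cyclicE)
    then have "\<ominus>\<^bsub>M\<^esub> w = \<ominus>\<^bsub>M\<^esub> u \<oplus>\<^bsub>M\<^esub> (\<ominus> a) \<odot>\<^bsub>M\<^esub> v"
      using c v by (simp add: M.minus_add smult_l_minus)
    then show ?thesis using add_cyclicI[of "\<ominus>\<^bsub>M\<^esub> u" U "\<ominus> a" v] * submoduleE(3)[OF U] by simp
  qed
  show "w \<oplus>\<^bsub>M\<^esub> w' \<in> add_cyclic R M U v"
    if ab: "w \<in> add_cyclic R M U v" "w' \<in> add_cyclic R M U v" for w w'
  proof -
    from ab(1) obtain u a where 1: "u \<in> U" "a \<in> carrier R" "w = u \<oplus>\<^bsub>M\<^esub> a \<odot>\<^bsub>M\<^esub> v"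
      by (rule add_cyclicE)
    from ab(2) obtain u' a' where 2: "u' \<in> U" "a' \<in> carrier R" "w' = u' \<oplus>\<^bsub>M\<^esub> a' \<odot>\<^bsub>M\<^esub> v"
      by (rule add_cyclicE)
    have "w \<oplus>\<^bsub>M\<^esub> w' = (u \<oplus>\<^bsub>M\<^esub> u') \<oplus>\<^bsub>M\<^esub> (a \<oplus> a') \<odot>\<^bsub>M\<^esub> v"
      using 1 2 c v by (simp add: smult_l_distr M.a_ac)
    then show ?thesis
      using add_cyclicI[of "u \<oplus>\<^bsub>M\<^esub> u'" U "a \<oplus> a'" v] 1 2 submoduleE(5)[OF U] by simp
  qed
  show "b \<odot>\<^bsub>M\<^esub> w \<in> add_cyclic R M U v" if b: "b \<in> carrier R" and w: "w \<in> add_cyclic R M U v" for b w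
  proof -
    from w obtain u a where *: "u \<in> U" "a \<in> carrier R" "w = u \<oplus>\<^bsub>M\<^esub> a \<odot>\<^bsub>M\<^esub> v"
      by (rule add_cyclicE)
    then have "b \<odot>\<^bsub>M\<^esub> w = b \<odot>\<^bsub>M\<^esub> u \<oplus>\<^bsub>M\<^esub> (b \<otimes> a) \<odot>\<^bsub>M\<^esub> v"
      using b c v by (simp add: smult_r_distr smult_assoc1)
    then show ?thesis
      using add_cyclicI[of "b \<odot>\<^bsub>M\<^esub> u" U "b \<otimes> a" v] * b submoduleE(4)[OF U] by simp
  qed
qed

lemma add_cyclic_superset:
  assumes "submodule U R M" "v \<in> carrier M"
  shows "U \<subseteq> add_cyclic R M U v" "v \<in> add_cyclic R M U v"
proof -
  show "U \<subseteq> add_cyclic R M U v"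
  proof
    fix u assume "u \<in> U"
    then show "u \<in> add_cyclic R M U v"
      using add_cyclicI[of u U \<zero> v] assms submodule_carrier[OF assms(1)] by simp
  qed
  show "v \<in> add_cyclic R M U v"
    using add_cyclicI[of "\<zero>\<^bsub>M\<^esub>" U \<one> v] assms submodule_zero[OF assms(1)] by simp
qed

lemma add_cyclic_least:
  assumes "submodule K R M" "U \<subseteq> K" "v \<in> K"
  shows "add_cyclic R M U v \<subseteq> K"
  using assms submoduleE(4,5)[OF assms(1)] by (auto elim!: add_cyclicE)

lemma colon_ideal:
  assumes U: "submodule U R M" and v: "v \<in> carrier M"
  shows "ideal {a \<in> carrier R. a \<odot>\<^bsub>M\<^esub> v \<in> U} R"
proof (rule idealI)
  show "ring R" by (rule R.ring_axioms)
  show "subgroup {a \<in> carrier R. a \<odot>\<^bsub>M\<^esub> v \<in> U} (add_monoid R)"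
    by (rule R.add.subgroupI)
      (use U v in \<open>auto simp: smult_l_distr submodule_zero submoduleE smult_l_minus
         simp flip: a_inv_def intro!: exI[of _ \<zero>]\<close>)
  fix a x assume "a \<in> {a \<in> carrier R. a \<odot>\<^bsub>M\<^esub> v \<in> U}" "x \<in> carrier R"
  then have "x \<otimes> a \<in> {a \<in> carrier R. a \<odot>\<^bsub>M\<^esub> v \<in> U}"
    using U v by (simp add: smult_assoc1 submoduleE)
  then show "x \<otimes> a \<in> {a \<in> carrier R. a \<odot>\<^bsub>M\<^esub> v \<in> U}" "a \<otimes> x \<in> {a \<in> carrier R. a \<odot>\<^bsub>M\<^esub> v \<in> U}"
    using \<open>a \<in> _\<close> \<open>x \<in> _\<close> by (simp_all add: R.m_comm)
qed

end

section \<open>Finitely generated modules over a Noetherian ring\<close>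

context pure_module
begin

lemma diff_add_right_cancel:
  assumes "a \<in> carrier M" "b \<in> carrier M" "c \<in> carrier M"
  shows "(a \<oplus>\<^bsub>M\<^esub> c) \<ominus>\<^bsub>M\<^esub> (b \<oplus>\<^bsub>M\<^esub> c) = a \<ominus>\<^bsub>M\<^esub> b"
proof -
  have "(a \<oplus>\<^bsub>M\<^esub> c) \<ominus>\<^bsub>M\<^esub> (b \<oplus>\<^bsub>M\<^esub> c) = a \<oplus>\<^bsub>M\<^esub> (c \<oplus>\<^bsub>M\<^esub> (\<ominus>\<^bsub>M\<^esub> c \<oplus>\<^bsub>M\<^esub> \<ominus>\<^bsub>M\<^esub> b))"
    using assms by (simp add: a_minus_def M.a_assoc M.minus_add M.a_comm)
  then show ?thesis using assms by (simp add: a_minus_def M.r_neg2)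
qed

text \<open>
  The coefficients of \<open>s\<close> in the elements of \<open>H\<close>, modulo \<open>K\<close>. As for leading coefficients in
  Hilbert's basis theorem, finite generation of this ideal allows to split off the generator
  \<open>s\<close>.
\<close>
lemma leading_coefficient_ideal:
  assumes H: "submodule H R M" and K: "submodule K R M" and s: "s \<in> carrier M"
  shows "ideal {a \<in> carrier R. \<exists>t \<in> K. t \<oplus>\<^bsub>M\<^esub> a \<odot>\<^bsub>M\<^esub> s \<in> H} R" (is "ideal ?J R")
proof (rule idealI)
  note c = submodule_carrier[OF K]
  show "ring R" by (rule R.ring_axioms)
  have smult: "x \<otimes> a \<in> ?J" if "a \<in> ?J" "x \<in> carrier R" for a x
  proof -
    from that obtain t where t: "a \<in> carrier R" "t \<in> K" "t \<oplus>\<^bsub>M\<^esub> a \<odot>\<^bsub>M\<^esub> s \<in> H" by blast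
    have "x \<odot>\<^bsub>M\<^esub> t \<oplus>\<^bsub>M\<^esub> (x \<otimes> a) \<odot>\<^bsub>M\<^esub> s = x \<odot>\<^bsub>M\<^esub> (t \<oplus>\<^bsub>M\<^esub> a \<odot>\<^bsub>M\<^esub> s)"
      using t c that s by (simp add: smult_r_distr smult_assoc1)
    then show ?thesis using t that submoduleE(4)[OF H] submoduleE(4)[OF K] by force
  qed
  show "subgroup ?J (add_monoid R)"
  proof (rule R.add.subgroupI)
    have "\<zero>\<^bsub>M\<^esub> \<oplus>\<^bsub>M\<^esub> \<zero> \<odot>\<^bsub>M\<^esub> s \<in> H" using s submodule_zero[OF H] by simp
    then show "?J \<noteq> {}" using submodule_zero[OF K] by blast
    show "\<ominus> a \<in> ?J" if "a \<in> ?J" for a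
      using smult[of a "\<ominus> \<one>"] that by (simp add: R.l_minus)
    show "a \<oplus> b \<in> ?J" if ab: "a \<in> ?J" "b \<in> ?J" for a b
    proof -
      from ab obtain t where t: "a \<in> carrier R" "t \<in> K" "t \<oplus>\<^bsub>M\<^esub> a \<odot>\<^bsub>M\<^esub> s \<in> H" by blast
      from ab obtain t' where t': "b \<in> carrier R" "t' \<in> K" "t' \<oplus>\<^bsub>M\<^esub> b \<odot>\<^bsub>M\<^esub> s \<in> H" by blast
      have "(t \<oplus>\<^bsub>M\<^esub> t') \<oplus>\<^bsub>M\<^esub> (a \<oplus> b) \<odot>\<^bsub>M\<^esub> s = (t \<oplus>\<^bsub>M\<^esub> a \<odot>\<^bsub>M\<^esub> s) \<oplus>\<^bsub>M\<^esub> (t' \<oplus>\<^bsub>M\<^esub> b \<odot>\<^bsub>M\<^esub> s)"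
        using t t' c s by (simp add: smult_l_distr M.a_ac)
      then have "(t \<oplus>\<^bsub>M\<^esub> t') \<oplus>\<^bsub>M\<^esub> (a \<oplus> b) \<odot>\<^bsub>M\<^esub> s \<in> H" "t \<oplus>\<^bsub>M\<^esub> t' \<in> K"
        using t t' submoduleE(5)[OF H] submoduleE(5)[OF K] by simp_all
      then show ?thesis using t t' by auto
    qed
  qed blast
  show "x \<otimes> a \<in> ?J" "a \<otimes> x \<in> ?J" if "a \<in> ?J" "x \<in> carrier R" for a x
    using smult[OF that] that by (simp_all add: R.m_comm)
qed

text \<open>
  Induction on the number of generators. The submodule \<open>H\<close> is generated by finitely many
  elements whose coefficients at \<open>s\<close> generate the ideal of all such coefficients, together with
  generators of the part of \<open>H\<close> that lies in the span \<open>K\<close> of the other generators.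
\<close>
lemma submodule_of_span_fg:
  assumes R: "noetherian_ring R" and S: "finite S" "S \<subseteq> carrier M"
    and H: "submodule H R M" "H \<subseteq> mod_span R M S"
  shows "\<exists>T \<subseteq> H. finite T \<and> mod_span R M T = H"
  using S H
proof (induction S arbitrary: H rule: finite_induct)
  case empty
  have "mod_span R M {} \<subseteq> {\<zero>\<^bsub>M\<^esub>}" by (rule mod_span_least[OF zero_submodule]) simp
  moreover have "mod_span R M {} \<subseteq> H" by (rule mod_span_least) (use empty in auto)
  ultimately show ?case using empty.prems by blast
next
  case (insert s S)
  note H = insert.prems(2)
  have s: "s \<in> carrier M" and S: "S \<subseteq> carrier M" using insert.prems by auto
  define K where "K = mod_span R M S"
  have K: "submodule K R M" unfolding K_def by (rule mod_span_submodule[OF S])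
  have HK: "H \<subseteq> add_cyclic R M K s"
  proof -
    have "mod_span R M (insert s S) \<subseteq> add_cyclic R M K s"
      using add_cyclic_superset[OF K s] mod_span_contains[of S] unfolding K_def
      by (intro mod_span_least add_cyclic_submodule[OF K[unfolded K_def] s]) auto
    then show ?thesis using insert.prems(3) by blast
  qed
  define J where "J H = {a \<in> carrier R. \<exists>t \<in> K. t \<oplus>\<^bsub>M\<^esub> a \<odot>\<^bsub>M\<^esub> s \<in> H}" for H
  have J: "ideal (J H) R" if "submodule H R M" for H
    unfolding J_def by (rule leading_coefficient_ideal[OF that K s])
  obtain A where A: "A \<subseteq> carrier R" "finite A" "J H = Idl A"
    using noetherian_ring.finetely_gen[OF R J[OF H]] by blast
  then have "A \<subseteq> J H" using R.genideal_self by blast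
  then have "\<forall>a \<in> A. \<exists>h. h \<in> H \<and> (\<exists>t \<in> K. t \<oplus>\<^bsub>M\<^esub> a \<odot>\<^bsub>M\<^esub> s = h)" unfolding J_def by blast
  then obtain h where h: "\<And>a. a \<in> A \<Longrightarrow> h a \<in> H"
    and h': "\<And>a. a \<in> A \<Longrightarrow> \<exists>t \<in> K. t \<oplus>\<^bsub>M\<^esub> a \<odot>\<^bsub>M\<^esub> s = h a" by metis
  have HcK: "submodule (H \<inter> K) R M" by (rule submodule_inter[OF H K])
  then obtain T where T: "T \<subseteq> H \<inter> K" "finite T" "mod_span R M T = H \<inter> K"
    using insert.IH[OF S HcK] unfolding K_def by blast
  define T' where "T' = h ` A \<union> T"
  have T'H: "T' \<subseteq> H" unfolding T'_def using h T by auto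
  then have T'M: "T' \<subseteq> carrier M" using submoduleE(1)[OF H] by blast
  note span = mod_span_submodule[OF T'M]
  have "A \<subseteq> J (mod_span R M T')"
  proof
    fix a assume a: "a \<in> A"
    then have "h a \<in> mod_span R M T'" using mod_span_contains[of T'] unfolding T'_def by blast
    moreover obtain t where t: "t \<in> K" "t \<oplus>\<^bsub>M\<^esub> a \<odot>\<^bsub>M\<^esub> s = h a" using h'[OF a] by blast
    moreover have "a \<in> carrier R" using a A(1) by blast
    ultimately show "a \<in> J (mod_span R M T')" unfolding J_def by (auto intro!: bexI[of _ t])
  qed
  then have JJ: "J H \<subseteq> J (mod_span R M T')"
    unfolding A(3) by (rule R.genideal_minimal[OF J[OF span]])
  have TT: "H \<inter> K \<subseteq> mod_span R M T'"
  proof -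
    have "mod_span R M T \<subseteq> mod_span R M T'"
      using mod_span_contains[of T'] unfolding T'_def
      by (intro mod_span_least[OF span[unfolded T'_def]]) auto
    then show ?thesis using T by simp
  qed
  have "H \<subseteq> mod_span R M T'"
  proof
    fix w assume w: "w \<in> H"
    then obtain t a where ta: "t \<in> K" "a \<in> carrier R" "w = t \<oplus>\<^bsub>M\<^esub> a \<odot>\<^bsub>M\<^esub> s"
      using HK by (blast elim: add_cyclicE)
    then have "a \<in> J H" using w unfolding J_def by blast
    then obtain t' where t': "t' \<in> K" "t' \<oplus>\<^bsub>M\<^esub> a \<odot>\<^bsub>M\<^esub> s \<in> mod_span R M T'"
      using JJ unfolding J_def by blast
    define w' where "w' = t' \<oplus>\<^bsub>M\<^esub> a \<odot>\<^bsub>M\<^esub> s"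
    have w'H: "w' \<in> H" using t' mod_span_least[OF H T'H] unfolding w'_def by blast
    note c = submodule_carrier[OF K ta(1)] submodule_carrier[OF K t'(1)]
    have "w \<ominus>\<^bsub>M\<^esub> w' = t \<ominus>\<^bsub>M\<^esub> t'"
      using c ta(2) s unfolding ta(3) w'_def by (simp add: diff_add_right_cancel)
    then have "w \<ominus>\<^bsub>M\<^esub> w' \<in> H \<inter> K"
      using submodule_minus[OF H w w'H] submodule_minus[OF K ta(1) t'(1)] by simp
    then have "w \<ominus>\<^bsub>M\<^esub> w' \<in> mod_span R M T'" using TT by blast
    then have "(w \<ominus>\<^bsub>M\<^esub> w') \<oplus>\<^bsub>M\<^esub> w' \<in> mod_span R M T'"
      using t'(2) submoduleE(5)[OF span] unfolding w'_def by blast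
    moreover have "(w \<ominus>\<^bsub>M\<^esub> w') \<oplus>\<^bsub>M\<^esub> w' = w"
      using submodule_carrier[OF H w] submodule_carrier[OF H w'H]
      by (simp add: a_minus_def M.a_assoc M.l_neg)
    ultimately show "w \<in> mod_span R M T'" by simp
  qed
  then show ?case
    using T'H mod_span_least[OF H T'H] A(2) T(2) unfolding T'_def
    by (intro exI[of _ "h ` A \<union> T"]) auto
qed

end

locale fg_module = pure_module +
  assumes noetherian: "noetherian_ring R"
    and fg: "\<exists>S \<subseteq> carrier M. finite S \<and> mod_span R M S = carrier M"
begin

lemma submodule_fg: "submodule H R M \<Longrightarrow> \<exists>T \<subseteq> H. finite T \<and> mod_span R M T = H"
  using submodule_of_span_fg[OF noetherian] fg submoduleE(1) by metis

text \<open>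
  The union of a chain of submodules is finitely generated, so it is one of the members of the
  chain, and Zorn's lemma applies to any family of submodules.
\<close>
lemma maximal_submodule_exists:
  assumes sub: "\<And>H. H \<in> C \<Longrightarrow> submodule H R M" and ne: "C \<noteq> {}"
  shows "\<exists>H \<in> C. \<forall>K \<in> C. H \<subseteq> K \<longrightarrow> K = H"
proof (rule subset_Zorn_nonempty[OF ne])
  fix \<C> assume \<C>: "\<C> \<noteq> {}" "subset.chain C \<C>"
  show "\<Union>\<C> \<in> C"
  proof -
    have inC: "\<And>H. H \<in> \<C> \<Longrightarrow> H \<in> C" using \<C>(2) by (auto simp: subset.chain_def)
    have two: "\<exists>H \<in> \<C>. a \<in> H \<and> b \<in> H" if "a \<in> \<Union>\<C>" "b \<in> \<Union>\<C>" for a b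
      using finite_subset_Union_chain[of "{a, b}", OF _ _ \<C>] that by auto
    have U: "submodule (\<Union>\<C>) R M"
    proof (rule submoduleI)
      show "\<Union>\<C> \<subseteq> carrier M" using sub inC submoduleE(1) by blast
      show "\<zero>\<^bsub>M\<^esub> \<in> \<Union>\<C>" using \<C>(1) sub inC submodule_zero by blast
      show "a \<oplus>\<^bsub>M\<^esub> b \<in> \<Union>\<C>" if "a \<in> \<Union>\<C>" "b \<in> \<Union>\<C>" for a b
        using two[OF that] sub inC submoduleE(5) by (meson UnionI)
    qed (use sub inC submoduleE(3,4) in blast)+
    obtain T where T: "T \<subseteq> \<Union>\<C>" "finite T" "mod_span R M T = \<Union>\<C>"
      using submodule_fg[OF U] by blast
    obtain H where H: "H \<in> \<C>" "T \<subseteq> H"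
      using finite_subset_Union_chain[OF T(2,1) \<C>] by blast
    have "\<Union>\<C> \<subseteq> H" using T(3) mod_span_least[OF sub[OF inC] H(2)] H(1) by simp
    then have "\<Union>\<C> = H" using H(1) by blast
    then show ?thesis using inC H(1) by simp
  qed
qed

end

lemma fg_modules_iff:
  "M \<in> fg_modules R \<longleftrightarrow>
    pure_module R M \<and> (\<exists>S \<subseteq> carrier M. finite S \<and> mod_span R M S = carrier M)"
  unfolding fg_modules_def by (simp add: pure_module_def)

lemma fg_moduleI: "noetherian_ring R \<Longrightarrow> M \<in> fg_modules R \<Longrightarrow> fg_module R M"
  unfolding fg_modules_iff by (simp add: fg_module_def fg_module_axioms_def)

section \<open>Prime avoidance and zero divisors\<close>

text \<open>
  If \<open>I\<close> is the maximal ideal of a local ring, this says that the socle of \<open>M / U\<close> is zero.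
\<close>
definition socle_free :: "'a set \<Rightarrow> ('a, 'b) module \<Rightarrow> 'b set \<Rightarrow> bool" where
  "socle_free I M U \<longleftrightarrow> (\<forall>v \<in> carrier M. (\<forall>a \<in> I. a \<odot>\<^bsub>M\<^esub> v \<in> U) \<longrightarrow> v \<in> U)"

lemma nzd_modD: "nzd_mod M U x \<Longrightarrow> v \<in> carrier M \<Longrightarrow> x \<odot>\<^bsub>M\<^esub> v \<in> U \<Longrightarrow> v \<in> U"
  unfolding nzd_mod_def by blast

lemma (in ideal) add_cancel:
  assumes "a \<in> I" "b \<in> carrier R" "a \<oplus> b \<in> I"
  shows "b \<in> I"
proof -
  have "\<ominus> a \<oplus> (a \<oplus> b) \<in> I" by (rule additive_subgroup.a_closed[OF additive_subgroup_axioms]) (use assms in \<open>auto intro: additive_subgroup.a_inv_closed[OF additive_subgroup_axioms]\<close>)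
  then show ?thesis using assms(2) Icarr[OF assms(1)] by (simp add: r_neg1)
qed

text \<open>
  A product of one element outside \<open>P\<close> from each of the ideals does it.
\<close>
lemma (in ring) prime_avoids_intersection:
  assumes P: "primeideal P R" and I: "ideal I R" "\<not> I \<subseteq> P" and fin: "finite \<Q>"
    and Q: "\<And>Q. Q \<in> \<Q> \<Longrightarrow> ideal Q R" "\<And>Q. Q \<in> \<Q> \<Longrightarrow> \<not> Q \<subseteq> P"
  shows "\<exists>d \<in> I. d \<notin> P \<and> (\<forall>Q \<in> \<Q>. d \<in> Q)"
  using fin Q
proof (induction \<Q> rule: finite_induct)
  case empty
  then show ?case using I by blast
next
  case (insert Q \<Q>)
  then obtain d where d: "d \<in> I" "d \<notin> P" "\<forall>Q \<in> \<Q>. d \<in> Q" by blast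
  obtain q where q: "q \<in> Q" "q \<notin> P" using insert.prems(2) by blast
  interpret Q: ideal Q R using insert.prems(1) by blast
  interpret I: ideal I R by (rule I)
  have dc: "d \<in> carrier R" and qc: "q \<in> carrier R" using I.Icarr[OF d(1)] Q.Icarr[OF q(1)] .
  have "d \<otimes> q \<notin> P" using primeideal.I_prime[OF P dc qc] d(2) q(2) by blast
  moreover have "d \<otimes> q \<in> I" by (rule I.I_r_closed[OF d(1) qc])
  moreover have "d \<otimes> q \<in> Q" by (rule Q.I_l_closed[OF q(1) dc])
  moreover have "d \<otimes> q \<in> Q'" if "Q' \<in> \<Q>" for Q'
    using ideal.I_r_closed[OF insert.prems(1)] that d(3) qc by blast
  ultimately show ?case by blast
qed

lemma (in noetherian_ring) maximal_in_ideal_family: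
  assumes "\<And>I. I \<in> C \<Longrightarrow> ideal I R" "C \<noteq> {}"
  shows "\<exists>I \<in> C. \<forall>J \<in> C. I \<subseteq> J \<longrightarrow> J = I"
proof (rule subset_Zorn_nonempty[OF assms(2)])
  fix \<C> assume "\<C> \<noteq> {}" "subset.chain C \<C>"
  moreover from this have "subset.chain {I. ideal I R} \<C>"
    using assms(1) by (auto simp: subset.chain_def)
  ultimately have "\<Union>\<C> \<in> \<C>" using ideal_chain_is_trivial by blast
  then show "\<Union>\<C> \<in> C" using \<open>subset.chain C \<C>\<close> by (auto simp: subset.chain_def)
qed

text \<open>
  Induction on the number of primes, where the prime \<open>P\<close> that is split off is minimal among
  them. If the element \<open>u + i\<close> found for the others lies in \<open>P\<close>, it is corrected by an element \<open>d\<close>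
  of \<open>I\<close> that is in all the other primes but not in \<open>P\<close>. Minimality of \<open>P\<close> ensures that there is
  such a \<open>d\<close>.
\<close>
lemma (in cring) coset_prime_avoidance:
  assumes fin: "finite \<P>" and prime: "\<And>P. P \<in> \<P> \<Longrightarrow> primeideal P R"
    and I: "ideal I R" and nle: "\<And>P. P \<in> \<P> \<Longrightarrow> \<not> I \<subseteq> P" and u: "u \<in> carrier R"
  shows "\<exists>i \<in> I. \<forall>P \<in> \<P>. u \<oplus> i \<notin> P"
  using fin prime nle
proof (induction "card \<P>" arbitrary: \<P>)
  case 0
  then have "\<P> = {}" by simp
  then show ?case using additive_subgroup.zero_closed[OF ideal.axioms(1)[OF I]] by blast
next
  case (Suc n)
  from Suc.hyps(2) Suc.prems(1) have "\<P> \<noteq> {}" by auto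
  then obtain P where P: "P \<in> \<P>" and Pmin: "\<And>Q. Q \<in> \<P> \<Longrightarrow> Q \<subseteq> P \<Longrightarrow> Q = P"
    using finite_has_minimal[OF Suc.prems(1)] by blast
  define \<Q> where "\<Q> = \<P> - {P}"
  have "n = card \<Q>" using Suc.hyps(2) Suc.prems(1) P unfolding \<Q>_def by simp
  then have "\<exists>i \<in> I. \<forall>Q \<in> \<Q>. u \<oplus> i \<notin> Q"
  proof (rule Suc.hyps(1))
    show "finite \<Q>" using Suc.prems(1) by (simp add: \<Q>_def)
    show "primeideal Q R" "\<not> I \<subseteq> Q" if "Q \<in> \<Q>" for Q
      using that by (simp_all add: \<Q>_def Suc.prems)
  qed
  then obtain i where i: "i \<in> I" "\<forall>Q \<in> \<Q>. u \<oplus> i \<notin> Q" by blast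
  note Ic = additive_subgroup.a_Hcarr[OF ideal.axioms(1)[OF I]]
  note Ia = additive_subgroup.a_closed[OF ideal.axioms(1)[OF I]]
  interpret P: primeideal P R by (rule Suc.prems(2)[OF P])
  show ?case
  proof (cases "u \<oplus> i \<in> P")
    case False
    then have "\<forall>Q \<in> \<P>. u \<oplus> i \<notin> Q" using i(2) unfolding \<Q>_def by blast
    then show ?thesis using i(1) by blast
  next
    case True
    have "\<exists>d \<in> I. d \<notin> P \<and> (\<forall>Q \<in> \<Q>. d \<in> Q)"
    proof (rule prime_avoids_intersection[OF P.primeideal_axioms I])
      show "finite \<Q>" using Suc.prems(1) unfolding \<Q>_def by simp
      show "ideal Q R" if "Q \<in> \<Q>" for Q
        using that by (auto simp: \<Q>_def intro: primeideal.axioms(1) Suc.prems(2))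
      show "\<not> Q \<subseteq> P" if "Q \<in> \<Q>" for Q
        using that Pmin[of Q] by (auto simp: \<Q>_def)
      show "\<not> I \<subseteq> P" by (rule Suc.prems(3)[OF P])
    qed
    then obtain d where d: "d \<in> I" "d \<notin> P" "\<forall>Q \<in> \<Q>. d \<in> Q" by blast
    note c = u Ic[OF i(1)] Ic[OF d(1)]
    have "u \<oplus> (i \<oplus> d) \<notin> Q" if Q: "Q \<in> \<P>" for Q
    proof
      assume a: "u \<oplus> (i \<oplus> d) \<in> Q"
      interpret Q: ideal Q R using Suc.prems(2)[OF Q] primeideal.axioms(1) by blast
      have eq: "u \<oplus> (i \<oplus> d) = (u \<oplus> i) \<oplus> d" using c by (simp add: a_assoc)
      show False
      proof (cases "Q = P")
        case True
        then have "d \<in> P"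
          using P.add_cancel[of "u \<oplus> i" d] \<open>u \<oplus> i \<in> P\<close> a c unfolding eq by simp
        then show False using d(2) by blast
      next
        case False
        then have dQ: "d \<in> Q" "u \<oplus> i \<notin> Q" using d(3) i(2) Q unfolding \<Q>_def by auto
        moreover have "d \<oplus> (u \<oplus> i) \<in> Q" using a c unfolding eq by (simp add: a_comm)
        moreover have "u \<oplus> i \<in> carrier R" using c by simp
        ultimately show False using Q.add_cancel[OF dQ(1)] by blast
      qed
    qed
    then show ?thesis by (intro bexI[OF _ Ia[OF i(1) d(1)]] ballI)
  qed
qed

context pure_module
begin

lemma nzd_mod_one: "nzd_mod M U \<one>"
  unfolding nzd_mod_def by simp

lemma nzd_mod_mult:
  assumes "nzd_mod M U x" "nzd_mod M U y" "x \<in> carrier R" "y \<in> carrier R"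
  shows "nzd_mod M U (x \<otimes> y)"
  unfolding nzd_mod_def
proof (intro ballI impI)
  fix v assume v: "v \<in> carrier M" "(x \<otimes> y) \<odot>\<^bsub>M\<^esub> v \<in> U"
  then have "x \<odot>\<^bsub>M\<^esub> (y \<odot>\<^bsub>M\<^esub> v) \<in> U" using assms by (simp add: smult_assoc1)
  then show "v \<in> U" using nzd_modD[OF assms(1)] nzd_modD[OF assms(2)] assms(4) v(1) by blast
qed

lemma nzd_mod_pow:
  assumes "nzd_mod M U x" "x \<in> carrier R"
  shows "nzd_mod M U (x [^] (n::nat))"
  by (induction n) (use assms in \<open>auto simp: nzd_mod_one nzd_mod_mult\<close>)

end

context fg_module
begin

text \<open>
  The primes are the maximal members of the family of all annihilators \<open>(U : v)\<close> with \<open>v \<notin> U\<close>.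
  There are only finitely many: pick \<open>w\<^sub>P\<close> with \<open>P = (U : w\<^sub>P)\<close> for each of them, and a finite set \<open>\<Q>\<close>
  of them whose elements \<open>w\<^sub>Q\<close> span as much as possible. Then each \<open>w\<^sub>P\<close> is in this span, so the
  intersection of \<open>\<Q>\<close> is contained in \<open>P\<close>; hence some \<open>Q \<in> \<Q>\<close> is contained in \<open>P\<close>, and \<open>Q = P\<close> by
  maximality.
\<close>
lemma zero_divisors_finite_union_primes:
  assumes U: "submodule U R M"
  shows "\<exists>\<P>. finite \<P> \<and> (\<forall>P \<in> \<P>. primeideal P R) \<and>
    (\<forall>P \<in> \<P>. \<exists>v \<in> carrier M - U. P = {a \<in> carrier R. a \<odot>\<^bsub>M\<^esub> v \<in> U}) \<and>
    (\<forall>x \<in> carrier R. (\<forall>P \<in> \<P>. x \<notin> P) \<longrightarrow> nzd_mod M U x)"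
proof -
  define Z where "Z v = {a \<in> carrier R. a \<odot>\<^bsub>M\<^esub> v \<in> U}" for v
  define F where "F = Z ` (carrier M - U)"
  have Z: "ideal (Z v) R" if "v \<in> carrier M" for v unfolding Z_def by (rule colon_ideal[OF U that])
  define MX where "MX = {P \<in> F. \<forall>Q \<in> F. P \<subseteq> Q \<longrightarrow> Q = P}"
  have above: "\<exists>P \<in> MX. Z v \<subseteq> P" if "v \<in> carrier M - U" for v
  proof -
    define G where "G = {P \<in> F. Z v \<subseteq> P}"
    have "\<exists>P \<in> G. \<forall>Q \<in> G. P \<subseteq> Q \<longrightarrow> Q = P"
    proof (rule noetherian_ring.maximal_in_ideal_family[OF noetherian])
      show "ideal I R" if "I \<in> G" for I
      proof -
        obtain w where "w \<in> carrier M" "I = Z w" using \<open>I \<in> G\<close> unfolding G_def F_def by auto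
        then show ?thesis using Z by simp
      qed
      have "Z v \<in> G" using that by (simp add: G_def F_def)
      then show "G \<noteq> {}" by blast
    qed
    then obtain P where P: "P \<in> G" "\<forall>Q \<in> G. P \<subseteq> Q \<longrightarrow> Q = P" by (elim bexE)
    have P': "P \<in> F" "Z v \<subseteq> P" using P(1) by (simp_all add: G_def)
    have "Q = P" if Q: "Q \<in> F" "P \<subseteq> Q" for Q
    proof -
      have "Q \<in> G" using Q P'(2) by (auto simp: G_def)
      then show ?thesis using P(2) Q(2) by (elim ballE impE) auto
    qed
    then have "P \<in> MX" using P'(1) by (auto simp: MX_def)
    then show ?thesis using P'(2) by (rule bexI[rotated])
  qed
  have prime: "primeideal P R" if P: "P \<in> MX" for P
  proof -
    obtain v where v: "v \<in> carrier M" "v \<notin> U" "P = Z v" using P unfolding MX_def F_def by blast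
    show ?thesis
    proof (rule primeidealI)
      show "ideal P R" using Z v by simp
      show "cring R" by (rule R.is_cring)
      have "\<one> \<notin> P" using v unfolding Z_def by simp
      then show "carrier R \<noteq> P" by blast
      fix a b assume ab: "a \<in> carrier R" "b \<in> carrier R" "a \<otimes> b \<in> P"
      show "a \<in> P \<or> b \<in> P"
      proof (cases "b \<in> P")
        case False
        then have bv: "b \<odot>\<^bsub>M\<^esub> v \<in> carrier M - U" using v ab unfolding Z_def by simp
        have "Z v \<subseteq> Z (b \<odot>\<^bsub>M\<^esub> v)"
          using ab v submoduleE(4)[OF U] unfolding Z_def by (auto simp: smult_commute[of _ b])
        then have "Z (b \<odot>\<^bsub>M\<^esub> v) = P" using P bv v unfolding MX_def F_def by blast
        moreover have "a \<in> Z (b \<odot>\<^bsub>M\<^esub> v)" using ab v unfolding Z_def by (simp add: smult_assoc1)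
        ultimately show ?thesis by simp
      qed simp
    qed
  qed
  have "\<exists>w. \<forall>P \<in> MX. w P \<in> carrier M - U \<and> P = Z (w P)"
    by (rule bchoice) (auto simp: MX_def F_def)
  then obtain w where w: "\<And>P. P \<in> MX \<Longrightarrow> w P \<in> carrier M - U" "\<And>P. P \<in> MX \<Longrightarrow> P = Z (w P)" by blast
  have "finite MX"
  proof (rule ccontr)
    assume inf: "infinite MX"
    define C where "C = {mod_span R M (w ` \<Q>) | \<Q>. \<Q> \<subseteq> MX \<and> finite \<Q>}"
    have "submodule H R M" if "H \<in> C" for H
      using that w(1) unfolding C_def by (auto intro!: mod_span_submodule)
    moreover have "C \<noteq> {}" unfolding C_def by blast
    ultimately have "\<exists>W \<in> C. \<forall>K \<in> C. W \<subseteq> K \<longrightarrow> K = W"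
      by (rule maximal_submodule_exists)
    then obtain W where W: "W \<in> C" "\<forall>K \<in> C. W \<subseteq> K \<longrightarrow> K = W" by (elim bexE)
    from W(1) obtain \<Q> where Q: "\<Q> \<subseteq> MX" "finite \<Q>" "W = mod_span R M (w ` \<Q>)"
      unfolding C_def by blast
    obtain P where P: "P \<in> MX" "P \<notin> \<Q>" using inf Q(1,2) by (meson finite_subset subsetI)
    have sub: "w ` insert P \<Q> \<subseteq> carrier M" using w(1) P(1) Q(1) by blast
    have "W \<subseteq> mod_span R M (w ` insert P \<Q>)"
      using mod_span_contains[of "w ` insert P \<Q>"] unfolding Q(3)
      by (intro mod_span_least mod_span_submodule[OF sub]) blast
    moreover have "mod_span R M (w ` insert P \<Q>) \<in> C" unfolding C_def using P Q by blast
    ultimately have "w P \<in> W" using W(2) mod_span_contains[of "w ` insert P \<Q>"] by blast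
    \<comment> \<open>An element of all \<open>Q \<in> \<Q>\<close> kills the \<open>w Q\<close> modulo \<open>U\<close>, hence also \<open>w P\<close>, which is in their span.\<close>
    have "\<exists>Q \<in> \<Q>. Q \<subseteq> P"
    proof (rule ccontr)
      assume neg: "\<not> (\<exists>Q \<in> \<Q>. Q \<subseteq> P)"
      have "\<exists>d \<in> carrier R. d \<notin> P \<and> (\<forall>Q \<in> \<Q>. d \<in> Q)"
      proof (rule R.prime_avoids_intersection[OF prime[OF P(1)] R.oneideal _ Q(2)])
        show "\<not> carrier R \<subseteq> P"
          using primeideal.I_notcarr[OF prime[OF P(1)]]
            ideal.Icarr[OF primeideal.axioms(1)[OF prime[OF P(1)]]] by blast
        show "ideal Q R" if "Q \<in> \<Q>" for Q using prime primeideal.axioms(1) that Q(1) by blast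
        show "\<not> Q \<subseteq> P" if "Q \<in> \<Q>" for Q using neg that by blast
      qed
      then obtain d where d: "d \<in> carrier R" "d \<notin> P" "\<And>Q. Q \<in> \<Q> \<Longrightarrow> d \<in> Q" by blast
      have "submodule {v \<in> carrier M. d \<odot>\<^bsub>M\<^esub> v \<in> U} R M"
        by (rule submoduleI) (use d(1) U in \<open>auto simp: smult_r_distr smult_r_minus
            smult_commute[of d] submodule_zero submoduleE\<close>)
      moreover have "w ` \<Q> \<subseteq> {v \<in> carrier M. d \<odot>\<^bsub>M\<^esub> v \<in> U}"
      proof
        fix v assume "v \<in> w ` \<Q>"
        then obtain Q' where Q': "Q' \<in> \<Q>" "v = w Q'" by blast
        then have "d \<in> Z v" "v \<in> carrier M" using w[of Q'] Q(1) d(3) by auto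
        then show "v \<in> {v \<in> carrier M. d \<odot>\<^bsub>M\<^esub> v \<in> U}" unfolding Z_def by blast
      qed
      ultimately have "d \<odot>\<^bsub>M\<^esub> w P \<in> U" using \<open>w P \<in> W\<close> mod_span_least unfolding Q(3) by blast
      then have "d \<in> P" using w(2)[OF P(1)] d(1) unfolding Z_def by blast
      then show False using d(2) by blast
    qed
    then obtain Q' where Q': "Q' \<in> \<Q>" "Q' \<subseteq> P" by blast
    then have "P = Q'" using P(1) Q(1) unfolding MX_def by blast
    then show False using Q' P by blast
  qed
  moreover note prime
  moreover have "\<exists>v \<in> carrier M - U. P = {a \<in> carrier R. a \<odot>\<^bsub>M\<^esub> v \<in> U}" if "P \<in> MX" for P
    using that unfolding MX_def F_def Z_def by blast
  moreover have "nzd_mod M U x" if x: "x \<in> carrier R" "\<And>P. P \<in> MX \<Longrightarrow> x \<notin> P" for x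
    unfolding nzd_mod_def
  proof (intro ballI impI)
    fix v assume v: "v \<in> carrier M" "x \<odot>\<^bsub>M\<^esub> v \<in> U"
    show "v \<in> U"
    proof (rule ccontr)
      assume "v \<notin> U"
      then obtain P where "P \<in> MX" "Z v \<subseteq> P" using above v by blast
      then show False using x v unfolding Z_def by blast
    qed
  qed
  ultimately show ?thesis by (intro exI[of _ MX]) simp
qed

end

text \<open>
  Being socle free for \<open>I\<close> prevents \<open>I\<close> from lying in one of the finitely many primes that make up
  the zero divisors of the two quotients, so the coset \<open>x + I\<close> avoids them all at once.
\<close>
lemma common_nzd_in_coset:
  assumes M: "fg_module R M" and N: "fg_module R N"
    and U: "submodule U R M" and V: "submodule V R N"
    and I: "ideal I R" and x: "x \<in> carrier R"
    and sM: "socle_free I M U" and sN: "socle_free I N V"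
  shows "\<exists>i \<in> I. nzd_mod M U (x \<oplus>\<^bsub>R\<^esub> i) \<and> nzd_mod N V (x \<oplus>\<^bsub>R\<^esub> i)"
proof -
  interpret M: fg_module R M by (rule M)
  interpret N: fg_module R N by (rule N)
  obtain \<P> where P: "finite \<P>" "\<forall>P \<in> \<P>. primeideal P R"
    "\<forall>P \<in> \<P>. \<exists>v \<in> carrier M - U. P = {a \<in> carrier R. a \<odot>\<^bsub>M\<^esub> v \<in> U}"
    "\<forall>x \<in> carrier R. (\<forall>P \<in> \<P>. x \<notin> P) \<longrightarrow> nzd_mod M U x"
    using M.zero_divisors_finite_union_primes[OF U] by blast
  obtain \<Q> where Q: "finite \<Q>" "\<forall>P \<in> \<Q>. primeideal P R"
    "\<forall>P \<in> \<Q>. \<exists>v \<in> carrier N - V. P = {a \<in> carrier R. a \<odot>\<^bsub>N\<^esub> v \<in> V}"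
    "\<forall>x \<in> carrier R. (\<forall>P \<in> \<Q>. x \<notin> P) \<longrightarrow> nzd_mod N V x"
    using N.zero_divisors_finite_union_primes[OF V] by blast
  have nle: "\<not> I \<subseteq> P" if "P \<in> \<P> \<union> \<Q>" for P
  proof
    assume le: "I \<subseteq> P"
    from that show False
    proof
      assume "P \<in> \<P>"
      then obtain v where v: "v \<in> carrier M" "v \<notin> U" "P = {a \<in> carrier R. a \<odot>\<^bsub>M\<^esub> v \<in> U}" using P(3) by blast
      have "\<forall>a \<in> I. a \<odot>\<^bsub>M\<^esub> v \<in> U" using le unfolding v(3) by blast
      then show False using v sM unfolding socle_free_def by simp
    next
      assume "P \<in> \<Q>"
      then obtain v where v: "v \<in> carrier N" "v \<notin> V" "P = {a \<in> carrier R. a \<odot>\<^bsub>N\<^esub> v \<in> V}" using Q(3) by blast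
      have "\<forall>a \<in> I. a \<odot>\<^bsub>N\<^esub> v \<in> V" using le unfolding v(3) by blast
      then show False using v sN unfolding socle_free_def by simp
    qed
  qed
  obtain i where i: "i \<in> I" "\<forall>P \<in> \<P> \<union> \<Q>. x \<oplus>\<^bsub>R\<^esub> i \<notin> P"
  proof -
    have "\<exists>i \<in> I. \<forall>P \<in> \<P> \<union> \<Q>. x \<oplus>\<^bsub>R\<^esub> i \<notin> P"
      by (rule M.R.coset_prime_avoidance[OF _ _ I nle x]) (use P(1,2) Q(1,2) in auto)
    then show ?thesis using that by blast
  qed
  have "x \<oplus>\<^bsub>R\<^esub> i \<in> carrier R" using x ideal.Icarr[OF I i(1)] by simp
  then have "nzd_mod M U (x \<oplus>\<^bsub>R\<^esub> i)" "nzd_mod N V (x \<oplus>\<^bsub>R\<^esub> i)"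
    using P(4) Q(4) i(2) by simp_all
  then show ?thesis using i(1) by blast
qed

section \<open>Regular sequences over a local ring\<close>

text \<open>
  The ring is local with maximal ideal \<open>\<mm>\<close>, expressed by the proper ideal \<open>\<mm>\<close> having only units in
  its complement.
\<close>
locale local_fg_module = fg_module R M
  for R :: "('a, 'r) ring_scheme" (structure) and M :: "('a, 'b) module" (structure) +
  fixes \<mm> :: "'a set"
  assumes max_ideal: "ideal \<mm> R" and one_notin: "\<one> \<notin> \<mm>"
    and units: "a \<in> carrier R \<Longrightarrow> a \<notin> \<mm> \<Longrightarrow> a \<in> Units R"

context pure_module
begin

lemma unit_smult_in_submodule:
  assumes H: "submodule H R M" and a: "a \<in> Units R" and v: "v \<in> carrier M" and av: "a \<odot>\<^bsub>M\<^esub> v \<in> H"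
  shows "v \<in> H"
proof -
  have "inv a \<odot>\<^bsub>M\<^esub> (a \<odot>\<^bsub>M\<^esub> v) \<in> H" using submoduleE(4)[OF H] a av by simp
  moreover have "inv a \<odot>\<^bsub>M\<^esub> (a \<odot>\<^bsub>M\<^esub> v) = v"
    using a v by (simp add: R.Units_closed flip: smult_assoc1)
  ultimately show ?thesis by simp
qed

lemma nzd_seq_append:
  "nzd_seq M U (xs @ ys) \<longleftrightarrow> nzd_seq M U xs \<and> nzd_seq M (add_mults M U xs) ys"
  by (induction xs arbitrary: U) auto

lemma nzd_imp_socle_free: "nzd_mod M U x \<Longrightarrow> x \<in> I \<Longrightarrow> socle_free I M U"
  unfolding socle_free_def nzd_mod_def by blast

end

context local_fg_module
begin

lemma mm_carrier: "a \<in> \<mm> \<Longrightarrow> a \<in> carrier R"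
  using ideal.Icarr[OF max_ideal] .

lemma mm_mult_r: "a \<in> \<mm> \<Longrightarrow> b \<in> carrier R \<Longrightarrow> a \<otimes> b \<in> \<mm>"
  using ideal.I_r_closed[OF max_ideal] .

lemma one_minus_unit:
  assumes a: "a \<in> \<mm>"
  shows "\<one> \<ominus> a \<in> Units R"
proof (rule units)
  have ac: "a \<in> carrier R" by (rule mm_carrier[OF a])
  then show "\<one> \<ominus> a \<in> carrier R" by simp
  show "\<one> \<ominus> a \<notin> \<mm>"
  proof
    assume "\<one> \<ominus> a \<in> \<mm>"
    then have "a \<oplus> (\<one> \<ominus> a) \<in> \<mm>"
      by (rule additive_subgroup.a_closed[OF ideal.axioms(1)[OF max_ideal] a])
    moreover have "a \<oplus> (\<one> \<ominus> a) = \<one>"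
      using ac by (simp add: a_minus_def R.a_comm[of \<one>] R.r_neg2)
    ultimately show False using one_notin by simp
  qed
qed

text \<open>
  Nakayama's lemma for \<open>K / U = x (K / U)\<close>. Otherwise there is a maximal submodule \<open>N\<close> with
  \<open>U \<subseteq> N \<subset> K\<close>, and \<open>K = N + R v\<close> for any \<open>v \<in> K\<close> outside \<open>N\<close>. Then \<open>v \<in> N + x R v\<close>, so a unit \<open>1 - x a\<close> maps \<open>v\<close>
  into \<open>N\<close>.
\<close>
lemma nakayama:
  assumes U: "submodule U R M" and K: "submodule K R M" and UK: "U \<subseteq> K" and x: "x \<in> \<mm>"
    and gen: "\<And>k. k \<in> K \<Longrightarrow> \<exists>u \<in> U. \<exists>k' \<in> K. k = u \<oplus>\<^bsub>M\<^esub> x \<odot>\<^bsub>M\<^esub> k'"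
  shows "K = U"
proof (rule ccontr)
  assume neq: "K \<noteq> U"
  define C where "C = {N. submodule N R M \<and> U \<subseteq> N \<and> N \<subseteq> K \<and> N \<noteq> K}"
  have "\<exists>N \<in> C. \<forall>N' \<in> C. N \<subseteq> N' \<longrightarrow> N' = N"
  proof (rule maximal_submodule_exists)
    show "submodule H R M" if "H \<in> C" for H using that by (simp add: C_def)
    have "U \<in> C" using U UK neq by (simp add: C_def)
    then show "C \<noteq> {}" by blast
  qed
  then obtain N where N: "N \<in> C" "\<forall>N' \<in> C. N \<subseteq> N' \<longrightarrow> N' = N" by (elim bexE)
  then have Ns: "submodule N R M" and UN: "U \<subseteq> N" and NK: "N \<subseteq> K" "N \<noteq> K" by (simp_all add: C_def)
  then obtain v where v: "v \<in> K" "v \<notin> N" by blast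
  have vM: "v \<in> carrier M" and xc: "x \<in> carrier R"
    using submodule_carrier[OF K v(1)] mm_carrier[OF x] .
  have "add_cyclic R M N v \<notin> C"
  proof
    assume "add_cyclic R M N v \<in> C"
    then have "add_cyclic R M N v = N" by (rule N(2)[rule_format]) (rule add_cyclic_superset(1)[OF Ns vM])
    then show False using add_cyclic_superset(2)[OF Ns vM] v(2) by simp
  qed
  then have eq: "add_cyclic R M N v = K"
    using add_cyclic_submodule[OF Ns vM] add_cyclic_superset(1)[OF Ns vM] UN
      add_cyclic_least[OF K NK(1) v(1)] unfolding C_def by auto
  obtain u k where uk: "u \<in> U" "k \<in> K" "v = u \<oplus>\<^bsub>M\<^esub> x \<odot>\<^bsub>M\<^esub> k" using gen[OF v(1)] by blast
  obtain n a where na: "n \<in> N" "a \<in> carrier R" "k = n \<oplus>\<^bsub>M\<^esub> a \<odot>\<^bsub>M\<^esub> v"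
    using uk(2) unfolding eq[symmetric] by (rule add_cyclicE)
  define n' where "n' = u \<oplus>\<^bsub>M\<^esub> x \<odot>\<^bsub>M\<^esub> n"
  have n'N: "n' \<in> N"
    unfolding n'_def using submoduleE(4,5)[OF Ns] UN uk(1) na(1) xc by blast
  have c: "u \<in> carrier M" "n \<in> carrier M" "n' \<in> carrier M"
    using submodule_carrier[OF U uk(1)] submodule_carrier[OF Ns] na(1) n'N by simp_all
  have xa: "x \<otimes> a \<in> \<mm>" by (rule mm_mult_r[OF x na(2)])
  have "v = n' \<oplus>\<^bsub>M\<^esub> (x \<otimes> a) \<odot>\<^bsub>M\<^esub> v"
    using uk(3) na(2,3) c vM xc unfolding n'_def
    by (simp add: smult_r_distr smult_assoc1 M.a_assoc)
  moreover have "(\<one> \<ominus> x \<otimes> a) \<odot>\<^bsub>M\<^esub> v = v \<ominus>\<^bsub>M\<^esub> (x \<otimes> a) \<odot>\<^bsub>M\<^esub> v"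
    using vM xc na(2) by (simp add: a_minus_def smult_l_distr smult_l_minus)
  moreover have "(n' \<oplus>\<^bsub>M\<^esub> (x \<otimes> a) \<odot>\<^bsub>M\<^esub> v) \<ominus>\<^bsub>M\<^esub> (x \<otimes> a) \<odot>\<^bsub>M\<^esub> v = n'"
    using vM xc na(2) c by (simp add: a_minus_def M.a_assoc M.r_neg)
  ultimately have "(\<one> \<ominus> x \<otimes> a) \<odot>\<^bsub>M\<^esub> v \<in> N" using n'N by metis
  then have "v \<in> N" by (rule unit_smult_in_submodule[OF Ns one_minus_unit[OF xa] vM])
  then show False using v(2) by blast
qed

lemma add_mult_proper:
  assumes U: "submodule U R M" and x: "x \<in> \<mm>" and ne: "U \<noteq> carrier M"
  shows "add_mult M U x \<noteq> carrier M"
proof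
  assume eq: "add_mult M U x = carrier M"
  have "carrier M = U"
  proof (rule nakayama[OF U carrier_is_submodule submoduleE(1)[OF U] x])
    fix k assume "k \<in> carrier M"
    then have "k \<in> add_mult M U x" unfolding eq .
    then show "\<exists>u \<in> U. \<exists>k' \<in> carrier M. k = u \<oplus>\<^bsub>M\<^esub> x \<odot>\<^bsub>M\<^esub> k'" by (blast elim: add_multE)
  qed
  then show False using ne by simp
qed

lemma add_mults_proper:
  "submodule U R M \<Longrightarrow> set xs \<subseteq> \<mm> \<Longrightarrow> U \<noteq> carrier M \<Longrightarrow> add_mults M U xs \<noteq> carrier M"
proof (induction xs arbitrary: U)
  case (Cons x xs)
  then have "x \<in> \<mm>" "set xs \<subseteq> \<mm>" by auto
  then show ?case
    using Cons.IH[of "add_mult M U x"] add_mult_proper[OF Cons.prems(1) _ Cons.prems(3)]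
      add_mult_submodule[OF Cons.prems(1) mm_carrier] by simp
qed simp

text \<open>
  Regular sequences of length two can be interchanged. If \<open>z k \<in> U\<close>, then \<open>k \<in> U + x M\<close> by
  regularity of \<open>z\<close>, say \<open>k = u + x w\<close>, and then \<open>z w \<in> U\<close> by regularity of \<open>x\<close>. So \<open>K = (U : z)\<close>
  satisfies \<open>K \<subseteq> U + x K\<close>, and Nakayama's lemma gives \<open>K = U\<close>.
\<close>
lemma nzd_swap:
  assumes U: "submodule U R M" and x: "x \<in> \<mm>" and z: "z \<in> \<mm>"
    and nx: "nzd_mod M U x" and nz: "nzd_mod M (add_mult M U x) z"
  shows "nzd_mod M U z" "nzd_mod M (add_mult M U z) x"
proof -
  note xc = mm_carrier[OF x] and zc = mm_carrier[OF z] and Uc = submodule_carrier[OF U]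
  define K where "K = {k \<in> carrier M. z \<odot>\<^bsub>M\<^esub> k \<in> U}"
  have K: "submodule K R M"
    unfolding K_def by (rule submoduleI) (use zc U in \<open>auto simp: smult_r_distr smult_r_minus
        smult_commute[of z] submodule_zero submoduleE\<close>)
  have UK: "U \<subseteq> K" using Uc zc submoduleE(4)[OF U] unfolding K_def by blast
  have "K = U"
  proof (rule nakayama[OF U K UK x])
    fix k assume "k \<in> K"
    then have k: "k \<in> carrier M" "z \<odot>\<^bsub>M\<^esub> k \<in> U" by (simp_all add: K_def)
    then have "k \<in> add_mult M U x"
      using nzd_modD[OF nz] add_mult_superset[OF U xc] by blast
    then obtain u w where uw: "u \<in> U" "w \<in> carrier M" "k = u \<oplus>\<^bsub>M\<^esub> x \<odot>\<^bsub>M\<^esub> w"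
      by (rule add_multE)
    have "z \<odot>\<^bsub>M\<^esub> u \<oplus>\<^bsub>M\<^esub> x \<odot>\<^bsub>M\<^esub> (z \<odot>\<^bsub>M\<^esub> w) \<in> U"
      using k(2) uw Uc xc zc by (simp add: smult_r_distr smult_commute[of x])
    then have "x \<odot>\<^bsub>M\<^esub> (z \<odot>\<^bsub>M\<^esub> w) \<in> U"
      by (rule submodule_add_cancel[OF U submoduleE(4)[OF U zc uw(1)], rotated]) (use xc zc uw(2) in simp)
    then have "z \<odot>\<^bsub>M\<^esub> w \<in> U" by (rule nzd_modD[OF nx, rotated]) (use zc uw(2) in simp)
    then have "w \<in> K" using uw(2) unfolding K_def by simp
    then show "\<exists>u \<in> U. \<exists>k' \<in> K. k = u \<oplus>\<^bsub>M\<^esub> x \<odot>\<^bsub>M\<^esub> k'" using uw by blast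
  qed
  then show "nzd_mod M U z" unfolding nzd_mod_def K_def by blast
  show "nzd_mod M (add_mult M U z) x"
    unfolding nzd_mod_def
  proof (intro ballI impI)
    fix a assume a: "a \<in> carrier M" "x \<odot>\<^bsub>M\<^esub> a \<in> add_mult M U z"
    then obtain u b where ub: "u \<in> U" "b \<in> carrier M" "x \<odot>\<^bsub>M\<^esub> a = u \<oplus>\<^bsub>M\<^esub> z \<odot>\<^bsub>M\<^esub> b"
      by (blast elim: add_multE)
    note Ux = add_mult_submodule[OF U xc]
    have "z \<odot>\<^bsub>M\<^esub> b \<in> add_mult M U x"
      using submodule_add_cancel[OF Ux, of u "z \<odot>\<^bsub>M\<^esub> b"] smult_in_add_mult[OF U xc a(1)]
        add_mult_superset[OF U xc] ub zc by auto
    then have "b \<in> add_mult M U x" by (rule nzd_modD[OF nz ub(2)])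
    then obtain u' c where uc: "u' \<in> U" "c \<in> carrier M" "b = u' \<oplus>\<^bsub>M\<^esub> x \<odot>\<^bsub>M\<^esub> c"
      by (rule add_multE)
    have "x \<odot>\<^bsub>M\<^esub> a = (u \<oplus>\<^bsub>M\<^esub> z \<odot>\<^bsub>M\<^esub> u') \<oplus>\<^bsub>M\<^esub> x \<odot>\<^bsub>M\<^esub> (z \<odot>\<^bsub>M\<^esub> c)"
      using ub uc Uc xc zc by (simp add: smult_r_distr smult_commute[of x] M.a_assoc)
    then have "x \<odot>\<^bsub>M\<^esub> (a \<ominus>\<^bsub>M\<^esub> z \<odot>\<^bsub>M\<^esub> c) = u \<oplus>\<^bsub>M\<^esub> z \<odot>\<^bsub>M\<^esub> u'"
      using a(1) ub(1) uc(1,2) Uc xc zc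
      by (simp add: smult_minus_distr) (simp add: a_minus_def M.a_assoc M.r_neg)
    then have "x \<odot>\<^bsub>M\<^esub> (a \<ominus>\<^bsub>M\<^esub> z \<odot>\<^bsub>M\<^esub> c) \<in> U"
      using ub(1) uc(1) submoduleE(4,5)[OF U] zc by simp
    then have "a \<ominus>\<^bsub>M\<^esub> z \<odot>\<^bsub>M\<^esub> c \<in> U"
      by (rule nzd_modD[OF nx, rotated]) (use a uc zc in simp)
    then have "(a \<ominus>\<^bsub>M\<^esub> z \<odot>\<^bsub>M\<^esub> c) \<oplus>\<^bsub>M\<^esub> z \<odot>\<^bsub>M\<^esub> c \<in> add_mult M U z"
      by (rule add_multI) (rule uc(2))
    moreover have "(a \<ominus>\<^bsub>M\<^esub> z \<odot>\<^bsub>M\<^esub> c) \<oplus>\<^bsub>M\<^esub> z \<odot>\<^bsub>M\<^esub> c = a"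
      using a uc zc by (simp add: a_minus_def M.a_assoc M.l_neg)
    ultimately show "a \<in> add_mult M U z" by simp
  qed
qed

lemma nzd_seq_rotate:
  "submodule U R M \<Longrightarrow> set xs \<subseteq> \<mm> \<Longrightarrow> z \<in> \<mm> \<Longrightarrow> nzd_seq M U (xs @ [z]) \<Longrightarrow> nzd_seq M U (z # xs)"
proof (induction xs arbitrary: U)
  case (Cons x xs)
  from Cons.prems have x: "x \<in> \<mm>" and z: "z \<in> \<mm>" and nx: "nzd_mod M U x" by auto
  note xc = mm_carrier[OF x] and zc = mm_carrier[OF z]
  have "nzd_seq M (add_mult M U x) (z # xs)"
    using Cons by (intro Cons.IH) (auto intro: add_mult_submodule xc)
  then have "nzd_mod M (add_mult M U x) z" "nzd_seq M (add_mult M (add_mult M U x) z) xs" by auto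
  then show ?case
    using nzd_swap[OF Cons.prems(1) x z nx] add_mult_commute[OF Cons.prems(1) xc zc] by simp
qed simp

text \<open>
  This is the length one case of Rees's theorem; the map \<open>u \<mapsto> v\<close> with \<open>y u = x v\<close> modulo \<open>U\<close>
  identifies the socles of \<open>M / (U + x M)\<close> and \<open>M / (U + y M)\<close>.
\<close>
lemma socle_exchange:
  assumes U: "submodule U R M" and x: "x \<in> \<mm>" and y: "y \<in> \<mm>"
    and nx: "nzd_mod M U x" and ny: "nzd_mod M U y"
    and soc: "\<not> socle_free \<mm> M (add_mult M U x)"
  shows "\<not> socle_free \<mm> M (add_mult M U y)"
proof -
  note xc = mm_carrier[OF x] and yc = mm_carrier[OF y] and Uc = submodule_carrier[OF U]
  obtain u where u: "u \<in> carrier M" "u \<notin> add_mult M U x" "\<And>a. a \<in> \<mm> \<Longrightarrow> a \<odot>\<^bsub>M\<^esub> u \<in> add_mult M U x"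
    using soc unfolding socle_free_def by blast
  obtain u0 v where v: "u0 \<in> U" "v \<in> carrier M" "y \<odot>\<^bsub>M\<^esub> u = u0 \<oplus>\<^bsub>M\<^esub> x \<odot>\<^bsub>M\<^esub> v"
    using u(3)[OF y] by (rule add_multE)
  have "v \<notin> add_mult M U y"
  proof
    assume "v \<in> add_mult M U y"
    then obtain u1 w where w: "u1 \<in> U" "w \<in> carrier M" "v = u1 \<oplus>\<^bsub>M\<^esub> y \<odot>\<^bsub>M\<^esub> w" by (rule add_multE)
    have "y \<odot>\<^bsub>M\<^esub> u = (u0 \<oplus>\<^bsub>M\<^esub> x \<odot>\<^bsub>M\<^esub> u1) \<oplus>\<^bsub>M\<^esub> y \<odot>\<^bsub>M\<^esub> (x \<odot>\<^bsub>M\<^esub> w)"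
      using v w Uc xc yc by (simp add: smult_r_distr smult_commute[of x] M.a_assoc)
    then have "y \<odot>\<^bsub>M\<^esub> (u \<ominus>\<^bsub>M\<^esub> x \<odot>\<^bsub>M\<^esub> w) = u0 \<oplus>\<^bsub>M\<^esub> x \<odot>\<^bsub>M\<^esub> u1"
      using u(1) v(1) w(1,2) Uc xc yc
      by (simp add: smult_minus_distr) (simp add: a_minus_def M.a_assoc M.r_neg)
    then have "y \<odot>\<^bsub>M\<^esub> (u \<ominus>\<^bsub>M\<^esub> x \<odot>\<^bsub>M\<^esub> w) \<in> U"
      using v(1) w(1) submoduleE(4,5)[OF U] xc by simp
    then have "u \<ominus>\<^bsub>M\<^esub> x \<odot>\<^bsub>M\<^esub> w \<in> U"
      by (rule nzd_modD[OF ny, rotated]) (use u w xc in simp)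
    then have "(u \<ominus>\<^bsub>M\<^esub> x \<odot>\<^bsub>M\<^esub> w) \<oplus>\<^bsub>M\<^esub> x \<odot>\<^bsub>M\<^esub> w \<in> add_mult M U x"
      by (rule add_multI) (rule w(2))
    moreover have "(u \<ominus>\<^bsub>M\<^esub> x \<odot>\<^bsub>M\<^esub> w) \<oplus>\<^bsub>M\<^esub> x \<odot>\<^bsub>M\<^esub> w = u"
      using u(1) w xc by (simp add: a_minus_def M.a_assoc M.l_neg)
    ultimately show False using u(2) by simp
  qed
  moreover have "a \<odot>\<^bsub>M\<^esub> v \<in> add_mult M U y" if a: "a \<in> \<mm>" for a
  proof -
    note ac = mm_carrier[OF a]
    obtain u2 w where w: "u2 \<in> U" "w \<in> carrier M" "a \<odot>\<^bsub>M\<^esub> u = u2 \<oplus>\<^bsub>M\<^esub> x \<odot>\<^bsub>M\<^esub> w"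
      using u(3)[OF a] by (rule add_multE)
    have "a \<odot>\<^bsub>M\<^esub> u0 \<oplus>\<^bsub>M\<^esub> x \<odot>\<^bsub>M\<^esub> (a \<odot>\<^bsub>M\<^esub> v) = a \<odot>\<^bsub>M\<^esub> (y \<odot>\<^bsub>M\<^esub> u)"
      using v Uc xc ac by (simp add: smult_r_distr smult_commute[of x])
    also have "\<dots> = y \<odot>\<^bsub>M\<^esub> (a \<odot>\<^bsub>M\<^esub> u)" by (rule smult_commute[OF ac yc u(1)])
    also have "\<dots> = y \<odot>\<^bsub>M\<^esub> u2 \<oplus>\<^bsub>M\<^esub> x \<odot>\<^bsub>M\<^esub> (y \<odot>\<^bsub>M\<^esub> w)"
      unfolding w(3) using w Uc xc yc by (simp add: smult_r_distr smult_commute[of x])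
    finally have eq: "a \<odot>\<^bsub>M\<^esub> u0 \<oplus>\<^bsub>M\<^esub> x \<odot>\<^bsub>M\<^esub> (a \<odot>\<^bsub>M\<^esub> v) = y \<odot>\<^bsub>M\<^esub> u2 \<oplus>\<^bsub>M\<^esub> x \<odot>\<^bsub>M\<^esub> (y \<odot>\<^bsub>M\<^esub> w)" .
    define p q where "p = x \<odot>\<^bsub>M\<^esub> (a \<odot>\<^bsub>M\<^esub> v)" and "q = x \<odot>\<^bsub>M\<^esub> (y \<odot>\<^bsub>M\<^esub> w)"
    have pq: "p \<in> carrier M" "q \<in> carrier M" unfolding p_def q_def using v w xc yc ac by simp_all
    have in_U: "a \<odot>\<^bsub>M\<^esub> u0 \<in> U" "y \<odot>\<^bsub>M\<^esub> u2 \<in> U" using submoduleE(4)[OF U] ac yc v(1) w(1) by simp_all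
    have "a \<odot>\<^bsub>M\<^esub> u0 \<oplus>\<^bsub>M\<^esub> (p \<ominus>\<^bsub>M\<^esub> q) = y \<odot>\<^bsub>M\<^esub> u2"
    proof -
      have "a \<odot>\<^bsub>M\<^esub> u0 \<oplus>\<^bsub>M\<^esub> (p \<ominus>\<^bsub>M\<^esub> q) = (a \<odot>\<^bsub>M\<^esub> u0 \<oplus>\<^bsub>M\<^esub> p) \<ominus>\<^bsub>M\<^esub> q"
        using pq Uc[OF in_U(1)] by (simp add: a_minus_def M.a_assoc)
      also have "\<dots> = (y \<odot>\<^bsub>M\<^esub> u2 \<oplus>\<^bsub>M\<^esub> q) \<ominus>\<^bsub>M\<^esub> q" using eq unfolding p_def q_def by simp
      also have "\<dots> = y \<odot>\<^bsub>M\<^esub> u2" using pq Uc[OF in_U(2)] by (simp add: a_minus_def M.a_assoc M.r_neg)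
      finally show ?thesis .
    qed
    then have "p \<ominus>\<^bsub>M\<^esub> q \<in> U"
      using submodule_add_cancel[OF U in_U(1), of "p \<ominus>\<^bsub>M\<^esub> q"] pq in_U(2) by simp
    then have "x \<odot>\<^bsub>M\<^esub> (a \<odot>\<^bsub>M\<^esub> v \<ominus>\<^bsub>M\<^esub> y \<odot>\<^bsub>M\<^esub> w) \<in> U"
      using v w xc yc ac unfolding p_def q_def by (simp add: smult_minus_distr)
    then have "a \<odot>\<^bsub>M\<^esub> v \<ominus>\<^bsub>M\<^esub> y \<odot>\<^bsub>M\<^esub> w \<in> U"
      by (rule nzd_modD[OF nx, rotated]) (use v w yc ac in simp)
    then have "(a \<odot>\<^bsub>M\<^esub> v \<ominus>\<^bsub>M\<^esub> y \<odot>\<^bsub>M\<^esub> w) \<oplus>\<^bsub>M\<^esub> y \<odot>\<^bsub>M\<^esub> w \<in> add_mult M U y"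
      by (rule add_multI) (rule w(2))
    moreover have "(a \<odot>\<^bsub>M\<^esub> v \<ominus>\<^bsub>M\<^esub> y \<odot>\<^bsub>M\<^esub> w) \<oplus>\<^bsub>M\<^esub> y \<odot>\<^bsub>M\<^esub> w = a \<odot>\<^bsub>M\<^esub> v"
      using v w yc ac by (simp add: a_minus_def M.a_assoc M.l_neg)
    ultimately show ?thesis by simp
  qed
  ultimately show ?thesis unfolding socle_free_def using v(2) by blast
qed

lemma common_nzd:
  assumes U: "submodule U R M" and V: "submodule V R M"
    and "socle_free \<mm> M U" "socle_free \<mm> M V"
  shows "\<exists>z \<in> \<mm>. nzd_mod M U z \<and> nzd_mod M V z"
proof -
  have "\<exists>z \<in> \<mm>. nzd_mod M U (\<zero> \<oplus> z) \<and> nzd_mod M V (\<zero> \<oplus> z)"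
    by (rule common_nzd_in_coset[OF fg_module_axioms fg_module_axioms U V max_ideal R.zero_closed assms(3,4)])
  then show ?thesis using mm_carrier by auto
qed

text \<open>
  Rees's theorem by Kaplansky's elementary argument: an element \<open>z\<close> that is regular after both
  shortened sequences can replace their last elements by the length one case, and can then be
  moved to the front. The induction hypothesis over \<open>U + z M\<close> compares the shortened sequences.
\<close>
lemma socle_exchange_seq:
  "length xs = length ys \<Longrightarrow> submodule U R M \<Longrightarrow> set xs \<subseteq> \<mm> \<Longrightarrow> set ys \<subseteq> \<mm> \<Longrightarrow>
   nzd_seq M U xs \<Longrightarrow> nzd_seq M U ys \<Longrightarrow> \<not> socle_free \<mm> M (add_mults M U xs) \<Longrightarrow>
   \<not> socle_free \<mm> M (add_mults M U ys)"
proof (induction "length xs" arbitrary: xs ys U)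
  case 0
  then show ?case by simp
next
  case (Suc n)
  obtain xs' x where xs: "xs = xs' @ [x]" using Suc.hyps(2) by (cases xs rule: rev_cases) auto
  obtain ys' y where ys: "ys = ys' @ [y]"
    using Suc.hyps(2) Suc.prems(1) by (cases ys rule: rev_cases) auto
  note U = Suc.prems(2)
  have len: "n = length xs'" "length xs' = length ys'" using Suc.hyps(2) Suc.prems(1) xs ys by simp_all
  have mm: "set xs' \<subseteq> \<mm>" "set ys' \<subseteq> \<mm>" "x \<in> \<mm>" "y \<in> \<mm>" using Suc.prems xs ys by auto
  then have car: "set xs' \<subseteq> carrier R" "set ys' \<subseteq> carrier R" using mm_carrier by auto
  define Ux where "Ux = add_mults M U xs'"
  define Uy where "Uy = add_mults M U ys'"
  have Ux: "submodule Ux R M" and Uy: "submodule Uy R M"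
    unfolding Ux_def Uy_def using add_mults_submodule[OF U] car by simp_all
  have seq: "nzd_seq M U xs'" "nzd_mod M Ux x" "nzd_seq M U ys'" "nzd_mod M Uy y"
    using Suc.prems(5,6) unfolding xs ys nzd_seq_snoc Ux_def Uy_def by simp_all
  obtain z where z: "z \<in> \<mm>" "nzd_mod M Ux z" "nzd_mod M Uy z"
    using common_nzd[OF Ux Uy] nzd_imp_socle_free[OF seq(2) mm(3)] nzd_imp_socle_free[OF seq(4) mm(4)] by blast
  note zc = mm_carrier[OF z(1)]
  have "\<not> socle_free \<mm> M (add_mult M Ux x)" using Suc.prems(7) unfolding xs add_mults_snoc Ux_def .
  then have "\<not> socle_free \<mm> M (add_mult M Ux z)"
    by (rule socle_exchange[OF Ux mm(3) z(1) seq(2) z(2)])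
  then have soc: "\<not> socle_free \<mm> M (add_mults M (add_mult M U z) xs')"
    unfolding Ux_def add_mults_add_mult[OF U car(1) zc] .
  have rot: "nzd_seq M (add_mult M U z) xs'" "nzd_seq M (add_mult M U z) ys'"
    using nzd_seq_rotate[OF U mm(1) z(1)] nzd_seq_rotate[OF U mm(2) z(1)] seq z
    unfolding nzd_seq_snoc Ux_def Uy_def by simp_all
  have "\<not> socle_free \<mm> M (add_mults M (add_mult M U z) ys')"
    by (rule Suc.hyps(1)[OF len add_mult_submodule[OF U zc] mm(1,2) rot soc])
  then have "\<not> socle_free \<mm> M (add_mult M Uy z)"
    unfolding Uy_def add_mults_add_mult[OF U car(2) zc] .
  then have "\<not> socle_free \<mm> M (add_mult M Uy y)"
    by (rule socle_exchange[OF Uy z(1) mm(4) z(3) seq(4)])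
  then show ?case unfolding ys add_mults_snoc Uy_def .
qed

lemma nzd_seq_length_le:
  assumes U: "submodule U R M" and xs: "set xs \<subseteq> \<mm>" "nzd_seq M U xs"
    and soc: "\<not> socle_free \<mm> M (add_mults M U xs)" and ys: "set ys \<subseteq> \<mm>" "nzd_seq M U ys"
  shows "length ys \<le> length xs"
proof (rule ccontr)
  assume "\<not> length ys \<le> length xs"
  then have lt: "length xs < length ys" by simp
  define zs where "zs = take (length xs) ys"
  have "nzd_seq M U (zs @ drop (length xs) ys)" using ys(2) unfolding zs_def by simp
  moreover have "drop (length xs) ys = ys ! length xs # drop (Suc (length xs)) ys"
    using lt by (simp add: Cons_nth_drop_Suc)
  ultimately have "nzd_seq M U zs" "nzd_mod M (add_mults M U zs) (ys ! length xs)"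
    unfolding nzd_seq_append by simp_all
  moreover have "ys ! length xs \<in> \<mm>" using lt ys(1) nth_mem by blast
  ultimately have "socle_free \<mm> M (add_mults M U zs)" by (blast intro: nzd_imp_socle_free)
  moreover have "\<not> socle_free \<mm> M (add_mults M U zs)"
    using lt xs ys soc \<open>nzd_seq M U zs\<close> set_take_subset[of "length xs" ys]
    by (intro socle_exchange_seq[of xs zs U] U) (auto simp: zs_def)
  ultimately show False by blast
qed

end

text \<open>
  Among the sequences in \<open>\<mm>\<close> that are regular on both modules, take one whose submodule of \<open>M\<close> is
  maximal. A further common regular element would not enlarge this submodule and so would map
  \<open>M\<close> into it, which makes the submodule all of \<open>M\<close>, contrary to Nakayama's lemma.
\<close>
lemma common_maximal_nzd_seq:
  assumes M: "local_fg_module R M \<mm>" and N: "fg_module R N"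
    and U: "submodule U R M" "U \<noteq> carrier M" and V: "submodule V R N"
  shows "\<exists>xs. set xs \<subseteq> \<mm> \<and> nzd_seq M U xs \<and> nzd_seq N V xs \<and>
    \<not> (socle_free \<mm> M (add_mults M U xs) \<and> socle_free \<mm> N (add_mults N V xs))"
proof (rule ccontr)
  assume neg: "\<not> ?thesis"
  interpret M: local_fg_module R M \<mm> by (rule M)
  interpret N: fg_module R N by (rule N)
  define good where "good xs \<longleftrightarrow> set xs \<subseteq> \<mm> \<and> nzd_seq M U xs \<and> nzd_seq N V xs" for xs
  have car: "set xs \<subseteq> carrier R" if "good xs" for xs using that M.mm_carrier unfolding good_def by blast
  have "\<exists>W \<in> add_mults M U ` Collect good. \<forall>K \<in> add_mults M U ` Collect good. W \<subseteq> K \<longrightarrow> K = W"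
  proof (rule M.maximal_submodule_exists)
    show "submodule H R M" if "H \<in> add_mults M U ` Collect good" for H
      using that M.add_mults_submodule[OF U(1) car] by auto
    have "good []" unfolding good_def by simp
    then show "add_mults M U ` Collect good \<noteq> {}" by blast
  qed
  then obtain xs where xs: "good xs"
    and max: "\<forall>K \<in> add_mults M U ` Collect good. add_mults M U xs \<subseteq> K \<longrightarrow> K = add_mults M U xs"
    by blast
  define W W' where "W = add_mults M U xs" and "W' = add_mults N V xs"
  have W: "submodule W R M" and W': "submodule W' R N"
    unfolding W_def W'_def using M.add_mults_submodule[OF U(1) car[OF xs]] N.add_mults_submodule[OF V car[OF xs]] .
  have free: "socle_free \<mm> M W" "socle_free \<mm> N W'"
    using neg xs unfolding good_def W_def W'_def by blast+
  have "\<exists>z \<in> \<mm>. nzd_mod M W (\<zero>\<^bsub>R\<^esub> \<oplus>\<^bsub>R\<^esub> z) \<and> nzd_mod N W' (\<zero>\<^bsub>R\<^esub> \<oplus>\<^bsub>R\<^esub> z)"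
    by (rule common_nzd_in_coset[OF M.fg_module_axioms N W W' M.max_ideal M.R.zero_closed free])
  then obtain z where z: "z \<in> \<mm>" "nzd_mod M W z" "nzd_mod N W' z"
    using M.mm_carrier by auto
  note zc = M.mm_carrier[OF z(1)]
  have "good (xs @ [z])"
    using xs z unfolding good_def M.nzd_seq_snoc N.nzd_seq_snoc W_def W'_def by simp
  moreover have "W \<subseteq> add_mults M U (xs @ [z])"
    unfolding M.add_mults_snoc W_def[symmetric] by (rule M.add_mult_superset[OF W zc])
  ultimately have "add_mult M W z = W"
    using max unfolding W_def[symmetric] by (metis M.add_mults_snoc W_def image_eqI mem_Collect_eq)
  then have "w \<in> W" if "w \<in> carrier M" for w
    using M.smult_in_add_mult[OF W zc that] nzd_modD[OF z(2) that] by simp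
  then have "W = carrier M" using M.submoduleE(1)[OF W] by blast
  moreover have "W \<noteq> carrier M"
    unfolding W_def using xs by (intro M.add_mults_proper U) (simp add: good_def)
  ultimately show False by blast
qed

section \<open>A kernel that is a vector space over the residue field\<close>

text \<open>
  The elements killed by the \<open>n\<close>-th power of the ideal \<open>I\<close>. For large \<open>n\<close> and \<open>I = \<mm>\<close> this is the
  zeroth local cohomology of \<open>M\<close>.
\<close>
primrec torsion :: "'a set \<Rightarrow> ('a, 'b) module \<Rightarrow> nat \<Rightarrow> 'b set" where
  "torsion I M 0 = {\<zero>\<^bsub>M\<^esub>}"
| "torsion I M (Suc n) = {v \<in> carrier M. \<forall>a \<in> I. a \<odot>\<^bsub>M\<^esub> v \<in> torsion I M n}"

context local_fg_module
begin

lemma torsion_submodule: "submodule (torsion \<mm> M n) R M"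
proof (induction n)
  case 0
  then show ?case by (simp add: zero_submodule)
next
  case (Suc n)
  show ?case
  proof (rule submoduleI)
    show "a \<oplus>\<^bsub>M\<^esub> b \<in> torsion \<mm> M (Suc n)" if "a \<in> torsion \<mm> M (Suc n)" "b \<in> torsion \<mm> M (Suc n)" for a b
      using that mm_carrier submoduleE(5)[OF Suc.IH] by (simp add: smult_r_distr)
    show "\<ominus>\<^bsub>M\<^esub> a \<in> torsion \<mm> M (Suc n)" if "a \<in> torsion \<mm> M (Suc n)" for a
      using that mm_carrier submoduleE(3)[OF Suc.IH] by (simp add: smult_r_minus)
    show "b \<odot>\<^bsub>M\<^esub> a \<in> torsion \<mm> M (Suc n)" if "b \<in> carrier R" "a \<in> torsion \<mm> M (Suc n)" for a b
      using that mm_carrier submoduleE(4)[OF Suc.IH] by (simp add: smult_commute[of _ b])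
    show "\<zero>\<^bsub>M\<^esub> \<in> torsion \<mm> M (Suc n)"
      using submodule_zero[OF Suc.IH] mm_carrier by simp
  qed auto
qed

lemma torsion_mono: "torsion \<mm> M n \<subseteq> torsion \<mm> M (Suc n)"
  using submoduleE(1,4)[OF torsion_submodule[of n]] mm_carrier by auto

lemma torsion_stable: "\<exists>n. torsion \<mm> M (Suc n) = torsion \<mm> M n"
proof -
  have "\<exists>H \<in> range (torsion \<mm> M). \<forall>K \<in> range (torsion \<mm> M). H \<subseteq> K \<longrightarrow> K = H"
    by (rule maximal_submodule_exists) (use torsion_submodule in auto)
  then obtain n where n: "\<forall>K \<in> range (torsion \<mm> M). torsion \<mm> M n \<subseteq> K \<longrightarrow> K = torsion \<mm> M n"
    by blast
  have "torsion \<mm> M (Suc n) = torsion \<mm> M n"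
    by (rule n[rule_format, OF rangeI torsion_mono])
  then show ?thesis by blast
qed

lemma pow_kills_torsion:
  "y \<in> \<mm> \<Longrightarrow> v \<in> torsion \<mm> M n \<Longrightarrow> (y [^] n) \<odot>\<^bsub>M\<^esub> v = \<zero>\<^bsub>M\<^esub>"
proof (induction n arbitrary: v)
  case 0
  then show ?case by simp
next
  case (Suc n)
  then have "(y [^] n) \<odot>\<^bsub>M\<^esub> (y \<odot>\<^bsub>M\<^esub> v) = \<zero>\<^bsub>M\<^esub>" by simp
  moreover have "v \<in> carrier M" using Suc.prems(2) by simp
  ultimately show ?case using mm_carrier[OF Suc.prems(1)] by (simp add: smult_assoc1)
qed

text \<open>
  The number \<open>n\<close> measures how far \<open>z L\<close> is from being killed by \<open>\<mm>\<close>. An element \<open>a \<in> \<mm>\<close> with \<open>a z L \<noteq> 0\<close>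
  lowers \<open>n\<close>, but need not be regular on the two quotients. It can be altered by a multiple of
  \<open>y\<close>, because \<open>y\<close> kills \<open>L\<close>.
\<close>
lemma minimal_torsion_multiple:
  assumes N: "fg_module R N" and V: "submodule V R N" and L: "submodule L R M"
    and y: "y \<in> carrier R" "nzd_mod M L y" "nzd_mod N V y"
    and kill: "\<And>l. l \<in> L \<Longrightarrow> y \<odot>\<^bsub>M\<^esub> l = \<zero>\<^bsub>M\<^esub>"
  shows "z \<in> carrier R \<Longrightarrow> nzd_mod M L z \<Longrightarrow> nzd_mod N V z \<Longrightarrow>
    \<forall>l \<in> L. z \<odot>\<^bsub>M\<^esub> l \<in> torsion \<mm> M n \<Longrightarrow> \<exists>l \<in> L. z \<odot>\<^bsub>M\<^esub> l \<noteq> \<zero>\<^bsub>M\<^esub> \<Longrightarrow>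
    \<exists>z' \<in> carrier R. nzd_mod M L z' \<and> nzd_mod N V z' \<and> (\<exists>l \<in> L. z' \<odot>\<^bsub>M\<^esub> l \<noteq> \<zero>\<^bsub>M\<^esub>) \<and>
      (\<forall>a \<in> \<mm>. \<forall>l \<in> L. a \<odot>\<^bsub>M\<^esub> (z' \<odot>\<^bsub>M\<^esub> l) = \<zero>\<^bsub>M\<^esub>)"
proof (induction n arbitrary: z)
  case 0
  then show ?case by simp
next
  case (Suc n)
  note z = Suc.prems(1)
  show ?case
  proof (cases "\<forall>a \<in> \<mm>. \<forall>l \<in> L. a \<odot>\<^bsub>M\<^esub> (z \<odot>\<^bsub>M\<^esub> l) = \<zero>\<^bsub>M\<^esub>")
    case True
    then show ?thesis using Suc.prems by blast
  next
    case False
    then obtain a l where al: "a \<in> \<mm>" "l \<in> L" "a \<odot>\<^bsub>M\<^esub> (z \<odot>\<^bsub>M\<^esub> l) \<noteq> \<zero>\<^bsub>M\<^esub>" by blast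
    note ac = mm_carrier[OF al(1)] and Lc = submodule_carrier[OF L]
    interpret N: fg_module R N by (rule N)
    have yI: "y \<in> PIdl y" by (rule R.cgenideal_self[OF y(1)])
    \<comment> \<open>The ideal generated by \<open>y\<close> contains the regular element \<open>y\<close>, so both quotients are socle free for it.\<close>
    have "\<exists>i \<in> PIdl y. nzd_mod M L (a \<oplus> i) \<and> nzd_mod N V (a \<oplus> i)"
      by (rule common_nzd_in_coset[OF fg_module_axioms N L V R.cgenideal_ideal[OF y(1)] ac
            nzd_imp_socle_free[OF y(2) yI] N.nzd_imp_socle_free[OF y(3) yI]])
    then obtain i where i: "i \<in> PIdl y" "nzd_mod M L (a \<oplus> i)" "nzd_mod N V (a \<oplus> i)" by blast
    obtain c where c: "c \<in> carrier R" "i = c \<otimes> y" using i(1) unfolding cgenideal_def by blast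
    have ic: "a \<oplus> i \<in> carrier R" using c ac y(1) by simp
    have act: "((a \<oplus> i) \<otimes> z) \<odot>\<^bsub>M\<^esub> l' = a \<odot>\<^bsub>M\<^esub> (z \<odot>\<^bsub>M\<^esub> l')" if l': "l' \<in> L" for l'
    proof -
      have zl: "z \<odot>\<^bsub>M\<^esub> l' \<in> L" by (rule submoduleE(4)[OF L z l'])
      have "((a \<oplus> i) \<otimes> z) \<odot>\<^bsub>M\<^esub> l' = a \<odot>\<^bsub>M\<^esub> (z \<odot>\<^bsub>M\<^esub> l') \<oplus>\<^bsub>M\<^esub> c \<odot>\<^bsub>M\<^esub> (y \<odot>\<^bsub>M\<^esub> (z \<odot>\<^bsub>M\<^esub> l'))"
        using ac z c y(1) Lc[OF l'] by (simp add: smult_assoc1 smult_l_distr)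
      then show ?thesis using kill[OF zl] c(1) ac Lc[OF zl] by simp
    qed
    show ?thesis
    proof (rule Suc.IH)
      show "(a \<oplus> i) \<otimes> z \<in> carrier R" using ic z by simp
      show "nzd_mod M L ((a \<oplus> i) \<otimes> z)" by (rule nzd_mod_mult[OF i(2) Suc.prems(2) ic z])
      show "nzd_mod N V ((a \<oplus> i) \<otimes> z)" by (rule N.nzd_mod_mult[OF i(3) Suc.prems(3) ic z])
      show "\<forall>l \<in> L. ((a \<oplus> i) \<otimes> z) \<odot>\<^bsub>M\<^esub> l \<in> torsion \<mm> M n"
        using Suc.prems(4) al(1) by (simp add: act)
      show "\<exists>l \<in> L. ((a \<oplus> i) \<otimes> z) \<odot>\<^bsub>M\<^esub> l \<noteq> \<zero>\<^bsub>M\<^esub>"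
        using al(2,3) act[OF al(2)] by (intro bexI[of _ l]) simp_all
    qed
  qed
qed

text \<open>
  The kernel in question is that of multiplication by \<open>y\<close> on \<open>z M\<close>. Let \<open>L\<close> be the torsion
  submodule. If \<open>y\<close> kills \<open>L\<close>, and \<open>y\<close> and \<open>z\<close> are regular on \<open>M / L\<close>, it consists of the \<open>z w\<close> with \<open>w \<in> L\<close>.
\<close>
lemma nzd_with_vector_space_kernel:
  assumes N: "fg_module R N" and V: "submodule V R N" and free: "socle_free \<mm> N V"
    and soc: "\<not> socle_free \<mm> M {\<zero>\<^bsub>M\<^esub>}"
  shows "\<exists>z \<in> carrier R. \<exists>y \<in> carrier R. nzd_mod N V z \<and> nzd_mod N V y \<and>
    (\<exists>w \<in> carrier M. z \<odot>\<^bsub>M\<^esub> w \<noteq> \<zero>\<^bsub>M\<^esub> \<and> y \<odot>\<^bsub>M\<^esub> (z \<odot>\<^bsub>M\<^esub> w) = \<zero>\<^bsub>M\<^esub>) \<and>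
    (\<forall>w \<in> carrier M. y \<odot>\<^bsub>M\<^esub> (z \<odot>\<^bsub>M\<^esub> w) = \<zero>\<^bsub>M\<^esub> \<longrightarrow> (\<forall>a \<in> \<mm>. a \<odot>\<^bsub>M\<^esub> (z \<odot>\<^bsub>M\<^esub> w) = \<zero>\<^bsub>M\<^esub>))"
proof -
  interpret N: fg_module R N by (rule N)
  obtain n where n: "torsion \<mm> M (Suc n) = torsion \<mm> M n" using torsion_stable by blast
  define L where "L = torsion \<mm> M n"
  have L: "submodule L R M" unfolding L_def by (rule torsion_submodule)
  have freeL: "socle_free \<mm> M L"
    using n unfolding L_def socle_free_def by auto
  have "\<exists>i \<in> \<mm>. nzd_mod M L (\<zero> \<oplus> i) \<and> nzd_mod N V (\<zero> \<oplus> i)"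
    by (rule common_nzd_in_coset[OF fg_module_axioms N L V max_ideal R.zero_closed freeL free])
  then obtain y0 where "y0 \<in> \<mm>" "nzd_mod M L (\<zero> \<oplus> y0)" "nzd_mod N V (\<zero> \<oplus> y0)" by blast
  then have y0: "y0 \<in> \<mm>" "nzd_mod M L y0" "nzd_mod N V y0" using mm_carrier[of y0] by simp_all
  \<comment> \<open>The exponent \<open>n\<close> is large enough for \<open>y\<close> to kill the torsion submodule.\<close>
  define y where "y = y0 [^] n"
  have y: "y \<in> carrier R" "nzd_mod M L y" "nzd_mod N V y"
    unfolding y_def using mm_carrier[OF y0(1)] nzd_mod_pow[OF y0(2)] N.nzd_mod_pow[OF y0(3)] by simp_all
  have kill: "y \<odot>\<^bsub>M\<^esub> l = \<zero>\<^bsub>M\<^esub>" if "l \<in> L" for l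
    unfolding y_def by (rule pow_kills_torsion[OF y0(1)]) (use that in \<open>simp add: L_def\<close>)
  have "\<exists>z \<in> carrier R. nzd_mod M L z \<and> nzd_mod N V z \<and> (\<exists>l \<in> L. z \<odot>\<^bsub>M\<^esub> l \<noteq> \<zero>\<^bsub>M\<^esub>) \<and>
      (\<forall>a \<in> \<mm>. \<forall>l \<in> L. a \<odot>\<^bsub>M\<^esub> (z \<odot>\<^bsub>M\<^esub> l) = \<zero>\<^bsub>M\<^esub>)"
  proof (rule minimal_torsion_multiple[OF N V L y])
    show "y \<odot>\<^bsub>M\<^esub> l = \<zero>\<^bsub>M\<^esub>" if "l \<in> L" for l by (rule kill[OF that])
    show "\<one> \<in> carrier R" by simp
    show "nzd_mod M L \<one>" "nzd_mod N V \<one>" by (rule nzd_mod_one N.nzd_mod_one)+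
    show "\<forall>l \<in> L. \<one> \<odot>\<^bsub>M\<^esub> l \<in> torsion \<mm> M n"
      using submodule_carrier[OF L] unfolding L_def by simp
    have "L \<noteq> {\<zero>\<^bsub>M\<^esub>}" using soc freeL by blast
    then obtain l where "l \<in> L" "l \<noteq> \<zero>\<^bsub>M\<^esub>" using submodule_zero[OF L] by blast
    then show "\<exists>l \<in> L. \<one> \<odot>\<^bsub>M\<^esub> l \<noteq> \<zero>\<^bsub>M\<^esub>" using submodule_carrier[OF L] by (intro bexI[of _ l]) simp_all
  qed
  then obtain z l where z: "z \<in> carrier R" "nzd_mod M L z" "nzd_mod N V z"
    and l: "l \<in> L" "z \<odot>\<^bsub>M\<^esub> l \<noteq> \<zero>\<^bsub>M\<^esub>"
    and mz: "\<forall>a \<in> \<mm>. \<forall>l \<in> L. a \<odot>\<^bsub>M\<^esub> (z \<odot>\<^bsub>M\<^esub> l) = \<zero>\<^bsub>M\<^esub>" by blast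
  have inL: "w \<in> L" if w: "w \<in> carrier M" "y \<odot>\<^bsub>M\<^esub> (z \<odot>\<^bsub>M\<^esub> w) = \<zero>\<^bsub>M\<^esub>" for w
  proof -
    have "y \<odot>\<^bsub>M\<^esub> (z \<odot>\<^bsub>M\<^esub> w) \<in> L" using w(2) submodule_zero[OF L] by simp
    then have "z \<odot>\<^bsub>M\<^esub> w \<in> L" by (rule nzd_modD[OF y(2), rotated]) (use z(1) w(1) in simp)
    then show ?thesis by (rule nzd_modD[OF z(2) w(1)])
  qed
  have "y \<odot>\<^bsub>M\<^esub> (z \<odot>\<^bsub>M\<^esub> l) = \<zero>\<^bsub>M\<^esub>" by (rule kill[OF submoduleE(4)[OF L z(1) l(1)]])
  then have "\<exists>w \<in> carrier M. z \<odot>\<^bsub>M\<^esub> w \<noteq> \<zero>\<^bsub>M\<^esub> \<and> y \<odot>\<^bsub>M\<^esub> (z \<odot>\<^bsub>M\<^esub> w) = \<zero>\<^bsub>M\<^esub>"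
    using l submodule_carrier[OF L l(1)] by (intro bexI[of _ l]) simp_all
  moreover have "\<forall>w \<in> carrier M. y \<odot>\<^bsub>M\<^esub> (z \<odot>\<^bsub>M\<^esub> w) = \<zero>\<^bsub>M\<^esub> \<longrightarrow> (\<forall>a \<in> \<mm>. a \<odot>\<^bsub>M\<^esub> (z \<odot>\<^bsub>M\<^esub> w) = \<zero>\<^bsub>M\<^esub>)"
    using inL mz by blast
  ultimately show ?thesis using z(1,3) y(1,3) by (intro bexI[of _ z] bexI[of _ y]) simp_all
qed

text \<open>
  Here \<open>M\<close> is a vector space over the residue field. A submodule that is maximal among those
  that do not contain \<open>v\<close> is a complement of the line through \<open>v\<close>; this avoids bases.
\<close>
lemma cyclic_complement:
  assumes kill: "\<And>a v. a \<in> \<mm> \<Longrightarrow> v \<in> carrier M \<Longrightarrow> a \<odot>\<^bsub>M\<^esub> v = \<zero>\<^bsub>M\<^esub>"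
    and v: "v \<in> carrier M" "v \<noteq> \<zero>\<^bsub>M\<^esub>"
  shows "\<exists>K. submodule K R M \<and> add_cyclic R M {\<zero>\<^bsub>M\<^esub>} v \<inter> K = {\<zero>\<^bsub>M\<^esub>} \<and>
    (\<forall>w \<in> carrier M. \<exists>p \<in> add_cyclic R M {\<zero>\<^bsub>M\<^esub>} v. \<exists>q \<in> K. w = p \<oplus>\<^bsub>M\<^esub> q)"
proof -
  define C where "C = {K. submodule K R M \<and> v \<notin> K}"
  have "\<exists>K \<in> C. \<forall>K' \<in> C. K \<subseteq> K' \<longrightarrow> K' = K"
  proof (rule maximal_submodule_exists)
    show "submodule H R M" if "H \<in> C" for H using that by (simp add: C_def)
    have "{\<zero>\<^bsub>M\<^esub>} \<in> C" using v zero_submodule by (simp add: C_def)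
    then show "C \<noteq> {}" by blast
  qed
  then obtain K where K: "K \<in> C" "\<forall>K' \<in> C. K \<subseteq> K' \<longrightarrow> K' = K" by (elim bexE)
  then have Ks: "submodule K R M" and vK: "v \<notin> K" by (simp_all add: C_def)
  define P where "P = add_cyclic R M {\<zero>\<^bsub>M\<^esub>} v"
  have P: "submodule P R M" unfolding P_def by (rule add_cyclic_submodule[OF zero_submodule v(1)])
  have PI: "a \<odot>\<^bsub>M\<^esub> v \<in> P" if "a \<in> carrier R" for a
    using add_cyclicI[of "\<zero>\<^bsub>M\<^esub>" "{\<zero>\<^bsub>M\<^esub>}" a v] that v(1) unfolding P_def by simp
  have "p = \<zero>\<^bsub>M\<^esub>" if p: "p \<in> P" "p \<in> K" for p
  proof -
    obtain a where a: "a \<in> carrier R" "p = a \<odot>\<^bsub>M\<^esub> v"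
      using p(1) v(1) unfolding P_def by (auto elim!: add_cyclicE)
    have "a \<in> \<mm>"
    proof (rule ccontr)
      assume "a \<notin> \<mm>"
      then have "v \<in> K" using unit_smult_in_submodule[OF Ks units[OF a(1)] v(1)] p(2) a(2) by simp
      then show False using vK by blast
    qed
    then show ?thesis using kill v(1) a(2) by simp
  qed
  then have int: "P \<inter> K = {\<zero>\<^bsub>M\<^esub>}" using submodule_zero[OF P] submodule_zero[OF Ks] by blast
  have "\<exists>p \<in> P. \<exists>q \<in> K. w = p \<oplus>\<^bsub>M\<^esub> q" if w: "w \<in> carrier M" for w
  proof (cases "w \<in> K")
    case True
    then show ?thesis using submodule_zero[OF P] w by (intro bexI[of _ "\<zero>\<^bsub>M\<^esub>"] bexI[of _ w]) simp_all
  next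
    case False
    have "add_cyclic R M K w \<notin> C"
    proof
      assume "add_cyclic R M K w \<in> C"
      then have "add_cyclic R M K w = K" by (rule K(2)[rule_format]) (rule add_cyclic_superset(1)[OF Ks w])
      then show False using add_cyclic_superset(2)[OF Ks w] False by simp
    qed
    then have "v \<in> add_cyclic R M K w" using add_cyclic_submodule[OF Ks w] by (simp add: C_def)
    then obtain q a where qa: "q \<in> K" "a \<in> carrier R" "v = q \<oplus>\<^bsub>M\<^esub> a \<odot>\<^bsub>M\<^esub> w" by (rule add_cyclicE)
    have "a \<notin> \<mm>"
    proof
      assume "a \<in> \<mm>"
      then have "v = q" using qa kill[OF _ w] submodule_carrier[OF Ks qa(1)] by simp
      then show False using vK qa(1) by simp
    qed
    then have u: "a \<in> Units R" by (rule units[OF qa(2)])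
    define b where "b = inv a"
    have b: "b \<in> carrier R" "b \<otimes> a = \<one>" unfolding b_def using u by simp_all
    have qc: "q \<in> carrier M" by (rule submodule_carrier[OF Ks qa(1)])
    have "b \<odot>\<^bsub>M\<^esub> v = b \<odot>\<^bsub>M\<^esub> q \<oplus>\<^bsub>M\<^esub> w"
      unfolding qa(3) using b qa(2) qc w by (simp add: smult_r_distr flip: smult_assoc1)
    then have "w = b \<odot>\<^bsub>M\<^esub> v \<oplus>\<^bsub>M\<^esub> \<ominus>\<^bsub>M\<^esub> (b \<odot>\<^bsub>M\<^esub> q)"
      using b(1) qc w by (simp add: M.a_comm[of "b \<odot>\<^bsub>M\<^esub> q"] M.a_assoc M.r_neg)
    then show ?thesis using PI[OF b(1)] submoduleE(3)[OF Ks submoduleE(4)[OF Ks b(1) qa(1)]] by blast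
  qed
  then show ?thesis using Ks int unfolding P_def by (intro exI[of _ K]) simp
qed

end

section \<open>Homomorphisms, quotients and direct sums\<close>

lemma (in pure_module) diff_eq_zero_iff:
  assumes "a \<in> carrier M" "b \<in> carrier M"
  shows "a \<ominus>\<^bsub>M\<^esub> b = \<zero>\<^bsub>M\<^esub> \<longleftrightarrow> a = b"
proof
  assume "a \<ominus>\<^bsub>M\<^esub> b = \<zero>\<^bsub>M\<^esub>"
  then have "(a \<ominus>\<^bsub>M\<^esub> b) \<oplus>\<^bsub>M\<^esub> b = b" using assms by simp
  then show "a = b" using assms by (simp add: a_minus_def M.a_assoc M.l_neg)
qed (use assms in \<open>simp add: a_minus_def M.r_neg\<close>)

lemma module_homI:
  assumes "\<And>x. x \<in> carrier M \<Longrightarrow> f x \<in> carrier N"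
    and "\<And>x y. x \<in> carrier M \<Longrightarrow> y \<in> carrier M \<Longrightarrow> f (x \<oplus>\<^bsub>M\<^esub> y) = f x \<oplus>\<^bsub>N\<^esub> f y"
    and "\<And>a x. a \<in> carrier R \<Longrightarrow> x \<in> carrier M \<Longrightarrow> f (a \<odot>\<^bsub>M\<^esub> x) = a \<odot>\<^bsub>N\<^esub> f x"
  shows "f \<in> module_hom R M N"
  using assms unfolding module_hom_def hom_def by auto

lemma module_homD:
  assumes "f \<in> module_hom R M N"
  shows "x \<in> carrier M \<Longrightarrow> f x \<in> carrier N"
    and "x \<in> carrier M \<Longrightarrow> y \<in> carrier M \<Longrightarrow> f (x \<oplus>\<^bsub>M\<^esub> y) = f x \<oplus>\<^bsub>N\<^esub> f y"
    and "a \<in> carrier R \<Longrightarrow> x \<in> carrier M \<Longrightarrow> f (a \<odot>\<^bsub>M\<^esub> x) = a \<odot>\<^bsub>N\<^esub> f x"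
  using assms unfolding module_hom_def hom_def by auto

lemma a_kernel_iff: "x \<in> a_kernel M N f \<longleftrightarrow> x \<in> carrier M \<and> f x = \<zero>\<^bsub>N\<^esub>"
  unfolding a_kernel_def' by simp

lemma module_hom_zero:
  assumes M: "pure_module R M" and N: "pure_module R N" and f: "f \<in> module_hom R M N"
  shows "f \<zero>\<^bsub>M\<^esub> = \<zero>\<^bsub>N\<^esub>"
proof -
  interpret M: pure_module R M by (rule M)
  interpret N: pure_module R N by (rule N)
  have "f (\<zero>\<^bsub>R\<^esub> \<odot>\<^bsub>M\<^esub> \<zero>\<^bsub>M\<^esub>) = \<zero>\<^bsub>R\<^esub> \<odot>\<^bsub>N\<^esub> f \<zero>\<^bsub>M\<^esub>"
    by (rule module_homD(3)[OF f]) simp_all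
  then show ?thesis using module_homD(1)[OF f, of "\<zero>\<^bsub>M\<^esub>"] by simp
qed

lemma module_hom_minus:
  assumes M: "pure_module R M" and N: "pure_module R N" and f: "f \<in> module_hom R M N"
    and x: "x \<in> carrier M" "y \<in> carrier M"
  shows "f (x \<ominus>\<^bsub>M\<^esub> y) = f x \<ominus>\<^bsub>N\<^esub> f y"
proof -
  interpret M: pure_module R M by (rule M)
  interpret N: pure_module R N by (rule N)
  have "f (\<ominus>\<^bsub>M\<^esub> y) = f ((\<ominus>\<^bsub>R\<^esub> \<one>\<^bsub>R\<^esub>) \<odot>\<^bsub>M\<^esub> y)" using x by (simp add: M.smult_l_minus)
  also have "\<dots> = (\<ominus>\<^bsub>R\<^esub> \<one>\<^bsub>R\<^esub>) \<odot>\<^bsub>N\<^esub> f y" by (rule module_homD(3)[OF f]) (use x in simp_all)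
  also have "\<dots> = \<ominus>\<^bsub>N\<^esub> f y" using module_homD(1)[OF f x(2)] by (simp add: N.smult_l_minus)
  finally show ?thesis using module_homD(2)[OF f x(1), of "\<ominus>\<^bsub>M\<^esub> y"] x by (simp add: a_minus_def)
qed

lemma module_hom_eq_iff:
  assumes M: "pure_module R M" and N: "pure_module R N" and f: "f \<in> module_hom R M N"
    and x: "x \<in> carrier M" "y \<in> carrier M"
  shows "f x = f y \<longleftrightarrow> x \<ominus>\<^bsub>M\<^esub> y \<in> a_kernel M N f"
proof -
  interpret M: pure_module R M by (rule M)
  interpret N: pure_module R N by (rule N)
  have "f x = f y \<longleftrightarrow> f x \<ominus>\<^bsub>N\<^esub> f y = \<zero>\<^bsub>N\<^esub>"
    using module_homD(1)[OF f] x by (simp add: N.diff_eq_zero_iff)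
  then show ?thesis using x by (simp add: a_kernel_iff module_hom_minus[OF M N f x])
qed

lemma surjection_factors:
  assumes A: "pure_module R A" and B: "pure_module R B" and M: "pure_module R M"
    and p: "p \<in> module_hom R M A" "p ` carrier M = carrier A"
    and q: "q \<in> module_hom R M B" "a_kernel M A p \<subseteq> a_kernel M B q"
  shows "\<exists>g \<in> module_hom R A B. \<forall>v \<in> carrier M. g (p v) = q v"
proof -
  define g where "g a = q (SOME v. v \<in> carrier M \<and> p v = a)" for a
  have g: "g (p v) = q v" if v: "v \<in> carrier M" for v
  proof -
    define w where "w = (SOME w. w \<in> carrier M \<and> p w = p v)"
    have "w \<in> carrier M \<and> p w = p v" unfolding w_def by (rule someI[of _ v]) (use v in simp)
    then have "w \<in> carrier M" "q w = q v"
      using v module_hom_eq_iff[OF M A p(1)] module_hom_eq_iff[OF M B q(1)] q(2) by auto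
    then show ?thesis unfolding g_def w_def by simp
  qed
  have "g \<in> module_hom R A B"
  proof (rule module_homI)
    fix x assume "x \<in> carrier A"
    then obtain v where v: "v \<in> carrier M" "x = p v" using p(2) by blast
    then show "g x \<in> carrier B" using g module_homD(1)[OF q(1)] by simp
    {
      fix y assume "y \<in> carrier A"
      then obtain w where w: "w \<in> carrier M" "y = p w" using p(2) by blast
      interpret M: pure_module R M by (rule M)
      have "g (p (v \<oplus>\<^bsub>M\<^esub> w)) = q v \<oplus>\<^bsub>B\<^esub> q w"
        using v w g[of "v \<oplus>\<^bsub>M\<^esub> w"] module_homD(2)[OF q(1)] by simp
      then show "g (x \<oplus>\<^bsub>A\<^esub> y) = g x \<oplus>\<^bsub>B\<^esub> g y"
        using v w g module_homD(2)[OF p(1)] by simp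
    }
    fix a assume a: "a \<in> carrier R"
    interpret M: pure_module R M by (rule M)
    have "g (p (a \<odot>\<^bsub>M\<^esub> v)) = a \<odot>\<^bsub>B\<^esub> q v"
      using v a g[of "a \<odot>\<^bsub>M\<^esub> v"] module_homD(3)[OF q(1)] by simp
    then show "g (a \<odot>\<^bsub>A\<^esub> x) = a \<odot>\<^bsub>B\<^esub> g x"
      using v a g module_homD(3)[OF p(1)] by simp
  qed
  then show ?thesis using g by blast
qed

context pure_module
begin

lemma submodule_abelian_subgroup: "submodule U R M \<Longrightarrow> abelian_subgroup U M"
  by (intro abelian_subgroupI3 additive_subgroup.intro M.abelian_group_axioms submodule.axioms(1))

lemma quot_carrier: "carrier (quot_module M U) = (\<lambda>v. U +>\<^bsub>M\<^esub> v) ` carrier M"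
  unfolding quot_module_def A_RCOSETS_def' by auto

lemma coset_mem:
  assumes "submodule U R M" "v \<in> carrier M"
  shows "v \<in> U +>\<^bsub>M\<^esub> v"
  using abelian_subgroup.a_rcos_self[OF submodule_abelian_subgroup[OF assms(1)] assms(2)] .

lemma coset_eq_iff:
  assumes U: "submodule U R M" and v: "v \<in> carrier M" "w \<in> carrier M"
  shows "U +>\<^bsub>M\<^esub> v = U +>\<^bsub>M\<^esub> w \<longleftrightarrow> v \<ominus>\<^bsub>M\<^esub> w \<in> U"
proof -
  interpret U: abelian_subgroup U M by (rule submodule_abelian_subgroup[OF U])
  have "U +>\<^bsub>M\<^esub> v = U +>\<^bsub>M\<^esub> w \<longleftrightarrow> v \<in> U +>\<^bsub>M\<^esub> w"
    using U.a_repr_independence' coset_mem[OF U v(1)] v by metis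
  also have "\<dots> \<longleftrightarrow> v \<ominus>\<^bsub>M\<^esub> w \<in> U"
    unfolding a_minus_def by (rule U.a_rcos_module[OF v(2,1)])
  finally show ?thesis .
qed

lemma quot_add:
  assumes "submodule U R M" "v \<in> carrier M" "w \<in> carrier M"
  shows "(U +>\<^bsub>M\<^esub> v) \<oplus>\<^bsub>quot_module M U\<^esub> (U +>\<^bsub>M\<^esub> w) = U +>\<^bsub>M\<^esub> (v \<oplus>\<^bsub>M\<^esub> w)"
  using abelian_subgroup.a_rcos_sum[OF submodule_abelian_subgroup[OF assms(1)] assms(2,3)]
  unfolding quot_module_def by simp

lemma quot_smult:
  assumes U: "submodule U R M" and a: "a \<in> carrier R" and v: "v \<in> carrier M"
  shows "a \<odot>\<^bsub>quot_module M U\<^esub> (U +>\<^bsub>M\<^esub> v) = U +>\<^bsub>M\<^esub> (a \<odot>\<^bsub>M\<^esub> v)"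
proof -
  have "U +>\<^bsub>M\<^esub> (a \<odot>\<^bsub>M\<^esub> x) = U +>\<^bsub>M\<^esub> (a \<odot>\<^bsub>M\<^esub> v)" if x: "x \<in> U +>\<^bsub>M\<^esub> v" for x
  proof -
    obtain u where u: "u \<in> U" "x = u \<oplus>\<^bsub>M\<^esub> v" using x unfolding a_r_coset_def' by blast
    have uc: "u \<in> carrier M" by (rule submodule_carrier[OF U u(1)])
    have "a \<odot>\<^bsub>M\<^esub> x \<ominus>\<^bsub>M\<^esub> a \<odot>\<^bsub>M\<^esub> v = a \<odot>\<^bsub>M\<^esub> u"
      unfolding u(2) using a v uc by (simp add: smult_r_distr a_minus_def M.a_assoc M.r_neg)
    then show ?thesis using coset_eq_iff[OF U] submoduleE(4)[OF U a u(1)] a v uc u(2) by simp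
  qed
  then have "(\<Union>x \<in> U +>\<^bsub>M\<^esub> v. U +>\<^bsub>M\<^esub> (a \<odot>\<^bsub>M\<^esub> x)) = U +>\<^bsub>M\<^esub> (a \<odot>\<^bsub>M\<^esub> v)"
    using coset_mem[OF U v] by blast
  then show ?thesis unfolding quot_module_def by simp
qed

lemma quot_zero: "\<zero>\<^bsub>quot_module M U\<^esub> = U"
  unfolding quot_module_def by simp

lemma coset_eq_zero_iff:
  assumes U: "submodule U R M" and v: "v \<in> carrier M"
  shows "U +>\<^bsub>M\<^esub> v = U \<longleftrightarrow> v \<in> U"
proof -
  have "\<ominus>\<^bsub>M\<^esub> \<zero>\<^bsub>M\<^esub> = \<zero>\<^bsub>M\<^esub>" by (rule M.minus_equality) simp_all
  then have "v \<ominus>\<^bsub>M\<^esub> \<zero>\<^bsub>M\<^esub> = v" using v by (simp add: a_minus_def)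
  moreover have "U +>\<^bsub>M\<^esub> \<zero>\<^bsub>M\<^esub> = U" using submoduleE(1)[OF U] by simp
  ultimately show ?thesis using coset_eq_iff[OF U v, of "\<zero>\<^bsub>M\<^esub>"] by simp
qed

lemma quot_iso_imp_surjection:
  assumes U: "submodule U R M" and A: "pure_module R A" and iso: "module_iso R (quot_module M U) A"
  shows "\<exists>p \<in> module_hom R M A. p ` carrier M = carrier A \<and> a_kernel M A p = U"
proof -
  obtain f where f: "f \<in> module_hom R (quot_module M U) A"
    "bij_betw f (carrier (quot_module M U)) (carrier A)"
    using iso unfolding module_iso_def by blast
  interpret A: pure_module R A by (rule A)
  have mem: "U +>\<^bsub>M\<^esub> v \<in> carrier (quot_module M U)" if "v \<in> carrier M" for v
    using that unfolding quot_carrier by blast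
  define p where "p v = f (U +>\<^bsub>M\<^esub> v)" for v
  have p: "p \<in> module_hom R M A"
    by (rule module_homI)
      (simp_all add: p_def module_homD[OF f(1)] mem flip: quot_add[OF U] quot_smult[OF U])
  have im: "p ` carrier M = carrier A"
    using f(2) unfolding bij_betw_def quot_carrier p_def image_image by simp
  have "f U = \<zero>\<^bsub>A\<^esub>"
  proof -
    have z: "U +>\<^bsub>M\<^esub> \<zero>\<^bsub>M\<^esub> = U" using coset_eq_zero_iff[OF U] submodule_zero[OF U] by simp
    have "p \<zero>\<^bsub>M\<^esub> = \<zero>\<^bsub>A\<^esub>" by (rule module_hom_zero[OF pure_module_axioms A p])
    then show ?thesis unfolding p_def z .
  qed
  then have "p v = \<zero>\<^bsub>A\<^esub> \<longleftrightarrow> U +>\<^bsub>M\<^esub> v = U" if v: "v \<in> carrier M" for v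
  proof -
    have "U \<in> carrier (quot_module M U)"
      using mem[OF M.zero_closed] coset_eq_zero_iff[OF U M.zero_closed] submodule_zero[OF U] by simp
    then show ?thesis using inj_on_eq_iff[OF bij_betw_imp_inj_on[OF f(2)] mem[OF v]] \<open>f U = \<zero>\<^bsub>A\<^esub>\<close>
      unfolding p_def by metis
  qed
  then have "a_kernel M A p = U"
    using coset_eq_zero_iff[OF U] submodule_carrier[OF U] by (auto simp: a_kernel_iff)
  then show ?thesis using p im by blast
qed

lemma surjection_imp_quot_iso:
  assumes U: "submodule U R M" and A: "pure_module R A" and p: "p \<in> module_hom R M A"
    "p ` carrier M = carrier A" "a_kernel M A p = U"
  shows "module_iso R (quot_module M U) A"
proof -
  define f where "f C = p (SOME v. v \<in> C)" for C
  have f: "f (U +>\<^bsub>M\<^esub> v) = p v" if v: "v \<in> carrier M" for v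
  proof -
    define w where "w = (SOME w. w \<in> U +>\<^bsub>M\<^esub> v)"
    have "w \<in> U +>\<^bsub>M\<^esub> v" unfolding w_def by (rule someI[of _ v]) (rule coset_mem[OF U v])
    then obtain u where u: "u \<in> U" "w = u \<oplus>\<^bsub>M\<^esub> v" unfolding a_r_coset_def' by blast
    then have w: "w \<in> carrier M" using submodule_carrier[OF U] v by simp
    have "w \<ominus>\<^bsub>M\<^esub> v = u" using u submodule_carrier[OF U] v by (simp add: a_minus_def M.a_assoc M.r_neg)
    then have "p w = p v" using module_hom_eq_iff[OF pure_module_axioms A p(1) w v] u(1) p(3) by simp
    then show ?thesis unfolding f_def w_def by simp
  qed
  have "f \<in> module_hom R (quot_module M U) A"
    by (rule module_homI)
      (auto simp: quot_carrier f module_homD[OF p(1)] quot_add[OF U] quot_smult[OF U])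
  moreover have "inj_on f (carrier (quot_module M U))"
    unfolding quot_carrier
  proof (rule inj_onI)
    fix C D assume CD: "C \<in> (\<lambda>v. U +>\<^bsub>M\<^esub> v) ` carrier M" "D \<in> (\<lambda>v. U +>\<^bsub>M\<^esub> v) ` carrier M" "f C = f D"
    then obtain v w where vw: "v \<in> carrier M" "w \<in> carrier M" "C = U +>\<^bsub>M\<^esub> v" "D = U +>\<^bsub>M\<^esub> w" by blast
    then have "p v = p w" using CD(3) f by simp
    then show "C = D"
      using vw module_hom_eq_iff[OF pure_module_axioms A p(1) vw(1,2)] coset_eq_iff[OF U vw(1,2)] p(3) by simp
  qed
  moreover have "f ` carrier (quot_module M U) = carrier A"
    unfolding quot_carrier image_image p(2)[symmetric] by (rule image_cong) (simp_all add: f)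
  ultimately show ?thesis unfolding module_iso_def bij_betw_def by blast
qed

lemma kernel_submodule:
  assumes A: "pure_module R A" and p: "p \<in> module_hom R M A"
  shows "submodule (a_kernel M A p) R M"
proof -
  interpret A: pure_module R A by (rule A)
  have "p (\<ominus>\<^bsub>M\<^esub> a) = \<zero>\<^bsub>A\<^esub>" if "a \<in> carrier M" "p a = \<zero>\<^bsub>A\<^esub>" for a
    using module_hom_minus[OF pure_module_axioms A p, of "\<zero>\<^bsub>M\<^esub>" a]
      module_hom_zero[OF pure_module_axioms A p] that by (simp add: a_minus_def)
  then show ?thesis
    by (intro submoduleI)
      (auto simp: a_kernel_iff module_homD[OF p] module_hom_zero[OF pure_module_axioms A p])
qed

lemma submodule_pure_module: "submodule H R M \<Longrightarrow> pure_module R (M\<lparr>carrier := H\<rparr>)"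
  by (rule pure_module.intro) (rule submodule.submodule_is_module[OF _ module_axioms])

lemma internal_direct_sum:
  assumes P: "submodule P R M" and Q: "submodule Q R M" and int: "P \<inter> Q = {\<zero>\<^bsub>M\<^esub>}"
    and sum: "\<And>w. w \<in> carrier M \<Longrightarrow> \<exists>p \<in> P. \<exists>q \<in> Q. w = p \<oplus>\<^bsub>M\<^esub> q"
  shows "module_iso R M (direct_sum [M\<lparr>carrier := P\<rparr>, M\<lparr>carrier := Q\<rparr>])" (is "module_iso R M ?S")
proof -
  note Pc = submodule_carrier[OF P] and Qc = submodule_carrier[OF Q]
  have uniq: "p = p' \<and> q = q'"
    if pq: "p \<in> P" "q \<in> Q" "p' \<in> P" "q' \<in> Q" and eq: "p \<oplus>\<^bsub>M\<^esub> q = p' \<oplus>\<^bsub>M\<^esub> q'" for p q p' q'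
  proof -
    note c = Pc[OF pq(1)] Qc[OF pq(2)] Pc[OF pq(3)] Qc[OF pq(4)]
    have "p \<ominus>\<^bsub>M\<^esub> p' = q' \<ominus>\<^bsub>M\<^esub> q"
    proof -
      have "p = (p \<oplus>\<^bsub>M\<^esub> q) \<oplus>\<^bsub>M\<^esub> \<ominus>\<^bsub>M\<^esub> q" using c by (simp add: M.a_assoc M.r_neg)
      also have "\<dots> = p' \<oplus>\<^bsub>M\<^esub> (q' \<ominus>\<^bsub>M\<^esub> q)" unfolding eq using c by (simp add: M.a_assoc a_minus_def)
      finally have "p = (q' \<ominus>\<^bsub>M\<^esub> q) \<oplus>\<^bsub>M\<^esub> p'" using c by (simp add: M.a_comm)
      then show ?thesis using c by (simp add: a_minus_def M.a_assoc M.r_neg)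
    qed
    then have "p \<ominus>\<^bsub>M\<^esub> p' \<in> P \<inter> Q"
      using submodule_minus[OF P pq(1,3)] submodule_minus[OF Q pq(4,2)] by simp
    then have "p = p'" unfolding int using c by (simp add: diff_eq_zero_iff)
    moreover from this have "q = q'" using eq c by simp
    ultimately show ?thesis by simp
  qed
  define f where "f w = (SOME l. \<exists>p \<in> P. \<exists>q \<in> Q. w = p \<oplus>\<^bsub>M\<^esub> q \<and> l = [p, q])" for w
  have f: "f (p \<oplus>\<^bsub>M\<^esub> q) = [p, q]" if "p \<in> P" "q \<in> Q" for p q
    unfolding f_def
  proof (rule some_equality)
    show "\<exists>p' \<in> P. \<exists>q' \<in> Q. p \<oplus>\<^bsub>M\<^esub> q = p' \<oplus>\<^bsub>M\<^esub> q' \<and> [p, q] = [p', q']" using that by blast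
    show "l = [p, q]" if "\<exists>p' \<in> P. \<exists>q' \<in> Q. p \<oplus>\<^bsub>M\<^esub> q = p' \<oplus>\<^bsub>M\<^esub> q' \<and> l = [p', q']" for l
      using that uniq \<open>p \<in> P\<close> \<open>q \<in> Q\<close> by blast
  qed
  have carS: "carrier ?S = {[p, q] | p q. p \<in> P \<and> q \<in> Q}"
  proof -
    have "xs \<in> carrier ?S \<longleftrightarrow> (\<exists>p q. xs = [p, q] \<and> p \<in> P \<and> q \<in> Q)" for xs
      unfolding direct_sum_def by (cases xs; cases "tl xs") (auto simp: less_Suc_eq)
    then show ?thesis by blast
  qed
  have addS: "[p, q] \<oplus>\<^bsub>?S\<^esub> [p', q'] = [p \<oplus>\<^bsub>M\<^esub> p', q \<oplus>\<^bsub>M\<^esub> q']" for p q p' q'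
    unfolding direct_sum_def by simp
  have smultS: "a \<odot>\<^bsub>?S\<^esub> [p, q] = [a \<odot>\<^bsub>M\<^esub> p, a \<odot>\<^bsub>M\<^esub> q]" for a p q
    unfolding direct_sum_def by simp
  have "f \<in> module_hom R M ?S"
  proof (rule module_homI)
    fix w assume "w \<in> carrier M"
    then obtain p q where pq: "p \<in> P" "q \<in> Q" "w = p \<oplus>\<^bsub>M\<^esub> q" using sum by blast
    then show "f w \<in> carrier ?S" using f unfolding carS by simp
    {
      fix w' assume "w' \<in> carrier M"
      then obtain p' q' where pq': "p' \<in> P" "q' \<in> Q" "w' = p' \<oplus>\<^bsub>M\<^esub> q'" using sum by blast
      have "w \<oplus>\<^bsub>M\<^esub> w' = (p \<oplus>\<^bsub>M\<^esub> p') \<oplus>\<^bsub>M\<^esub> (q \<oplus>\<^bsub>M\<^esub> q')"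
        using pq pq' Pc Qc by (simp add: M.a_ac)
      then show "f (w \<oplus>\<^bsub>M\<^esub> w') = f w \<oplus>\<^bsub>?S\<^esub> f w'"
        using f submoduleE(5)[OF P pq(1) pq'(1)] submoduleE(5)[OF Q pq(2) pq'(2)] pq pq' addS by simp
    }
    fix a assume a: "a \<in> carrier R"
    have "a \<odot>\<^bsub>M\<^esub> w = a \<odot>\<^bsub>M\<^esub> p \<oplus>\<^bsub>M\<^esub> a \<odot>\<^bsub>M\<^esub> q" using a pq Pc Qc by (simp add: smult_r_distr)
    then show "f (a \<odot>\<^bsub>M\<^esub> w) = a \<odot>\<^bsub>?S\<^esub> f w"
      using f submoduleE(4)[OF P a pq(1)] submoduleE(4)[OF Q a pq(2)] pq smultS by simp
  qed
  moreover have "bij_betw f (carrier M) (carrier ?S)"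
  proof (rule bij_betwI')
    fix x y assume x: "x \<in> carrier M" and y: "y \<in> carrier M"
    obtain p q where pq: "p \<in> P" "q \<in> Q" "x = p \<oplus>\<^bsub>M\<^esub> q" using sum[OF x] by blast
    obtain p' q' where pq': "p' \<in> P" "q' \<in> Q" "y = p' \<oplus>\<^bsub>M\<^esub> q'" using sum[OF y] by blast
    show "(f x = f y) = (x = y)"
    proof
      assume "f x = f y"
      then have "[p, q] = [p', q']" unfolding pq(3) pq'(3) f[OF pq(1,2)] f[OF pq'(1,2)] .
      then show "x = y" unfolding pq(3) pq'(3) by simp
    qed simp
  next
    fix x assume "x \<in> carrier M"
    then show "f x \<in> carrier ?S" using sum f unfolding carS by fastforce
  next
    fix l assume "l \<in> carrier ?S"
    then obtain p q where pq: "l = [p, q]" "p \<in> P" "q \<in> Q" unfolding carS by blast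
    then show "\<exists>x \<in> carrier M. l = f x"
      using f Pc Qc by (intro bexI[of _ "p \<oplus>\<^bsub>M\<^esub> q"]) simp_all
  qed
  ultimately show ?thesis unfolding module_iso_def by blast
qed

text \<open>
  This makes a finitely generated submodule a finitely generated module in its own right. It holds
  because the submodules of \<open>H\<close> are those of \<open>M\<close> that lie in \<open>H\<close>.
\<close>
lemma span_in_submodule:
  assumes H: "submodule H R M" and T: "T \<subseteq> H"
  shows "mod_span R (M\<lparr>carrier := H\<rparr>) T = mod_span R M T"
proof -
  interpret H: pure_module R "M\<lparr>carrier := H\<rparr>" by (rule submodule_pure_module[OF H])
  \<comment> \<open>The additive inverse is defined through the carrier, so this is not true by mere unfolding.\<close>
  have Hinv: "\<ominus>\<^bsub>M\<lparr>carrier := H\<rparr>\<^esub> a = \<ominus>\<^bsub>M\<^esub> a" if "a \<in> H" for a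
  proof (rule sym, rule M.minus_equality)
    show "a \<in> carrier M" "\<ominus>\<^bsub>M\<lparr>carrier := H\<rparr>\<^esub> a \<in> carrier M"
      using that H.M.a_inv_closed[of a] submodule_carrier[OF H] by simp_all
    show "\<ominus>\<^bsub>M\<lparr>carrier := H\<rparr>\<^esub> a \<oplus>\<^bsub>M\<^esub> a = \<zero>\<^bsub>M\<^esub>" using that H.M.l_neg[of a] by simp
  qed
  have "submodule K R (M\<lparr>carrier := H\<rparr>) \<longleftrightarrow> submodule K R M \<and> K \<subseteq> H" for K
  proof
    assume K: "submodule K R (M\<lparr>carrier := H\<rparr>)"
    have KH: "K \<subseteq> H" using H.submoduleE(1)[OF K] by simp
    have "submodule K R M"
    proof (rule submoduleI)
      show "K \<subseteq> carrier M" using KH submoduleE(1)[OF H] by blast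
      show "\<zero>\<^bsub>M\<^esub> \<in> K" using H.submodule_zero[OF K] by simp
      show "\<ominus>\<^bsub>M\<^esub> a \<in> K" if "a \<in> K" for a using H.submoduleE(3)[OF K that] Hinv that KH by auto
    qed (use H.submoduleE(4,5)[OF K] in simp_all)
    then show "submodule K R M \<and> K \<subseteq> H" using KH by simp
  next
    assume K: "submodule K R M \<and> K \<subseteq> H"
    then have Ks: "submodule K R M" and KH: "K \<subseteq> H" by simp_all
    show "submodule K R (M\<lparr>carrier := H\<rparr>)"
    proof (rule H.submoduleI)
      show "\<ominus>\<^bsub>M\<lparr>carrier := H\<rparr>\<^esub> a \<in> K" if "a \<in> K" for a
        using submoduleE(3)[OF Ks that] Hinv that KH by auto
    qed (use KH submodule_zero[OF Ks] submoduleE(4,5)[OF Ks] in simp_all)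
  qed
  then have eq: "{K. submodule K R (M\<lparr>carrier := H\<rparr>) \<and> T \<subseteq> K} = {K. submodule K R M \<and> K \<subseteq> H \<and> T \<subseteq> K}"
    by auto
  have TM: "T \<subseteq> carrier M" using T submoduleE(1)[OF H] by blast
  show ?thesis
  proof
    show "mod_span R M T \<subseteq> mod_span R (M\<lparr>carrier := H\<rparr>) T"
      unfolding mod_span_def eq by blast
    show "mod_span R (M\<lparr>carrier := H\<rparr>) T \<subseteq> mod_span R M T"
      unfolding mod_span_def[of R "M\<lparr>carrier := H\<rparr>"] eq
      using mod_span_submodule[OF TM] mod_span_least[OF H T] mod_span_contains[of T] by blast
  qed
qed

end

lemma (in fg_module) submodule_in_fg_modules:
  assumes H: "submodule H R M"
  shows "M\<lparr>carrier := H\<rparr> \<in> fg_modules R"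
proof -
  obtain T where T: "T \<subseteq> H" "finite T" "mod_span R M T = H" using submodule_fg[OF H] by blast
  then show ?thesis
    unfolding fg_modules_iff using submodule_pure_module[OF H] span_in_submodule[OF H T(1)] by auto
qed

section \<open>The ring as a module, and depth\<close>

lemma ring_module_simps [simp]:
  "carrier (ring_module R) = carrier R"
  "ring.zero (ring_module R) = \<zero>\<^bsub>R\<^esub>"
  "ring.add (ring_module R) = ring.add R"
  "smult (ring_module R) = monoid.mult R"
  by (simp_all add: ring_module_def)

lemma (in cring) ring_module_pure: "pure_module R (ring_module R)"
proof (rule pure_module.intro, rule moduleI)
  show "cring R" by (rule is_cring)
  show "abelian_group (ring_module R)"
    by (rule abelian_groupI) (auto simp: a_ac intro: exI[of _ "\<ominus> _"] bexI[of _ "\<ominus> _"] l_neg)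
qed (simp_all add: l_distr r_distr m_assoc)

lemma (in cring) submodule_ring_module_iff: "submodule H R (ring_module R) \<longleftrightarrow> ideal H R"
proof
  assume H: "submodule H R (ring_module R)"
  show "ideal H R"
  proof (rule idealI)
    show "ring R" by (rule ring_axioms)
    show "subgroup H (add_monoid R)"
      using submodule.axioms(1)[OF H] by (simp add: subgroup_def m_inv_def)
    show "x \<otimes> a \<in> H" "a \<otimes> x \<in> H" if "a \<in> H" "x \<in> carrier R" for a x
      using submodule.smult_closed[OF H that(2,1)] that
        subgroup.subset[OF submodule.axioms(1)[OF H]] by (auto simp: m_comm)
  qed
next
  assume H: "ideal H R"
  have "subgroup H (add_monoid (ring_module R))"
    using additive_subgroup.a_subgroup[OF ideal.axioms(1)[OF H]] by (simp add: subgroup_def m_inv_def)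
  then show "submodule H R (ring_module R)"
    using ideal.I_l_closed[OF H] by (simp add: submodule_def submodule_axioms_def)
qed

lemma (in cring) ring_module_fg: "ring_module R \<in> fg_modules R"
proof -
  interpret N: pure_module R "ring_module R" by (rule ring_module_pure)
  have "mod_span R (ring_module R) {\<one>} = carrier R"
  proof
    show "mod_span R (ring_module R) {\<one>} \<subseteq> carrier R"
      using N.mod_span_least[OF N.carrier_is_submodule, of "{\<one>}"] by simp
    have s: "submodule (mod_span R (ring_module R) {\<one>}) R (ring_module R)"
      by (rule N.mod_span_submodule) simp
    have "\<one> \<in> mod_span R (ring_module R) {\<one>}" using N.mod_span_contains[of "{\<one>}"] by simp
    then show "carrier R \<subseteq> mod_span R (ring_module R) {\<one>}"
      using N.submoduleE(4)[OF s, of _ \<one>] by auto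
  qed
  then show ?thesis
    unfolding fg_modules_iff using ring_module_pure by (intro conjI exI[of _ "{\<one>}"]) simp_all
qed

text \<open>
  A nonunit generates a proper ideal. By the Noetherian property this is contained in a
  maximal ideal, and there is only one of these.
\<close>
lemma local_fg_moduleI:
  assumes R: "noetherian_local_ring R" and M: "M \<in> fg_modules R"
  shows "local_fg_module R M (max_ideal R)"
proof -
  have cr: "cring R" and nr: "noetherian_ring R" and ex: "\<exists>!m. maximalideal m R"
    using R unfolding noetherian_local_ring_def by blast+
  interpret cring R by (rule cr)
  interpret fg_module R M by (rule fg_moduleI[OF nr M])
  have max: "maximalideal (max_ideal R) R" unfolding max_ideal_def by (rule theI'[OF ex])
  then interpret mm: maximalideal "max_ideal R" R .
  show ?thesis
  proof unfold_locales
    show "\<one>\<^bsub>R\<^esub> \<notin> max_ideal R" using mm.I_notcarr mm.one_imp_carrier by blast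
    fix a assume a: "a \<in> carrier R" "a \<notin> max_ideal R"
    show "a \<in> Units R"
    proof (rule ccontr)
      assume nu: "a \<notin> Units R"
      define C where "C = {J. ideal J R \<and> PIdl\<^bsub>R\<^esub> a \<subseteq> J \<and> J \<noteq> carrier R}"
      have "\<exists>J \<in> C. \<forall>K \<in> C. J \<subseteq> K \<longrightarrow> K = J"
      proof (rule noetherian_ring.maximal_in_ideal_family[OF nr])
        show "ideal J R" if "J \<in> C" for J using that by (simp add: C_def)
        have "PIdl\<^bsub>R\<^esub> a \<noteq> carrier R"
        proof
          assume "PIdl\<^bsub>R\<^esub> a = carrier R"
          then have "\<one>\<^bsub>R\<^esub> \<in> PIdl\<^bsub>R\<^esub> a" by simp
          then obtain b where b: "b \<in> carrier R" "\<one>\<^bsub>R\<^esub> = b \<otimes>\<^bsub>R\<^esub> a" unfolding cgenideal_def by blast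
          then have "a \<in> Units R" using a(1) unfolding Units_def by (auto simp: m_comm intro!: bexI[of _ b])
          then show False using nu by simp
        qed
        then have "PIdl\<^bsub>R\<^esub> a \<in> C" using cgenideal_ideal[OF a(1)] by (simp add: C_def)
        then show "C \<noteq> {}" by blast
      qed
      then obtain J where J: "J \<in> C" "\<forall>K \<in> C. J \<subseteq> K \<longrightarrow> K = J" by (elim bexE)
      have Ji: "ideal J R" "PIdl\<^bsub>R\<^esub> a \<subseteq> J" "J \<noteq> carrier R" using J(1) by (simp_all add: C_def)
      have "maximalideal J R"
      proof (rule maximalidealI[OF Ji(1)])
        show "carrier R \<noteq> J" using Ji(3) by simp
        fix K assume K: "ideal K R" "J \<subseteq> K" "K \<subseteq> carrier R"
        show "K = J \<or> K = carrier R"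
        proof (cases "K = carrier R")
          case False
          then have "K \<in> C" using K Ji(2) by (auto simp: C_def)
          then have "K = J" by (rule J(2)[rule_format]) (rule K(2))
          then show ?thesis ..
        qed simp
      qed
      then have "J = max_ideal R" using ex max by blast
      then show False using a(2) Ji(2) cgenideal_self[OF a(1)] by blast
    qed
  qed
qed

context pure_module
begin

lemma smult_in_add_mults:
  "submodule U R M \<Longrightarrow> set xs \<subseteq> carrier R \<Longrightarrow> x \<in> set xs \<Longrightarrow> w \<in> carrier M \<Longrightarrow> x \<odot>\<^bsub>M\<^esub> w \<in> add_mults M U xs"
proof (induction xs arbitrary: U)
  case (Cons y ys)
  then have y: "y \<in> carrier R" "set ys \<subseteq> carrier R" by auto
  note Uy = add_mult_submodule[OF Cons.prems(1) y(1)]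
  show ?case
  proof (cases "x = y")
    case True
    then show ?thesis
      using smult_in_add_mult[OF Cons.prems(1) y(1) Cons.prems(4)] add_mults_superset[OF Uy y(2)] by auto
  next
    case False
    then show ?thesis using Cons.IH[OF Uy y(2)] Cons.prems(3,4) by simp
  qed
qed simp

lemma add_mults_least:
  "submodule K R M \<Longrightarrow> U \<subseteq> K \<Longrightarrow> \<forall>x \<in> set xs. \<forall>w \<in> carrier M. x \<odot>\<^bsub>M\<^esub> w \<in> K \<Longrightarrow> add_mults M U xs \<subseteq> K"
proof (induction xs arbitrary: U)
  case (Cons y ys)
  have "add_mult M U y \<subseteq> K" using Cons.prems by (intro add_mult_least) simp_all
  then show ?case using Cons.IH[OF Cons.prems(1)] Cons.prems(3) by simp
qed simp

text \<open>
  The submodule \<open>(x\<^sub>1, \<dots>, x\<^sub>n) M\<close> by which \<open>quot_seq\<close> divides is reached by adding the \<open>x\<^sub>i M\<close> one after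
  the other. For \<open>\<subseteq>\<close>, the elements \<open>a\<close> with \<open>a y\<close> in the right-hand side form an ideal that contains
  the \<open>x\<^sub>i\<close>.
\<close>
lemma ideal_smult_eq_add_mults:
  assumes xs: "set xs \<subseteq> carrier R"
  shows "ideal_smult R (Idl (set xs)) M = add_mults M {\<zero>\<^bsub>M\<^esub>} xs"
proof
  note W = add_mults_submodule[OF zero_submodule xs]
  have "a \<odot>\<^bsub>M\<^esub> y \<in> add_mults M {\<zero>\<^bsub>M\<^esub>} xs" if a: "a \<in> Idl (set xs)" and y: "y \<in> carrier M" for a y
  proof -
    have "Idl (set xs) \<subseteq> {a \<in> carrier R. a \<odot>\<^bsub>M\<^esub> y \<in> add_mults M {\<zero>\<^bsub>M\<^esub>} xs}"
    proof (rule R.genideal_minimal[OF colon_ideal[OF W y]], rule subsetI)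
      fix x assume "x \<in> set xs"
      then show "x \<in> {a \<in> carrier R. a \<odot>\<^bsub>M\<^esub> y \<in> add_mults M {\<zero>\<^bsub>M\<^esub>} xs}"
        using smult_in_add_mults[OF zero_submodule xs _ y] xs by (intro CollectI conjI subsetD[OF xs])
    qed
    then show ?thesis using a by blast
  qed
  then have "{a \<odot>\<^bsub>M\<^esub> y | a y. a \<in> Idl (set xs) \<and> y \<in> carrier M} \<subseteq> add_mults M {\<zero>\<^bsub>M\<^esub>} xs"
    by (intro subsetI) (elim CollectE exE conjE, simp)
  then show "ideal_smult R (Idl (set xs)) M \<subseteq> add_mults M {\<zero>\<^bsub>M\<^esub>} xs"
    unfolding ideal_smult_def by (rule mod_span_least[OF W])
next
  define S where "S = {a \<odot>\<^bsub>M\<^esub> y | a y. a \<in> Idl (set xs) \<and> y \<in> carrier M}"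
  have S: "S \<subseteq> carrier M"
    unfolding S_def using ideal.Icarr[OF R.genideal_ideal[OF xs]] by auto
  note K = mod_span_submodule[OF S]
  have "x \<odot>\<^bsub>M\<^esub> w \<in> mod_span R M S" if "x \<in> set xs" "w \<in> carrier M" for x w
  proof -
    have "x \<odot>\<^bsub>M\<^esub> w \<in> S" using that R.genideal_self[OF xs] unfolding S_def by blast
    then show ?thesis using mod_span_contains[of S] by blast
  qed
  then show "add_mults M {\<zero>\<^bsub>M\<^esub>} xs \<subseteq> ideal_smult R (Idl (set xs)) M"
    unfolding ideal_smult_def S_def[symmetric] using submodule_zero[OF K]
    by (intro add_mults_least[OF K]) auto
qed

lemma nzd_seq_iff_nth:
  "nzd_seq M U xs \<longleftrightarrow> (\<forall>i < length xs. nzd_mod M (add_mults M U (take i xs)) (xs ! i))"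
proof (induction xs rule: rev_induct)
  case (snoc x xs)
  then show ?case by (auto simp: nzd_seq_snoc nth_append less_Suc_eq)
qed simp

lemma quot_nzd_iff:
  assumes U: "submodule U R M" and x: "x \<in> carrier R"
  shows "(\<forall>y \<in> carrier (quot_module M U). x \<odot>\<^bsub>quot_module M U\<^esub> y = \<zero>\<^bsub>quot_module M U\<^esub> \<longrightarrow>
    y = \<zero>\<^bsub>quot_module M U\<^esub>) \<longleftrightarrow> nzd_mod M U x"
  unfolding quot_carrier quot_zero nzd_mod_def
  using x by (simp add: quot_smult[OF U] coset_eq_zero_iff[OF U])

lemma quot_trivial_iff:
  assumes U: "submodule U R M"
  shows "carrier (quot_module M U) = {\<zero>\<^bsub>quot_module M U\<^esub>} \<longleftrightarrow> U = carrier M"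
proof -
  have "carrier (quot_module M U) = {U} \<longleftrightarrow> (\<forall>v \<in> carrier M. U +>\<^bsub>M\<^esub> v = U)"
    unfolding quot_carrier using M.zero_closed by (auto simp: image_iff)
  also have "\<dots> \<longleftrightarrow> U = carrier M"
    using coset_eq_zero_iff[OF U] submoduleE(1)[OF U] by blast
  finally show ?thesis unfolding quot_zero .
qed

end

text \<open>
  The condition in \<open>regular_seq\<close> that the final quotient be nonzero holds for \<open>M \<noteq> 0\<close> by Nakayama's
  lemma.
\<close>
lemma regular_seq_iff:
  assumes R: "noetherian_local_ring R" and M: "M \<in> fg_modules R" "carrier M \<noteq> {\<zero>\<^bsub>M\<^esub>}"
  shows "regular_seq R M xs \<longleftrightarrow> set xs \<subseteq> max_ideal R \<and> nzd_seq M {\<zero>\<^bsub>M\<^esub>} xs"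
proof (cases "set xs \<subseteq> max_ideal R")
  case True
  interpret local_fg_module R M "max_ideal R" by (rule local_fg_moduleI[OF R M(1)])
  have car: "set xs \<subseteq> carrier R" using True mm_carrier by blast
  have quot: "quot_seq R M ys = quot_module M (add_mults M {\<zero>\<^bsub>M\<^esub>} ys)" if "set ys \<subseteq> carrier R" for ys
    unfolding quot_seq_def ideal_smult_eq_add_mults[OF that] ..
  have tak: "set (take i xs) \<subseteq> carrier R" for i using car set_take_subset[of i xs] by blast
  note W = add_mults_submodule[OF zero_submodule]
  have "carrier (quot_seq R M xs) \<noteq> {\<zero>\<^bsub>quot_seq R M xs\<^esub>}"
    unfolding quot[OF car] quot_trivial_iff[OF W[OF car]]
    using add_mults_proper[OF zero_submodule True] M(2) by simp
  moreover have "(\<forall>y \<in> carrier (quot_seq R M (take i xs)).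
        xs ! i \<odot>\<^bsub>quot_seq R M (take i xs)\<^esub> y = \<zero>\<^bsub>quot_seq R M (take i xs)\<^esub>
          \<longrightarrow> y = \<zero>\<^bsub>quot_seq R M (take i xs)\<^esub>) \<longleftrightarrow> nzd_mod M (add_mults M {\<zero>\<^bsub>M\<^esub>} (take i xs)) (xs ! i)"
    if "i < length xs" for i
    unfolding quot[OF tak] by (rule quot_nzd_iff[OF W[OF tak]]) (use that car nth_mem in blast)
  ultimately show ?thesis
    unfolding regular_seq_def nzd_seq_iff_nth using True by simp
next
  case False
  then show ?thesis unfolding regular_seq_def by simp
qed

lemma length_le_depth:
  assumes "carrier M \<noteq> {\<zero>\<^bsub>M\<^esub>}" "regular_seq R M xs"
  shows "enat (length xs) \<le> depth R M"
  unfolding depth_def using assms by (auto intro!: Sup_upper)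

text \<open>
  Rees's theorem bounds the length of every regular sequence by that of one that cannot be
  prolonged. Thus the depth is finite as soon as there is a sequence of the latter kind.
\<close>
lemma depth_le_maximal_nzd_seq:
  assumes R: "noetherian_local_ring R" and M: "M \<in> fg_modules R" "carrier M \<noteq> {\<zero>\<^bsub>M\<^esub>}"
    and xs: "set xs \<subseteq> max_ideal R" "nzd_seq M {\<zero>\<^bsub>M\<^esub>} xs"
    and soc: "\<not> socle_free (max_ideal R) M (add_mults M {\<zero>\<^bsub>M\<^esub>} xs)"
  shows "depth R M \<le> enat (length xs)"
proof -
  interpret M: local_fg_module R M "max_ideal R" by (rule local_fg_moduleI[OF R M(1)])
  have "length ys \<le> length xs" if "regular_seq R M ys" for ys
    using M.nzd_seq_length_le[OF M.zero_submodule xs soc] that regular_seq_iff[OF R M] by blast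
  then show ?thesis unfolding depth_def using M(2) by (auto intro!: Sup_least)
qed

section \<open>Prethick subcategories\<close>

lemma prethick_subset: "prethick R \<XX> \<Longrightarrow> \<XX> \<subseteq> fg_modules R"
  unfolding prethick_def by blast

lemma prethick_summand:
  assumes "prethick R \<XX>" "M \<in> \<XX>" "N \<in> fg_modules R" "N' \<in> fg_modules R" "module_iso R M (direct_sum [N, N'])"
  shows "N \<in> \<XX>"
  using assms unfolding prethick_def by blast

lemma prethick_kernel:
  assumes X: "prethick R \<XX>" and R: "noetherian_ring R" and A: "A \<in> \<XX>" and B: "B \<in> \<XX>"
    and g: "g \<in> module_hom R A B" "g ` carrier A = carrier B"
  shows "A\<lparr>carrier := a_kernel A B g\<rparr> \<in> \<XX>"
proof -
  interpret A: fg_module R A by (rule fg_moduleI[OF R]) (use A prethick_subset[OF X] in blast)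
  have B': "pure_module R B" using B prethick_subset[OF X] fg_modules_iff by blast
  define L where "L = A\<lparr>carrier := a_kernel A B g\<rparr>"
  have "L \<in> fg_modules R"
    unfolding L_def by (rule A.submodule_in_fg_modules[OF A.kernel_submodule[OF B' g(1)]])
  moreover have "short_exact_modules R L A B (\<lambda>x. x) g"
    unfolding short_exact_modules_def
  proof (intro conjI g)
    show "(\<lambda>x. x) \<in> module_hom R L A"
      by (rule module_homI) (simp_all add: L_def a_kernel_iff)
  qed (simp_all add: L_def)
  ultimately have "L \<in> \<XX>" using X A B unfolding prethick_def by blast
  then show ?thesis unfolding L_def .
qed

text \<open>
  The depth zero case. It is enough to know that \<open>A / z A\<close> is in the subcategory for all \<open>z\<close> in
  the maximal ideal that are regular on \<open>R / I\<close>: then \<open>z A\<close> is in it for every \<open>z\<close> that is regular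
  on \<open>R / I\<close> (for a unit it is \<open>A\<close>), and so is the kernel of multiplication by another such \<open>y\<close> from
  \<open>z A\<close> onto \<open>y z A\<close>. For suitable \<open>y\<close> and \<open>z\<close> this kernel is a nonzero vector space, which has the
  residue field as a summand.
\<close>
lemma residue_field_in_prethick:
  fixes A :: "('a, 'b) module"
  assumes R: "noetherian_local_ring R" and X: "prethick R \<XX>" and A: "A \<in> \<XX>"
    and I: "submodule I R (ring_module R)" "socle_free (max_ideal R) (ring_module R) I"
    and soc: "\<not> socle_free (max_ideal R) A {\<zero>\<^bsub>A\<^esub>}"
    and quot: "\<And>z. z \<in> max_ideal R \<Longrightarrow> nzd_mod (ring_module R) I z \<Longrightarrow>
      \<exists>B \<in> \<XX>. \<exists>g \<in> module_hom R A B. g ` carrier A = carrier B \<and> a_kernel A B g = add_mult A {\<zero>\<^bsub>A\<^esub>} z"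
  shows "contains_module R \<XX> (residue_field R)"
proof -
  define \<mm> where "\<mm> = max_ideal R"
  have nr: "noetherian_ring R" and cr: "cring R" using R unfolding noetherian_local_ring_def by blast+
  have Afg: "A \<in> fg_modules R" using A prethick_subset[OF X] by blast
  interpret A: local_fg_module R A \<mm> unfolding \<mm>_def by (rule local_fg_moduleI[OF R Afg])
  have N: "fg_module R (ring_module R)" by (rule fg_moduleI[OF nr cring.ring_module_fg[OF cr]])
  interpret N: fg_module R "ring_module R" by (rule N)
  obtain z y where zy: "z \<in> carrier R" "y \<in> carrier R" "nzd_mod (ring_module R) I z" "nzd_mod (ring_module R) I y"
    and w: "\<exists>w \<in> carrier A. z \<odot>\<^bsub>A\<^esub> w \<noteq> \<zero>\<^bsub>A\<^esub> \<and> y \<odot>\<^bsub>A\<^esub> (z \<odot>\<^bsub>A\<^esub> w) = \<zero>\<^bsub>A\<^esub>"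
    and van: "\<forall>w \<in> carrier A. y \<odot>\<^bsub>A\<^esub> (z \<odot>\<^bsub>A\<^esub> w) = \<zero>\<^bsub>A\<^esub> \<longrightarrow> (\<forall>a \<in> \<mm>. a \<odot>\<^bsub>A\<^esub> (z \<odot>\<^bsub>A\<^esub> w) = \<zero>\<^bsub>A\<^esub>)"
    using A.nzd_with_vector_space_kernel[OF N I[folded \<mm>_def] soc[folded \<mm>_def]] by blast
  define mul where "mul r = add_mult A {\<zero>\<^bsub>A\<^esub>} r" for r
  have mul_iff: "x \<in> mul r \<longleftrightarrow> (\<exists>w \<in> carrier A. x = r \<odot>\<^bsub>A\<^esub> w)" if r: "r \<in> carrier R" for x r
  proof
    assume "x \<in> mul r"
    then obtain u w where "u \<in> {\<zero>\<^bsub>A\<^esub>}" "w \<in> carrier A" "x = u \<oplus>\<^bsub>A\<^esub> r \<odot>\<^bsub>A\<^esub> w"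
      unfolding mul_def by (rule A.add_multE)
    then show "\<exists>w \<in> carrier A. x = r \<odot>\<^bsub>A\<^esub> w" using r by (intro bexI[of _ w]) simp_all
  next
    assume "\<exists>w \<in> carrier A. x = r \<odot>\<^bsub>A\<^esub> w"
    then show "x \<in> mul r"
      unfolding mul_def using A.smult_in_add_mult[OF A.zero_submodule r] by blast
  qed
  have mul: "submodule (mul r) R A" if "r \<in> carrier R" for r
    unfolding mul_def by (rule A.add_mult_submodule[OF A.zero_submodule that])
  have mulX: "A\<lparr>carrier := mul r\<rparr> \<in> \<XX>" if r: "r \<in> carrier R" "nzd_mod (ring_module R) I r" for r
  proof (cases "r \<in> \<mm>")
    case True
    then obtain B g where "B \<in> \<XX>" "g \<in> module_hom R A B" "g ` carrier A = carrier B" "a_kernel A B g = mul r"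
      using quot r(2) unfolding \<mm>_def mul_def by blast
    then show ?thesis using prethick_kernel[OF X nr A] by metis
  next
    case False
    then have u: "r \<in> Units R" by (rule A.units[OF r(1)])
    have "w \<in> mul r" if w: "w \<in> carrier A" for w
      by (rule A.unit_smult_in_submodule[OF mul[OF r(1)] u w]) (use mul_iff[OF r(1)] w in blast)
    then have "mul r = carrier A" using A.submoduleE(1)[OF mul[OF r(1)]] by blast
    then show ?thesis using A by simp
  qed
  define Z where "Z = A\<lparr>carrier := mul z\<rparr>"
  define Y where "Y = A\<lparr>carrier := mul (y \<otimes>\<^bsub>R\<^esub> z)\<rparr>"
  have yzc: "y \<otimes>\<^bsub>R\<^esub> z \<in> carrier R" using zy by simp
  have ZX: "Z \<in> \<XX>" unfolding Z_def by (rule mulX[OF zy(1,3)])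
  have YX: "Y \<in> \<XX>"
    unfolding Y_def by (rule mulX[OF yzc N.nzd_mod_mult[OF zy(4,3,2,1)]])
  have Zc: "x \<in> carrier A" if "x \<in> carrier Z" for x
    using A.submodule_carrier[OF mul[OF zy(1)]] that unfolding Z_def by simp
  have mulh: "(\<lambda>x. y \<odot>\<^bsub>A\<^esub> x) \<in> module_hom R Z Y"
  proof (rule module_homI)
    fix x assume x: "x \<in> carrier Z"
    then obtain w where "w \<in> carrier A" "x = z \<odot>\<^bsub>A\<^esub> w" using mul_iff[OF zy(1)] unfolding Z_def by auto
    then have "y \<odot>\<^bsub>A\<^esub> x = (y \<otimes>\<^bsub>R\<^esub> z) \<odot>\<^bsub>A\<^esub> w" using zy by (simp add: A.smult_assoc1)
    then show "y \<odot>\<^bsub>A\<^esub> x \<in> carrier Y" using mul_iff[OF yzc] \<open>w \<in> carrier A\<close> unfolding Y_def by auto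
    show "y \<odot>\<^bsub>A\<^esub> (a \<odot>\<^bsub>Z\<^esub> x) = a \<odot>\<^bsub>Y\<^esub> (y \<odot>\<^bsub>A\<^esub> x)" if "a \<in> carrier R" for a
      using A.smult_commute[OF zy(2) that Zc[OF x]] unfolding Z_def Y_def by simp
    show "y \<odot>\<^bsub>A\<^esub> (x \<oplus>\<^bsub>Z\<^esub> x') = y \<odot>\<^bsub>A\<^esub> x \<oplus>\<^bsub>Y\<^esub> y \<odot>\<^bsub>A\<^esub> x'" if "x' \<in> carrier Z" for x'
      using A.smult_r_distr[OF zy(2) Zc[OF x] Zc[OF that]] unfolding Z_def Y_def by simp
  qed
  have surj: "(\<lambda>x. y \<odot>\<^bsub>A\<^esub> x) ` carrier Z = carrier Y"
  proof
    show "(\<lambda>x. y \<odot>\<^bsub>A\<^esub> x) ` carrier Z \<subseteq> carrier Y" using module_homD(1)[OF mulh] by blast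
    show "carrier Y \<subseteq> (\<lambda>x. y \<odot>\<^bsub>A\<^esub> x) ` carrier Z"
    proof
      fix x assume "x \<in> carrier Y"
      then obtain w where w: "w \<in> carrier A" "x = (y \<otimes>\<^bsub>R\<^esub> z) \<odot>\<^bsub>A\<^esub> w"
        using mul_iff[OF yzc] unfolding Y_def by auto
      then have "x = y \<odot>\<^bsub>A\<^esub> (z \<odot>\<^bsub>A\<^esub> w)" using zy by (simp add: A.smult_assoc1)
      moreover have "z \<odot>\<^bsub>A\<^esub> w \<in> carrier Z" using mul_iff[OF zy(1)] w(1) unfolding Z_def by auto
      ultimately show "x \<in> (\<lambda>x. y \<odot>\<^bsub>A\<^esub> x) ` carrier Z" by blast
    qed
  qed
  define K where "K = a_kernel Z Y (\<lambda>x. y \<odot>\<^bsub>A\<^esub> x)"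
  define V where "V = A\<lparr>carrier := K\<rparr>"
  have K_iff: "x \<in> K \<longleftrightarrow> x \<in> mul z \<and> y \<odot>\<^bsub>A\<^esub> x = \<zero>\<^bsub>A\<^esub>" for x
    unfolding K_def a_kernel_iff Z_def Y_def by simp
  have "Z\<lparr>carrier := K\<rparr> \<in> \<XX>"
    using prethick_kernel[OF X nr ZX YX mulh surj] unfolding K_def .
  moreover have "Z\<lparr>carrier := K\<rparr> = V" unfolding V_def Z_def by simp
  ultimately have VX: "V \<in> \<XX>" by simp
  then have Vfg: "V \<in> fg_modules R" using prethick_subset[OF X] by blast
  interpret V: local_fg_module R V \<mm> unfolding \<mm>_def by (rule local_fg_moduleI[OF R Vfg])
  have kill: "a \<odot>\<^bsub>V\<^esub> x = \<zero>\<^bsub>V\<^esub>" if a: "a \<in> \<mm>" and x: "x \<in> carrier V" for a x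
  proof -
    obtain w where "w \<in> carrier A" "x = z \<odot>\<^bsub>A\<^esub> w" "y \<odot>\<^bsub>A\<^esub> x = \<zero>\<^bsub>A\<^esub>"
      using x mul_iff[OF zy(1)] unfolding V_def by (auto simp: K_iff)
    then show ?thesis using van a unfolding V_def by simp
  qed
  obtain w where w: "w \<in> carrier A" "z \<odot>\<^bsub>A\<^esub> w \<noteq> \<zero>\<^bsub>A\<^esub>" "y \<odot>\<^bsub>A\<^esub> (z \<odot>\<^bsub>A\<^esub> w) = \<zero>\<^bsub>A\<^esub>"
    using w by blast
  define v where "v = z \<odot>\<^bsub>A\<^esub> w"
  have v: "v \<in> carrier V" "v \<noteq> \<zero>\<^bsub>V\<^esub>"
    using w mul_iff[OF zy(1)] unfolding V_def v_def by (auto simp: K_iff)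
  \<comment> \<open>The line \<open>P\<close> through \<open>v\<close> is a copy of the residue field: \<open>p\<close> below maps \<open>R\<close> onto it with kernel \<open>\<mm>\<close>.\<close>
  define P where "P = add_cyclic R V {\<zero>\<^bsub>V\<^esub>} v"
  have P: "submodule P R V" unfolding P_def by (rule V.add_cyclic_submodule[OF V.zero_submodule v(1)])
  obtain Q where Q: "submodule Q R V" "P \<inter> Q = {\<zero>\<^bsub>V\<^esub>}"
    "\<forall>w \<in> carrier V. \<exists>p \<in> P. \<exists>q \<in> Q. w = p \<oplus>\<^bsub>V\<^esub> q"
    using V.cyclic_complement[OF kill v] unfolding P_def by blast
  have "module_iso R V (direct_sum [V\<lparr>carrier := P\<rparr>, V\<lparr>carrier := Q\<rparr>])"
    by (rule V.internal_direct_sum[OF P Q(1,2)]) (use Q(3) in blast)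
  then have PX: "V\<lparr>carrier := P\<rparr> \<in> \<XX>"
    by (rule prethick_summand[OF X VX V.submodule_in_fg_modules[OF P] V.submodule_in_fg_modules[OF Q(1)]])
  have Pp: "pure_module R (V\<lparr>carrier := P\<rparr>)" by (rule V.submodule_pure_module[OF P])
  have P_iff: "x \<in> P \<longleftrightarrow> (\<exists>a \<in> carrier R. x = a \<odot>\<^bsub>V\<^esub> v)" for x
  proof
    assume "x \<in> P"
    then obtain u a where "u \<in> {\<zero>\<^bsub>V\<^esub>}" "a \<in> carrier R" "x = u \<oplus>\<^bsub>V\<^esub> a \<odot>\<^bsub>V\<^esub> v"
      unfolding P_def by (rule V.add_cyclicE)
    then show "\<exists>a \<in> carrier R. x = a \<odot>\<^bsub>V\<^esub> v" using v(1) by (intro bexI[of _ a]) simp_all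
  next
    assume "\<exists>a \<in> carrier R. x = a \<odot>\<^bsub>V\<^esub> v"
    then show "x \<in> P"
      using V.submoduleE(4)[OF P] V.add_cyclic_superset(2)[OF V.zero_submodule v(1)] unfolding P_def by blast
  qed
  define p where "p a = a \<odot>\<^bsub>V\<^esub> v" for a
  have ph: "p \<in> module_hom R (ring_module R) (V\<lparr>carrier := P\<rparr>)"
  proof (rule module_homI)
    fix a assume "a \<in> carrier (ring_module R)"
    then show "p a \<in> carrier (V\<lparr>carrier := P\<rparr>)" unfolding p_def by (auto simp: P_iff)
  qed (use v(1) in \<open>simp_all add: p_def V.smult_l_distr V.smult_assoc1\<close>)
  have "p ` carrier R = P" unfolding p_def by (auto simp: P_iff)
  moreover have "a_kernel (ring_module R) (V\<lparr>carrier := P\<rparr>) p = \<mm>"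
  proof -
    have "a \<in> \<mm>" if a: "a \<in> carrier R" "a \<odot>\<^bsub>V\<^esub> v = \<zero>\<^bsub>V\<^esub>" for a
    proof (rule ccontr)
      assume "a \<notin> \<mm>"
      then have "v \<in> {\<zero>\<^bsub>V\<^esub>}"
        using V.unit_smult_in_submodule[OF V.zero_submodule V.units[OF a(1)] v(1)] a(2) by simp
      then show False using v(2) by simp
    qed
    then show ?thesis using kill v(1) V.mm_carrier by (auto simp: a_kernel_iff p_def)
  qed
  moreover have "submodule \<mm> R (ring_module R)"
    unfolding cring.submodule_ring_module_iff[OF cr] by (rule V.max_ideal)
  ultimately have "module_iso R (residue_field R) (V\<lparr>carrier := P\<rparr>)"
    unfolding residue_field_def \<mm>_def[symmetric]
    by (intro N.surjection_imp_quot_iso[OF _ Pp ph]) simp_all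
  then show ?thesis unfolding contains_module_def using PX by blast
qed

lemma contains_quot_seq_imp_surjection:
  assumes R: "noetherian_local_ring R" and X: "prethick R \<XX>" and M: "M \<in> fg_modules R"
    and xs: "set xs \<subseteq> max_ideal R" and con: "contains_module R \<XX> (quot_seq R M xs)"
  shows "\<exists>A \<in> \<XX>. \<exists>p \<in> module_hom R M A. p ` carrier M = carrier A \<and>
    a_kernel M A p = add_mults M {\<zero>\<^bsub>M\<^esub>} xs"
proof -
  interpret M: local_fg_module R M "max_ideal R" by (rule local_fg_moduleI[OF R M])
  have car: "set xs \<subseteq> carrier R" using xs M.mm_carrier by blast
  obtain A where A: "A \<in> \<XX>" "module_iso R (quot_seq R M xs) A" using con unfolding contains_module_def by blast
  have "pure_module R A" using A(1) prethick_subset[OF X] fg_modules_iff by blast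
  from M.quot_iso_imp_surjection[OF M.add_mults_submodule[OF M.zero_submodule car] this]
  show ?thesis using A unfolding quot_seq_def M.ideal_smult_eq_add_mults[OF car] by blast
qed

text \<open>
  Here \<open>A\<close> is a copy of \<open>M / U\<close> and \<open>B\<close> is a copy of \<open>M / (U + z M)\<close>, so that \<open>B\<close> is a copy of \<open>A / z A\<close>.
\<close>
lemma induced_surjection:
  assumes M: "pure_module R M" and A: "pure_module R A" and B: "pure_module R B"
    and U: "submodule U R M" and z: "z \<in> carrier R"
    and p: "p \<in> module_hom R M A" "p ` carrier M = carrier A" "a_kernel M A p = U"
    and q: "q \<in> module_hom R M B" "q ` carrier M = carrier B" "a_kernel M B q = add_mult M U z"
  shows "\<exists>g \<in> module_hom R A B. g ` carrier A = carrier B \<and> a_kernel A B g = add_mult A {\<zero>\<^bsub>A\<^esub>} z"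
proof -
  interpret M: pure_module R M by (rule M)
  interpret A: pure_module R A by (rule A)
  obtain g where g: "g \<in> module_hom R A B" "\<forall>v \<in> carrier M. g (p v) = q v"
    using surjection_factors[OF A B M p(1,2) q(1)] M.add_mult_superset[OF U z] unfolding p(3) q(3) by blast
  have "g ` carrier A = carrier B"
    unfolding p(2)[symmetric] q(2)[symmetric] image_image by (rule image_cong) (use g(2) in simp_all)
  moreover have "x \<in> a_kernel A B g \<longleftrightarrow> x \<in> add_mult A {\<zero>\<^bsub>A\<^esub>} z" if x: "x \<in> carrier A" for x
  proof -
    obtain v where v: "v \<in> carrier M" "x = p v" using x p(2) by blast
    have "x \<in> a_kernel A B g \<longleftrightarrow> v \<in> a_kernel M B q" using v x g(2) by (simp add: a_kernel_iff)
    also have "\<dots> \<longleftrightarrow> x \<in> add_mult A {\<zero>\<^bsub>A\<^esub>} z"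
      unfolding q(3)
    proof
      assume "v \<in> add_mult M U z"
      then obtain u w where uw: "u \<in> U" "w \<in> carrier M" "v = u \<oplus>\<^bsub>M\<^esub> z \<odot>\<^bsub>M\<^esub> w" by (rule M.add_multE)
      have u: "u \<in> carrier M" "p u = \<zero>\<^bsub>A\<^esub>" using uw(1) unfolding p(3)[symmetric] by (simp_all add: a_kernel_iff)
      have "x = \<zero>\<^bsub>A\<^esub> \<oplus>\<^bsub>A\<^esub> z \<odot>\<^bsub>A\<^esub> p w"
        using u uw(2) z unfolding v(2) uw(3) by (simp add: module_homD[OF p(1)])
      then show "x \<in> add_mult A {\<zero>\<^bsub>A\<^esub>} z"
        using A.add_multI[OF singletonI module_homD(1)[OF p(1) uw(2)]] by simp
    next
      assume "x \<in> add_mult A {\<zero>\<^bsub>A\<^esub>} z"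
      then obtain u a where ua: "u \<in> {\<zero>\<^bsub>A\<^esub>}" "a \<in> carrier A" "x = u \<oplus>\<^bsub>A\<^esub> z \<odot>\<^bsub>A\<^esub> a" by (rule A.add_multE)
      obtain w where w: "w \<in> carrier M" "a = p w" using ua(2) p(2) by blast
      have zw: "z \<odot>\<^bsub>M\<^esub> w \<in> carrier M" using z w by simp
      have "p v = p (z \<odot>\<^bsub>M\<^esub> w)" using ua w z v(2) by (simp add: module_homD[OF p(1)])
      then have "v \<ominus>\<^bsub>M\<^esub> z \<odot>\<^bsub>M\<^esub> w \<in> U"
        using module_hom_eq_iff[OF M A p(1) v(1) zw] p(3) by simp
      then have "(v \<ominus>\<^bsub>M\<^esub> z \<odot>\<^bsub>M\<^esub> w) \<oplus>\<^bsub>M\<^esub> z \<odot>\<^bsub>M\<^esub> w \<in> add_mult M U z" by (rule M.add_multI) (rule w(1))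
      moreover have "(v \<ominus>\<^bsub>M\<^esub> z \<odot>\<^bsub>M\<^esub> w) \<oplus>\<^bsub>M\<^esub> z \<odot>\<^bsub>M\<^esub> w = v"
        using v(1) zw by (simp add: a_minus_def M.M.a_assoc M.M.l_neg)
      ultimately show "v \<in> add_mult M U z" by simp
    qed
    finally show ?thesis .
  qed
  moreover have "add_mult A {\<zero>\<^bsub>A\<^esub>} z \<subseteq> carrier A"
    using A.submoduleE(1)[OF A.add_mult_submodule[OF A.zero_submodule z]] .
  ultimately show ?thesis using g(1) by (intro bexI[of _ g]) (auto simp: a_kernel_iff)
qed

theorem theorem1p2:
  fixes R :: "('a, 'r) ring_scheme"
    and \<XX> :: "('a, 'b) module set"
    and M :: "('a, 'b) module"
  assumes "noetherian_local_ring R"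
    and "prethick R \<XX>"
    and "M \<in> fg_modules R"
    and "depth R (ring_module R) \<ge> depth R M + 1"
    and "\<And>i xs. enat i \<le> depth R M + 1 \<Longrightarrow> length xs = i \<Longrightarrow> regular_seq R (ring_module R) xs \<Longrightarrow>
           contains_module R \<XX> (quot_seq R M xs)"
  shows "contains_module R \<XX> (residue_field R)"
proof -
  note R = assms(1) and X = assms(2) and M = assms(3)
  define \<mm> where "\<mm> = max_ideal R"
  have cr: "cring R" using R unfolding noetherian_local_ring_def by blast
  note Nfg = cring.ring_module_fg[OF cr]
  note Mloc = local_fg_moduleI[OF R M, folded \<mm>_def] and Nloc = local_fg_moduleI[OF R Nfg, folded \<mm>_def]
  interpret M: local_fg_module R M \<mm> by (rule Mloc)
  interpret N: local_fg_module R "ring_module R" \<mm> by (rule Nloc)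
  have "\<one>\<^bsub>R\<^esub> \<noteq> \<zero>\<^bsub>R\<^esub>"
    using N.one_notin additive_subgroup.zero_closed[OF ideal.axioms(1)[OF N.max_ideal]] by metis
  then have Nne: "carrier (ring_module R) \<noteq> {\<zero>\<^bsub>ring_module R\<^esub>}" using M.R.one_closed by auto
  note N0 = N.zero_submodule and M0 = M.zero_submodule
  \<comment> \<open>Any maximal regular sequence on \<open>R\<close> shows that the depths of \<open>R\<close> and \<open>M\<close> are finite, so that \<open>M \<noteq> 0\<close>.\<close>
  obtain ys where ys: "set ys \<subseteq> \<mm>" "nzd_seq (ring_module R) {\<zero>\<^bsub>ring_module R\<^esub>} ys"
    "\<not> socle_free \<mm> (ring_module R) (add_mults (ring_module R) {\<zero>\<^bsub>ring_module R\<^esub>} ys)"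
    using common_maximal_nzd_seq[OF Nloc N.fg_module_axioms N0 Nne[symmetric] N0] by blast
  have "depth R (ring_module R) \<le> enat (length ys)"
    using depth_le_maximal_nzd_seq[OF R Nfg Nne] ys unfolding \<mm>_def by blast
  then have "depth R M + 1 \<le> enat (length ys)" using assms(4) by (rule order.trans[rotated])
  then have fin: "depth R M \<noteq> \<infinity>" by (intro notI) simp
  then have Mne: "carrier M \<noteq> {\<zero>\<^bsub>M\<^esub>}" unfolding depth_def by auto
  obtain t where t: "depth R M = enat t" using fin by auto
  obtain xs where xs: "set xs \<subseteq> \<mm>" "nzd_seq (ring_module R) {\<zero>\<^bsub>ring_module R\<^esub>} xs" "nzd_seq M {\<zero>\<^bsub>M\<^esub>} xs"
    and soc: "\<not> (socle_free \<mm> (ring_module R) (add_mults (ring_module R) {\<zero>\<^bsub>ring_module R\<^esub>} xs) \<and>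
      socle_free \<mm> M (add_mults M {\<zero>\<^bsub>M\<^esub>} xs))"
    using common_maximal_nzd_seq[OF Nloc M.fg_module_axioms N0 Nne[symmetric] M0] by blast
  define I where "I = add_mults (ring_module R) {\<zero>\<^bsub>ring_module R\<^esub>} xs"
  define W where "W = add_mults M {\<zero>\<^bsub>M\<^esub>} xs"
  have car: "set xs \<subseteq> carrier R" using xs(1) M.mm_carrier by blast
  have I: "submodule I R (ring_module R)" and W: "submodule W R M"
    unfolding I_def W_def using N.add_mults_submodule[OF N0 car] M.add_mults_submodule[OF M0 car] .
  have "enat (length xs) \<le> depth R M"
    by (rule length_le_depth[OF Mne]) (use regular_seq_iff[OF R M Mne] xs in \<open>simp add: \<mm>_def\<close>)
  then have len: "length xs \<le> t" using t by simp
  \<comment> \<open>If \<open>R / I\<close> had a socle, the depth of \<open>R\<close> would be at most the length of \<open>xs\<close>, hence at most that of \<open>M\<close>.\<close>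
  have freeI: "socle_free \<mm> (ring_module R) I"
  proof (rule ccontr)
    assume "\<not> ?thesis"
    then have "depth R (ring_module R) \<le> enat (length xs)"
      using depth_le_maximal_nzd_seq[OF R Nfg Nne] xs unfolding \<mm>_def I_def by blast
    then have "enat t + 1 \<le> enat (length xs)" using assms(4) unfolding t by (rule order.trans[rotated])
    then show False using len by (simp add: one_enat_def)
  qed
  then have socW: "\<not> socle_free \<mm> M W" using soc unfolding I_def W_def by blast
  have in_X: "\<exists>A \<in> \<XX>. \<exists>p \<in> module_hom R M A. p ` carrier M = carrier A \<and>
      a_kernel M A p = add_mults M {\<zero>\<^bsub>M\<^esub>} zs"
    if zs: "set zs \<subseteq> \<mm>" "nzd_seq (ring_module R) {\<zero>\<^bsub>ring_module R\<^esub>} zs" "length zs \<le> t + 1" for zs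
  proof (rule contains_quot_seq_imp_surjection[OF R X M])
    show "set zs \<subseteq> max_ideal R" using zs(1) unfolding \<mm>_def .
    show "contains_module R \<XX> (quot_seq R M zs)"
    proof (rule assms(5)[OF _ refl])
      show "enat (length zs) \<le> depth R M + 1" using zs(3) unfolding t by (simp add: one_enat_def)
      show "regular_seq R (ring_module R) zs"
        using regular_seq_iff[OF R Nfg Nne] zs unfolding \<mm>_def by simp
    qed
  qed
  obtain A p where A: "A \<in> \<XX>" and p: "p \<in> module_hom R M A" "p ` carrier M = carrier A" "a_kernel M A p = W"
    using in_X[OF xs(1,2)] len unfolding W_def by auto
  have pm: "pure_module R A" if "A \<in> \<XX>" for A using that prethick_subset[OF X] fg_modules_iff by blast
  have "\<not> socle_free \<mm> A {\<zero>\<^bsub>A\<^esub>}"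
  proof -
    obtain v where v: "v \<in> carrier M" "v \<notin> W" "\<forall>a \<in> \<mm>. a \<odot>\<^bsub>M\<^esub> v \<in> W"
      using socW unfolding socle_free_def by blast
    have "a \<odot>\<^bsub>A\<^esub> p v \<in> {\<zero>\<^bsub>A\<^esub>}" if a: "a \<in> \<mm>" for a
    proof -
      have "a \<odot>\<^bsub>M\<^esub> v \<in> a_kernel M A p" using v(3) a p(3) by blast
      then show ?thesis using module_homD(3)[OF p(1) M.mm_carrier[OF a] v(1)] by (simp add: a_kernel_iff)
    qed
    moreover have "p v \<in> carrier A" by (rule module_homD(1)[OF p(1) v(1)])
    moreover have "p v \<notin> {\<zero>\<^bsub>A\<^esub>}" using v(1,2) unfolding p(3)[symmetric] by (simp add: a_kernel_iff)
    ultimately show ?thesis unfolding socle_free_def by blast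
  qed
  moreover have "\<exists>B \<in> \<XX>. \<exists>g \<in> module_hom R A B. g ` carrier A = carrier B \<and>
      a_kernel A B g = add_mult A {\<zero>\<^bsub>A\<^esub>} z"
    if z: "z \<in> \<mm>" "nzd_mod (ring_module R) I z" for z
  proof -
    have "nzd_seq (ring_module R) {\<zero>\<^bsub>ring_module R\<^esub>} (xs @ [z])"
      unfolding N.nzd_seq_snoc using xs(2) z(2) unfolding I_def by simp
    then obtain B q where B: "B \<in> \<XX>"
      and q: "q \<in> module_hom R M B" "q ` carrier M = carrier B" "a_kernel M B q = add_mult M W z"
      using in_X[of "xs @ [z]"] xs(1) z(1) len unfolding M.add_mults_snoc W_def by auto
    from induced_surjection[OF M.pure_module_axioms pm[OF A] pm[OF B] W M.mm_carrier[OF z(1)] p q] B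
    show ?thesis by blast
  qed
  ultimately show ?thesis
    using residue_field_in_prethick[OF R X A I] freeI unfolding \<mm>_def by blast
qed

end
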